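(* Let $Z,\tilde Z:[0,1]\to\mathbb R^d$ be absolutely continuous paths such that $\mathbf c_{\le2}(Z)$ and $\mathbf c_{\le2}(\tilde Z)$ lie in $\mathcal U_{d;\le 2}$. Define $Y=\tilde\rho_d(\mathbf c_{\le2}(Z))\,Z$ and $\tilde Y=\tilde\rho_d(\mathbf c_{\le2}(\tilde Z))\,\tilde Z$. Then $S(Y)=S(\tilde Y)$ if and only if there exists $g\in O_d(\mathbb R)$ such that $S(gZ)=S(\tilde Z)$.
   Context: Fix $d\ge2$. For an absolutely continuous path $Z=(Z^1,\dots,Z^d):[0,1]\to\mathbb R^d$ and a word $w=w_1\cdots w_k$ over $\{1,\dots,d\}$, set $\langle S(Z),w\rangle=\int_{0<s_1<\dots<s_k<1}\dot Z^{w_1}(s_1)\cdots\dot Z^{w_k}(s_k)\,ds_1\cdots ds_k$ (and $1$ for the empty word); $S(Z)$ is the iterated-integrals signature, a formal series $\sum_w\langle S(Z),w\rangle w$. Its logarithm $\log S(Z)=\sum_{m\ge1}\frac{(-1)^{m-1}}{m}(S(Z)-1)^m$ (concatenation product of formal series) is a Lie series. Let $\mathbf c_{\le2}(Z)$ denote the projection of $\log S(Z)$ to word-length $\le2$, written in coordinates $c_i$ ($1\le i\le d$) and $c_{ij}$ ($i<j$) as $\sum_i c_i\,i+\sum_{i<j}c_{ij}[i,j]$; identify it with $(v,M)\in\mathbb R^d\oplus\mathfrak{so}(d,\mathbb R)$, $v=(c_1,\dots,c_d)^\top$, $M_{ij}=c_{ij}=-M_{ji}$. $O_d(\mathbb R)$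 acts on such pairs by $A\cdot(v,M)=(Av,AMA^\top)$ and on paths by $(AZ)_t=AZ_t$. $\mathcal U_{d;\le2}$: on $V_{\mathbb C}=\mathbb C^d\oplus\mathfrak{so}(d,\mathbb C)$ with $O_d(\mathbb C)=\{A:AA^\top=I\}$ acting the same way, let $L^{(1)}=\{c_1=\dots=c_{d-1}=0\}$ and for $2\le i\le d-1$, $L^{(i)}=\{(v,M)\in L^{(i-1)}: c_{k(d-i+2)}=0,\ 1\le k\le d-i\}$. Let $f_1=c_1^2+\dots+c_d^2$; for $2\le i\le d-1$ let $f_i$ be the $O_d(\mathbb C)$-invariant rational function whose restriction to $L^{(i-1)}$ is $c_{1(d-i+2)}^2+\dots+c_{(d-i+1)(d-i+2)}^2$; let $f_d$ be the one whose restriction to $L^{(d-1)}$ is $c_{12}^2$ (these exist, have real coefficients and are uniquely determined). $\mathcal U_{d;\le2}$ is the set of real $(v,M)$ in the domain of all $f_k$ with all $f_k(v,M)\neq0$. $\mathcal K_{d;\le2}=\{(v,M): c_i=0\ (i\le d-1),\ c_{j(i+1)}=0\ (1\le j<i\le d-1),\ c_d>0,\ c_{i(i+1)}>0\ (i\le d-1)\}$. $\tilde\rho_d:\mathcal U_{d;\le2}\to O_d(\mathbb R)$ is the moving frame assigning to $\mathbf c$ the unique $g\in O_d(\mathbb R)$ with $g\cdot\mathbf c\in\mathcal K_{d;\le2}$ (it exists and is unique on $\mathcal U_{d;\le2}$). *)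

theory Defs
  imports "HOL-Analysis.Analysis"
begin

text \<open>Paths Z : [0,1] -> R^d are encoded as Z :: real => nat => real, coordinate i
  (1 <= i <= d) at time t being Z t i. Words over {1..d} are nat lists.\<close>

definition abs_cont_on :: "real \<Rightarrow> real \<Rightarrow> (real \<Rightarrow> real) \<Rightarrow> bool" where
  "abs_cont_on a b f \<longleftrightarrow>
     (\<forall>\<epsilon>>0. \<exists>\<delta>>0. \<forall>(n::nat) (x::nat \<Rightarrow> real) y.
        (\<forall>k<n. a \<le> x k \<and> x k < y k \<and> y k \<le> b) \<and>
        (\<forall>k<n. \<forall>l<n. k \<noteq> l \<longrightarrow> y k \<le> x l \<or> y l \<le> x k) \<and>
        (\<Sum>k<n. y k - x k) < \<delta>
        \<longrightarrow> (\<Sum>k<n. \<bar>f (y k) - f (x k)\<bar>) < \<epsilon>)"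

definition abs_cont_path :: "nat \<Rightarrow> (real \<Rightarrow> nat \<Rightarrow> real) \<Rightarrow> bool" where
  "abs_cont_path d Z \<longleftrightarrow> (\<forall>i\<in>{1..d}. abs_cont_on 0 1 (\<lambda>t. Z t i))"

text \<open>Iterated integral over a reversed word: the head of the list is the last letter.\<close>
fun iter_int :: "(real \<Rightarrow> nat \<Rightarrow> real) \<Rightarrow> nat list \<Rightarrow> real \<Rightarrow> real" where
  "iter_int Z [] t = 1"
| "iter_int Z (a # ws) t =
     integral {0..t} (\<lambda>s. iter_int Z ws s * deriv (\<lambda>r. Z r a) s)"

definition sig :: "(real \<Rightarrow> nat \<Rightarrow> real) \<Rightarrow> nat list \<Rightarrow> real" where
  "sig Z w = iter_int Z (rev w) 1"

definition sig_eq :: "nat \<Rightarrow> (real \<Rightarrow> nat \<Rightarrow> real) \<Rightarrow> (real \<Rightarrow> nat \<Rightarrow> real) \<Rightarrow> bool" where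
  "sig_eq d Z Z' \<longleftrightarrow> (\<forall>w. set w \<subseteq> {1..d} \<longrightarrow> sig Z w = sig Z' w)"

definition ser_mult :: "(nat list \<Rightarrow> real) \<Rightarrow> (nat list \<Rightarrow> real) \<Rightarrow> nat list \<Rightarrow> real" where
  "ser_mult a b w = (\<Sum>k\<le>length w. a (take k w) * b (drop k w))"

definition ser_one :: "nat list \<Rightarrow> real" where
  "ser_one w = (if w = [] then 1 else 0)"

fun ser_pow :: "(nat list \<Rightarrow> real) \<Rightarrow> nat \<Rightarrow> nat list \<Rightarrow> real" where
  "ser_pow a 0 = ser_one"
| "ser_pow a (Suc m) = ser_mult a (ser_pow a m)"

text \<open>log S = sum_{m>=1} (-1)^(m-1)/m (S-1)^m.  When S has constant coefficient 1,
  (S-1)^m has no words of length < m, so the coefficient at w is the finite sum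
  over 1 <= m <= length w (exactly, not an approximation).\<close>
definition ser_log :: "(nat list \<Rightarrow> real) \<Rightarrow> nat list \<Rightarrow> real" where
  "ser_log S w = (\<Sum>m\<in>{1..length w}.
      (-1) ^ (m - 1) / real m * ser_pow (\<lambda>u. S u - ser_one u) m w)"

text \<open>Points (v, M) of R^d (+) so(d): v i for 1<=i<=d, and M given by its
  upper-triangular coordinates m i j = c_ij for 1<=i<j<=d.\<close>
type_synonym 'a pt = "(nat \<Rightarrow> 'a) \<times> (nat \<Rightarrow> nat \<Rightarrow> 'a)"

definition logsig2 :: "(real \<Rightarrow> nat \<Rightarrow> real) \<Rightarrow> real pt" where
  "logsig2 Z = (\<lambda>i. ser_log (sig Z) [i], \<lambda>i j. ser_log (sig Z) [i, j])"

definition skew :: "(nat \<Rightarrow> nat \<Rightarrow> 'a::comm_ring_1) \<Rightarrow> nat \<Rightarrow> nat \<Rightarrow> 'a" where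
  "skew m k l = (if k < l then m k l else if l < k then - m l k else 0)"

definition act :: "nat \<Rightarrow> (nat \<Rightarrow> nat \<Rightarrow> 'a::comm_ring_1) \<Rightarrow> 'a pt \<Rightarrow> 'a pt" where
  "act d A p = (\<lambda>i. \<Sum>k\<in>{1..d}. A i k * fst p k,
                \<lambda>i j. \<Sum>k\<in>{1..d}. \<Sum>l\<in>{1..d}. A i k * skew (snd p) k l * A j l)"

definition orth :: "nat \<Rightarrow> (nat \<Rightarrow> nat \<Rightarrow> 'a::comm_ring_1) \<Rightarrow> bool" where
  "orth d A \<longleftrightarrow> (\<forall>i\<in>{1..d}. \<forall>j\<in>{1..d}.
       (\<Sum>k\<in>{1..d}. A i k * A j k) = (if i = j then 1 else 0))"

text \<open>Real orthogonal matrices, with entries outside the index range fixed to 0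
  (so that a d x d matrix has a unique representative).\<close>
definition orth_real :: "nat \<Rightarrow> (nat \<Rightarrow> nat \<Rightarrow> real) \<Rightarrow> bool" where
  "orth_real d g \<longleftrightarrow> orth d g \<and> (\<forall>i j. i \<notin> {1..d} \<or> j \<notin> {1..d} \<longrightarrow> g i j = 0)"

definition path_act :: "nat \<Rightarrow> (nat \<Rightarrow> nat \<Rightarrow> real) \<Rightarrow> (real \<Rightarrow> nat \<Rightarrow> real) \<Rightarrow> real \<Rightarrow> nat \<Rightarrow> real" where
  "path_act d g Z = (\<lambda>t i. \<Sum>k\<in>{1..d}. g i k * Z t k)"

inductive_set polyfun :: "nat \<Rightarrow> (complex pt \<Rightarrow> complex) set" for d where
  pconst: "(\<lambda>_. complex_of_real r) \<in> polyfun d"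
| pvar1: "i \<in> {1..d} \<Longrightarrow> (\<lambda>p. fst p i) \<in> polyfun d"
| pvar2: "1 \<le> i \<Longrightarrow> i < j \<Longrightarrow> j \<le> d \<Longrightarrow> (\<lambda>p. snd p i j) \<in> polyfun d"
| padd: "P \<in> polyfun d \<Longrightarrow> Q \<in> polyfun d \<Longrightarrow> (\<lambda>p. P p + Q p) \<in> polyfun d"
| pmult: "P \<in> polyfun d \<Longrightarrow> Q \<in> polyfun d \<Longrightarrow> (\<lambda>p. P p * Q p) \<in> polyfun d"

definition frac :: "nat \<Rightarrow> ((complex pt \<Rightarrow> complex) \<times> (complex pt \<Rightarrow> complex)) set" where
  "frac d = {(P, Q). P \<in> polyfun d \<and> Q \<in> polyfun d \<and> (\<exists>p. Q p \<noteq> 0)}"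

definition ratclass :: "nat \<Rightarrow> (complex pt \<Rightarrow> complex) \<Rightarrow> (complex pt \<Rightarrow> complex)
    \<Rightarrow> ((complex pt \<Rightarrow> complex) \<times> (complex pt \<Rightarrow> complex)) set" where
  "ratclass d P Q = {(P', Q') \<in> frac d. \<forall>p. P p * Q' p = P' p * Q p}"

fun Lset :: "nat \<Rightarrow> nat \<Rightarrow> complex pt set" where
  "Lset d 0 = UNIV"
| "Lset d (Suc 0) = {p. \<forall>i\<in>{1..d-1}. fst p i = 0}"
| "Lset d (Suc (Suc n)) =
     Lset d (Suc n) \<inter> {p. \<forall>k\<in>{1..d - (n+2)}. snd p k (d - (n+2) + 2) = 0}"

definition target :: "nat \<Rightarrow> nat \<Rightarrow> complex pt \<Rightarrow> complex" where
  "target d i p = (if i = 1 then (\<Sum>k\<in>{1..d}. (fst p k)\<^sup>2)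
                   else (\<Sum>k\<in>{1..d-i+1}. (snd p k (d - i + 2))\<^sup>2))"

definition cplx_pt :: "real pt \<Rightarrow> complex pt" where
  "cplx_pt p = (\<lambda>i. complex_of_real (fst p i), \<lambda>i j. complex_of_real (snd p i j))"

definition fclass :: "nat \<Rightarrow> nat \<Rightarrow> ((complex pt \<Rightarrow> complex) \<times> (complex pt \<Rightarrow> complex)) set" where
  "fclass d i = (THE C. \<exists>P Q. (P, Q) \<in> frac d \<and> C = ratclass d P Q \<and>
       (\<forall>A::nat \<Rightarrow> nat \<Rightarrow> complex. orth d A \<longrightarrow>
           (\<forall>p. P (act d A p) * Q p = P p * Q (act d A p))) \<and>
       (\<exists>(P', Q') \<in> C. (\<exists>p\<in>Lset d (i - 1). Q' p \<noteq> 0) \<and>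
           (\<forall>p\<in>Lset d (i - 1). P' p = target d i p * Q' p)))"

definition f_def_nonzero :: "nat \<Rightarrow> nat \<Rightarrow> real pt \<Rightarrow> bool" where
  "f_def_nonzero d i p \<longleftrightarrow>
     (\<exists>(P, Q) \<in> fclass d i. Q (cplx_pt p) \<noteq> 0 \<and> P (cplx_pt p) \<noteq> 0)"

definition Uset :: "nat \<Rightarrow> real pt set" where
  "Uset d = {p. \<forall>i\<in>{1..d}. f_def_nonzero d i p}"

definition Kset :: "nat \<Rightarrow> real pt set" where
  "Kset d = {p. (\<forall>i\<in>{1..d-1}. fst p i = 0) \<and>
               (\<forall>i\<in>{1..d-1}. \<forall>j\<in>{1..<i}. snd p j (i+1) = 0) \<and>
               fst p d > 0 \<and>
               (\<forall>i\<in>{1..d-1}. snd p i (i+1) > 0)}"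

definition rho :: "nat \<Rightarrow> real pt \<Rightarrow> (nat \<Rightarrow> nat \<Rightarrow> real)" where
  "rho d c = (THE g. orth_real d g \<and> act d g c \<in> Kset d)"

end

theory Submission
  imports Defs "Jordan_Normal_Form.Determinant"
begin

text \<open>
  The signature is equivariant under linear maps, hence so is \<^term>\<open>logsig2\<close>; its degree-two part is
  skew by the shuffle relation. Both facts need integrable derivatives: an absolutely continuous
  function is a difference of increasing absolutely continuous ones, these have Radon-Nikodym
  densities, and indefinite integrals are differentiable almost everywhere.

  The rational invariants are made explicit by a fraction-free Lanczos recursion. For a skew matrix
  M, orthogonalising v, Mv, M^2 v, ... amounts to r_{i+1} = M r_i + (|r_i|^2 / |r_{i-1}|^2) r_{i-1},
  and f_i = |r_i|^2 / |r_{i-1}|^2. On \<^term>\<open>Uset d\<close> no r_i vanishes, so Householder reflections move the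
  point into \<^term>\<open>Kset d\<close>; the moving frame is unique because its rows must be the normalised r_i.
  With a unique frame, replacing Z by gZ multiplies the frame by the inverse of g on the right, which
  gives the theorem.
\<close>

text \<open>Three encodings shape the argument. \<open>integral\<close>, \<open>deriv\<close>,
  \<open>Sup\<close> and \<open>THE\<close> are total, so integrability, differentiability almost
  everywhere, boundedness and unique existence must be established before \<open>sig\<close>,
  \<open>posvar\<close>, \<open>fclass\<close> or \<open>rho\<close> carry information. Next, the
  slices and \<open>fclass\<close> live over the complex numbers, where a nonzero vector may have
  norm zero and cannot be reflected onto a coordinate axis; the reduction to the slice is therefore
  done at real points, and polynomial identities pass to complex points by restriction to lines.
  Finally, \<open>polyfun\<close> has no division, and \<open>Uset\<close> refers to some unknown
  representative P / Q of each class; hence the recursion is fraction-free, its identities hold also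
  where denominators vanish, and nonvanishing of the denominators is recovered by induction. The
  coefficient |r_i|^2 / |r_{i-1}|^2 is the one that makes r_{i+1} orthogonal to r_{i-1}: as M is
  skew, the inner product of M r_i with r_{i-1} is - |r_i|^2.\<close>

section \<open>Absolutely continuous functions\<close>

text \<open>Degenerate intervals are allowed, so that clipping with min and max preserves families.\<close>
definition interval_family :: "real \<Rightarrow> real \<Rightarrow> 'k set \<Rightarrow> ('k \<Rightarrow> real) \<Rightarrow> ('k \<Rightarrow> real) \<Rightarrow> bool" where
  "interval_family a b I x y \<longleftrightarrow> finite I \<and> (\<forall>k\<in>I. a \<le> x k \<and> x k \<le> y k \<and> y k \<le> b) \<and>
     (\<forall>k\<in>I. \<forall>l\<in>I. k \<noteq> l \<longrightarrow> y k \<le> x l \<or> y l \<le> x k)"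

text \<open>\<open>abs_cont_on\<close> speaks of nondegenerate intervals indexed by an initial
  segment of nat. Degenerate intervals contribute zero to both sums and the rest can be enumerated,
  so any finite index type is allowed; later uses index by pairs and by the intervals
  themselves.\<close>

lemma abs_cont_family:
  fixes f :: "real \<Rightarrow> real"
  assumes "abs_cont_on a b f" "\<epsilon> > 0"
  obtains \<delta> where "\<delta> > 0"
    "\<And>(I::'k set) x y. interval_family a b I x y \<Longrightarrow> (\<Sum>k\<in>I. y k - x k) < \<delta> \<Longrightarrow>
       (\<Sum>k\<in>I. \<bar>f (y k) - f (x k)\<bar>) < \<epsilon>"
proof -
  obtain \<delta> where d: "\<delta> > 0" and D: "\<forall>(n::nat) (x::nat \<Rightarrow> real) y.
        (\<forall>k<n. a \<le> x k \<and> x k < y k \<and> y k \<le> b) \<and>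
        (\<forall>k<n. \<forall>l<n. k \<noteq> l \<longrightarrow> y k \<le> x l \<or> y l \<le> x k) \<and>
        (\<Sum>k<n. y k - x k) < \<delta>
        \<longrightarrow> (\<Sum>k<n. \<bar>f (y k) - f (x k)\<bar>) < \<epsilon>"
    using assms(1)[unfolded abs_cont_on_def, THEN spec, THEN mp, OF assms(2)] by (elim exE conjE)
  have "(\<Sum>k\<in>I. \<bar>f (y k) - f (x k)\<bar>) < \<epsilon>"
    if fam: "interval_family a b I x y" and small: "(\<Sum>k\<in>I. y k - x k) < \<delta>" for I :: "'k set" and x y
  proof -
    have fin: "finite I" using fam by (simp add: interval_family_def)
    define J where "J = {k\<in>I. x k < y k}"
    have finJ: "finite J" using fin J_def by auto
    obtain h where h: "bij_betw h {..<card J} J"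
      using ex_bij_betw_nat_finite[OF finJ] by (auto simp: atLeast0LessThan)
    have inj: "inj_on h {..<card J}" and hJ: "\<And>k. k < card J \<Longrightarrow> h k \<in> J"
      using h by (auto simp: bij_betw_def)
    have eq: "(\<Sum>k\<in>J. g k) = (\<Sum>k<card J. g (h k))" for g :: "'k \<Rightarrow> real"
      using sum.reindex_bij_betw[OF h, of g] by simp
    have s1: "(\<Sum>k\<in>I. y k - x k) = (\<Sum>k\<in>J. y k - x k)"
    proof (rule sum.mono_neutral_right)
      show "\<forall>i\<in>I - J. y i - x i = 0" using fam by (force simp: J_def interval_family_def)
    qed (use fin J_def in auto)
    have s2: "(\<Sum>k\<in>I. \<bar>f (y k) - f (x k)\<bar>) = (\<Sum>k\<in>J. \<bar>f (y k) - f (x k)\<bar>)"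
    proof (rule sum.mono_neutral_right)
      show "\<forall>i\<in>I - J. \<bar>f (y i) - f (x i)\<bar> = 0"
      proof
        fix i assume "i \<in> I - J"
        then have "x i = y i" using fam by (force simp: J_def interval_family_def)
        then show "\<bar>f (y i) - f (x i)\<bar> = 0" by simp
      qed
    qed (use fin J_def in auto)
    have "(\<Sum>k<card J. \<bar>f ((y \<circ> h) k) - f ((x \<circ> h) k)\<bar>) < \<epsilon>"
    proof (intro D[THEN spec, THEN spec, THEN spec, THEN mp] conjI)
      show "\<forall>k<card J. a \<le> (x \<circ> h) k \<and> (x \<circ> h) k < (y \<circ> h) k \<and> (y \<circ> h) k \<le> b"
        using hJ fam by (auto simp: J_def interval_family_def)
      show "\<forall>k<card J. \<forall>l<card J. k \<noteq> l \<longrightarrow> (y \<circ> h) k \<le> (x \<circ> h) l \<or> (y \<circ> h) l \<le> (x \<circ> h) k"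
      proof (intro allI impI)
        fix k l assume "k < card J" "l < card J" "k \<noteq> l"
        then have "h k \<in> I" "h l \<in> I" "h k \<noteq> h l"
          using hJ inj by (auto simp: J_def inj_on_def)
        then show "(y \<circ> h) k \<le> (x \<circ> h) l \<or> (y \<circ> h) l \<le> (x \<circ> h) k"
          using fam by (auto simp: interval_family_def)
      qed
      show "(\<Sum>k<card J. (y \<circ> h) k - (x \<circ> h) k) < \<delta>"
        using small s1 eq[of "\<lambda>k. y k - x k"] by simp
    qed
    then show ?thesis using s2 eq[of "\<lambda>k. \<bar>f (y k) - f (x k)\<bar>"] by simp
  qed
  then show ?thesis using that d by blast
qed

text \<open>The open interiors are pairwise disjoint, so the sum is the Lebesgue measure of a subset
  of [a, b].\<close>

lemma interval_family_length:
  assumes "interval_family a b I x y" "a \<le> b"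
  shows "(\<Sum>k\<in>I. y k - x k) \<le> b - a"
proof -
  have fin: "finite I" and xy: "\<And>k. k \<in> I \<Longrightarrow> a \<le> x k \<and> x k \<le> y k \<and> y k \<le> b"
    using assms by (auto simp: interval_family_def)
  have dis: "disjoint_family_on (\<lambda>k. {x k<..<y k}) I"
    unfolding disjoint_family_on_def
  proof (intro ballI impI)
    fix k l assume "k \<in> I" "l \<in> I" "k \<noteq> l"
    then have "y k \<le> x l \<or> y l \<le> x k" using assms by (auto simp: interval_family_def)
    then show "{x k<..<y k} \<inter> {x l<..<y l} = {}" by auto
  qed
  have "(\<Sum>k\<in>I. y k - x k) = (\<Sum>k\<in>I. measure lborel {x k<..<y k})"
    using xy by (intro sum.cong) auto
  also have "\<dots> = measure lborel (\<Union>k\<in>I. {x k<..<y k})"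
    using dis fin xy by (intro measure_finite_Union[symmetric]) auto
  also have "\<dots> \<le> measure lborel {a..b}"
  proof (rule measure_mono_fmeasurable)
    show "(\<Union>k\<in>I. {x k<..<y k}) \<in> sets lborel" using fin by auto
    show "{a..b} \<in> fmeasurable lborel" using assms(2) by (auto simp: fmeasurable_def)
  qed (use xy in force)
  finally show ?thesis using assms(2) by simp
qed

lemma interval_family_min:
  assumes "interval_family a b I x y" "a \<le> s"
  shows "interval_family a s I (\<lambda>k. min (x k) s) (\<lambda>k. min (y k) s)"
  unfolding interval_family_def
proof (intro conjI ballI impI)
  fix k l assume "k \<in> I" "l \<in> I" "k \<noteq> l"
  then have "y k \<le> x l \<or> y l \<le> x k" using assms by (auto simp: interval_family_def)
  then show "min (y k) s \<le> min (x l) s \<or> min (y l) s \<le> min (x k) s" by linarith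
qed (use assms in \<open>auto simp: interval_family_def intro: min.mono\<close>)

lemma interval_family_max:
  assumes "interval_family a b I x y" "s \<le> b"
  shows "interval_family s b I (\<lambda>k. max (x k) s) (\<lambda>k. max (y k) s)"
  unfolding interval_family_def
proof (intro conjI ballI impI)
  fix k l assume "k \<in> I" "l \<in> I" "k \<noteq> l"
  then have "y k \<le> x l \<or> y l \<le> x k" using assms by (auto simp: interval_family_def)
  then show "max (y k) s \<le> max (x l) s \<or> max (y l) s \<le> max (x k) s" by linarith
qed (use assms in \<open>auto simp: interval_family_def intro: max.mono\<close>)

lemma interval_family_insert:
  assumes fam: "interval_family a s I x y" and n: "n \<notin> I" and "a \<le> s" "s \<le> t"
  shows "interval_family a t (insert n I) (x(n := s)) (y(n := t))"
proof -
  have "finite I" and 1: "\<And>k. k \<in> I \<Longrightarrow> a \<le> x k \<and> x k \<le> y k \<and> y k \<le> s"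
    and 2: "\<And>k l. k \<in> I \<Longrightarrow> l \<in> I \<Longrightarrow> k \<noteq> l \<Longrightarrow> y k \<le> x l \<or> y l \<le> x k"
    using fam unfolding interval_family_def by auto
  then show ?thesis using n assms(3,4) unfolding interval_family_def
    by (auto dest: 1 intro: order_trans)
qed
text \<open>\<open>min y s\<close> and \<open>max y s\<close> are y and s in some order, so the
  values of f at them add up to f y + f s. This cuts a whole family at s without splitting its index
  set.\<close>

lemma min_max_split:
  fixes f :: "real \<Rightarrow> real"
  shows "f y - f x = (f (min y s) - f (min x s)) + (f (max y s) - f (max x s))"
  by (auto simp: min_def max_def)

text \<open>Every family inside a window shorter than the \<delta> for \<epsilon> = 1 has variation
  below 1, and finitely many windows cover [a, b].\<close>

lemma abs_cont_bounded_variation: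
  fixes f :: "real \<Rightarrow> real"
  assumes ac: "abs_cont_on a b f" and "a \<le> b"
  obtains B where "\<And>(I::'k set) x y. interval_family a b I x y \<Longrightarrow>
    (\<Sum>k\<in>I. \<bar>f (y k) - f (x k)\<bar>) \<le> B"
proof -
  have one: "(0::real) < 1" by simp
  obtain \<delta> where d: "\<delta> > 0" and D: "\<And>(I::'k set) x y. interval_family a b I x y \<Longrightarrow>
     (\<Sum>k\<in>I. y k - x k) < \<delta> \<Longrightarrow> (\<Sum>k\<in>I. \<bar>f (y k) - f (x k)\<bar>) < 1"
    using abs_cont_family[OF ac one] by blast
  \<comment> \<open>Induction on the number m of windows of width \<delta>/2 that reach from a to c.
    Half of \<delta> leaves room for the strict bound on the length of the last window.\<close>
  have main: "(\<Sum>k\<in>I. \<bar>f (y k) - f (x k)\<bar>) \<le> real m"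
    if "interval_family a c I x y" "c \<le> b" "c \<le> a + real m * (\<delta>/2)" "a \<le> c"
    for m c and I :: "'k set" and x y
    using that
  proof (induction m arbitrary: c x y)
    case 0
    then have "c = a" by simp
    have "\<bar>f (y k) - f (x k)\<bar> = 0" if "k \<in> I" for k
    proof -
      have "y k = x k" using 0(1) that \<open>c = a\<close> by (force simp: interval_family_def)
      then show ?thesis by simp
    qed
    then show ?case by simp
  next
    case (Suc m)
    define s where "s = min c (a + real m * (\<delta>/2))"
    have s: "a \<le> s" "s \<le> c" "s \<le> a + real m * (\<delta>/2)" "c - s < \<delta>"
      using Suc.prems d by (auto simp: s_def min_def field_simps)
    have f1: "interval_family a s I (\<lambda>k. min (x k) s) (\<lambda>k. min (y k) s)"
      using interval_family_min Suc.prems s by blast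
    have f2: "interval_family s c I (\<lambda>k. max (x k) s) (\<lambda>k. max (y k) s)"
      using interval_family_max Suc.prems s by blast
    have f2': "interval_family a b I (\<lambda>k. max (x k) s) (\<lambda>k. max (y k) s)"
      using f2 s Suc.prems(2) unfolding interval_family_def by force
    have "(\<Sum>k\<in>I. \<bar>f (y k) - f (x k)\<bar>) \<le> (\<Sum>k\<in>I. \<bar>f (min (y k) s) - f (min (x k) s)\<bar>
        + \<bar>f (max (y k) s) - f (max (x k) s)\<bar>)"
    proof (rule sum_mono)
      fix k show "\<bar>f (y k) - f (x k)\<bar> \<le> \<bar>f (min (y k) s) - f (min (x k) s)\<bar>
        + \<bar>f (max (y k) s) - f (max (x k) s)\<bar>"
        using min_max_split[of f "y k" "x k" s] by linarith
    qed
    also have "\<dots> = (\<Sum>k\<in>I. \<bar>f (min (y k) s) - f (min (x k) s)\<bar>)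
        + (\<Sum>k\<in>I. \<bar>f (max (y k) s) - f (max (x k) s)\<bar>)"
      by (rule sum.distrib)
    also have "\<dots> \<le> real m + 1"
    proof (rule add_mono)
      show "(\<Sum>k\<in>I. \<bar>f (min (y k) s) - f (min (x k) s)\<bar>) \<le> real m"
        using Suc.IH[OF f1] s Suc.prems by simp
      have "(\<Sum>k\<in>I. max (y k) s - max (x k) s) < \<delta>"
        using interval_family_length[OF f2] s by linarith
      from D[OF f2' this] show "(\<Sum>k\<in>I. \<bar>f (max (y k) s) - f (max (x k) s)\<bar>) \<le> 1" by simp
    qed
    finally show ?case by simp
  qed
  obtain m :: nat where "(b - a) / (\<delta>/2) \<le> real m" using real_arch_simple by blast
  then have "b \<le> a + real m * (\<delta>/2)" using d by (simp add: field_simps)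
  with main[of b _ _ _ m] assms(2) that show ?thesis by blast
qed

section \<open>Positive variation and the Jordan decomposition\<close>

text \<open>The positive variation. Signed increments suffice: intervals on which f decreases may be
  left out of a family, so the supremum is the same as for positive parts.\<close>

definition posvar :: "(real \<Rightarrow> real) \<Rightarrow> real \<Rightarrow> real \<Rightarrow> real" where
  "posvar f a b = Sup {\<Sum>k\<in>I. f (y k) - f (x k) |(I::nat set) x y. interval_family a b I x y}"

lemma interval_family_mono:
  "interval_family a b I x y \<Longrightarrow> c \<le> a \<Longrightarrow> b \<le> d \<Longrightarrow> interval_family c d I x y"
  unfolding interval_family_def by force

context
  fixes f :: "real \<Rightarrow> real" and a b :: real
  assumes ac: "abs_cont_on a b f" and ab: "a \<le> b"
begin

text \<open>The total variation bounds the set of sums from above; only then is \<open>Sup\<close>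
  an upper bound.\<close>

lemma posvar_upper:
  fixes I :: "nat set"
  assumes "interval_family c d I x y" "a \<le> c" "d \<le> b"
  shows "(\<Sum>k\<in>I. f (y k) - f (x k)) \<le> posvar f c d"
proof -
  obtain B where B: "\<And>(I::nat set) x y. interval_family a b I x y \<Longrightarrow>
    (\<Sum>k\<in>I. \<bar>f (y k) - f (x k)\<bar>) \<le> B"
    using abs_cont_bounded_variation[OF ac ab] by blast
  have "bdd_above {\<Sum>k\<in>I. f (y k) - f (x k) |(I::nat set) x y. interval_family c d I x y}"
  proof (rule bdd_aboveI[of _ B])
    fix v assume "v \<in> {\<Sum>k\<in>I. f (y k) - f (x k) |(I::nat set) x y. interval_family c d I x y}"
    then obtain I :: "nat set" and x y where v: "v = (\<Sum>k\<in>I. f (y k) - f (x k))"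
      and fam: "interval_family c d I x y" by blast
    have "v \<le> (\<Sum>k\<in>I. \<bar>f (y k) - f (x k)\<bar>)" unfolding v by (intro sum_mono) auto
    also have "\<dots> \<le> B" using B interval_family_mono[OF fam] assms by blast
    finally show "v \<le> B" .
  qed
  then show ?thesis unfolding posvar_def using assms by (intro cSup_upper) auto
qed

lemma posvar_least:
  assumes "\<And>(I::nat set) x y. interval_family c d I x y \<Longrightarrow> (\<Sum>k\<in>I. f (y k) - f (x k)) \<le> B"
  shows "posvar f c d \<le> B"
proof -
  have "interval_family c d ({}::nat set) (\<lambda>_. 0) (\<lambda>_. 0)" by (simp add: interval_family_def)
  then show ?thesis unfolding posvar_def using assms by (intro cSup_least) auto
qed

text \<open>A family on [a, s] extends by the single interval [s, t]. The inequality says that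
  \<open>posvar f a t - f t\<close> is nondecreasing in t, the second half of the Jordan
  decomposition.\<close>

lemma posvar_add_le:
  assumes "a \<le> s" "s \<le> t" "t \<le> b"
  shows "posvar f a s + (f t - f s) \<le> posvar f a t"
proof -
  have "posvar f a s \<le> posvar f a t - (f t - f s)"
  proof (rule posvar_least)
    fix I :: "nat set" and x y assume fam: "interval_family a s I x y"
    then have fin: "finite I" by (simp add: interval_family_def)
    obtain n where n: "n \<notin> I" using ex_new_if_finite[OF infinite_UNIV_nat fin] by blast
    have "interval_family a t (insert n I) (x(n := s)) (y(n := t))"
      using interval_family_insert[OF fam n] assms by blast
    from posvar_upper[OF this] have "(\<Sum>k\<in>insert n I. f ((y(n := t)) k) - f ((x(n := s)) k)) \<le> posvar f a t"
      using assms by simp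
    moreover have "(\<Sum>k\<in>I. f ((y(n := t)) k) - f ((x(n := s)) k)) = (\<Sum>k\<in>I. f (y k) - f (x k))"
      using n by (intro sum.cong) auto
    ultimately show "(\<Sum>k\<in>I. f (y k) - f (x k)) \<le> posvar f a t - (f t - f s)"
      using n fin by simp
  qed
  then show ?thesis by simp
qed

lemma posvar_mono:
  assumes "a \<le> s" "s \<le> t" "t \<le> b"
  shows "posvar f a s \<le> posvar f a t"
proof (rule posvar_least)
  fix I :: "nat set" and x y assume "interval_family a s I x y"
  then show "(\<Sum>k\<in>I. f (y k) - f (x k)) \<le> posvar f a t"
    using assms by (intro posvar_upper) (auto intro: interval_family_mono)
qed

text \<open>Every family is cut at s. Together with monotonicity this controls the increment of the
  variation over [s, t] by the behaviour of f inside [s, t].\<close>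

lemma posvar_split:
  assumes "a \<le> s" "s \<le> t" "t \<le> b"
  shows "posvar f a t \<le> posvar f a s + posvar f s t"
proof (rule posvar_least)
  fix I :: "nat set" and x y assume fam: "interval_family a t I x y"
  have "(\<Sum>k\<in>I. f (y k) - f (x k)) = (\<Sum>k\<in>I. f (min (y k) s) - f (min (x k) s))
      + (\<Sum>k\<in>I. f (max (y k) s) - f (max (x k) s))"
    by (subst min_max_split[of f _ _ s]) (rule sum.distrib)
  also have "\<dots> \<le> posvar f a s + posvar f s t"
    using posvar_upper[OF interval_family_min[OF fam, of s]] posvar_upper[OF interval_family_max[OF fam, of s]] assms
    by (intro add_mono) auto
  finally show "(\<Sum>k\<in>I. f (y k) - f (x k)) \<le> posvar f a s + posvar f s t" .
qed

lemma posvar_approx: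
  assumes "\<eta> > 0"
  obtains I :: "nat set" and x y where "interval_family c d I x y"
    "posvar f c d < (\<Sum>k\<in>I. f (y k) - f (x k)) + \<eta>"
proof -
  have "\<not> (\<forall>(I::nat set) x y. interval_family c d I x y \<longrightarrow> (\<Sum>k\<in>I. f (y k) - f (x k)) \<le> posvar f c d - \<eta>)"
    using posvar_least[of c d "posvar f c d - \<eta>"] assms by auto
  then show ?thesis using that by (metis less_diff_eq not_le diff_less_eq)
qed

text \<open>Inside each given interval a nearly optimal subfamily is chosen; their union is one
  family of no greater total length, to which absolute continuity of f applies.\<close>

lemma posvar_abs_cont: "abs_cont_on a b (\<lambda>t. posvar f a t)"
  unfolding abs_cont_on_def
proof (intro allI impI)
  fix \<epsilon> :: real assume e: "\<epsilon> > 0"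
  obtain \<delta> where d: "\<delta> > 0" and D: "\<And>(I::(nat \<times> nat) set) x y. interval_family a b I x y \<Longrightarrow>
     (\<Sum>k\<in>I. y k - x k) < \<delta> \<Longrightarrow> (\<Sum>k\<in>I. \<bar>f (y k) - f (x k)\<bar>) < \<epsilon>/2"
    using abs_cont_family[OF ac half_gt_zero[OF e]] by blast
  have "(\<Sum>k<n. \<bar>posvar f a (y k) - posvar f a (x k)\<bar>) < \<epsilon>"
    if xy: "\<forall>k<n. a \<le> x k \<and> x k < y k \<and> y k \<le> b"
    and no: "\<forall>k<n. \<forall>l<n. k \<noteq> l \<longrightarrow> y k \<le> x l \<or> y l \<le> x k"
    and sm: "(\<Sum>k<n. y k - x k) < \<delta>" for n :: nat and x y :: "nat \<Rightarrow> real"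
  proof -
    \<comment> \<open>The n errors add up to at most \<epsilon>/2; the summand 1 avoids division by
      zero for n = 0.\<close>
    define \<eta> where "\<eta> = \<epsilon> / (2 * (real n + 1))"
    have eta: "\<eta> > 0" using e by (simp add: \<eta>_def)
    have "\<forall>k. \<exists>I X Y. interval_family (x k) (y k) (I::nat set) X Y \<and>
        posvar f (x k) (y k) < (\<Sum>j\<in>I. f (Y j) - f (X j)) + \<eta>"
      using posvar_approx[OF eta] by metis
    then obtain I X Y where fam: "\<And>k. interval_family (x k) (y k) (I k :: nat set) (X k) (Y k)"
      and ap: "\<And>k. posvar f (x k) (y k) < (\<Sum>j\<in>I k. f (Y k j) - f (X k j)) + \<eta>"
      by metis
    have finI: "\<And>k. finite (I k)" using fam by (simp add: interval_family_def)
    let ?S = "Sigma {..<n} I"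
    have famS: "interval_family a b ?S (\<lambda>(k,j). X k j) (\<lambda>(k,j). Y k j)"
      unfolding interval_family_def
    proof (intro conjI ballI impI)
      show "finite ?S" using finI by auto
    next
      fix z assume "z \<in> ?S"
      then obtain k j where z: "z = (k,j)" "k < n" "j \<in> I k" by auto
      then have "a \<le> x k" "y k \<le> b" using xy by auto
      moreover have "x k \<le> X k j \<and> X k j \<le> Y k j \<and> Y k j \<le> y k"
        using fam[of k] z by (auto simp: interval_family_def)
      ultimately show "a \<le> (case z of (k, j) \<Rightarrow> X k j)" "(case z of (k, j) \<Rightarrow> Y k j) \<le> b"
        "(case z of (k, j) \<Rightarrow> X k j) \<le> (case z of (k, j) \<Rightarrow> Y k j)"
        using z by auto
    next
      fix z w assume "z \<in> ?S" "w \<in> ?S" "z \<noteq> w"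
      then obtain k j l i where z: "z = (k,j)" "k < n" "j \<in> I k" "w = (l,i)" "l < n" "i \<in> I l"
        "k \<noteq> l \<or> j \<noteq> i" by auto
      have 1: "x k \<le> X k j \<and> X k j \<le> Y k j \<and> Y k j \<le> y k"
        using fam[of k] z by (auto simp: interval_family_def)
      have 2: "x l \<le> X l i \<and> X l i \<le> Y l i \<and> Y l i \<le> y l"
        using fam[of l] z by (auto simp: interval_family_def)
      show "(case z of (k, j) \<Rightarrow> Y k j) \<le> (case w of (k, j) \<Rightarrow> X k j) \<or>
           (case w of (k, j) \<Rightarrow> Y k j) \<le> (case z of (k, j) \<Rightarrow> X k j)"
      proof (cases "k = l")
        case True
        then have "j \<noteq> i" using z by simp
        then show ?thesis using fam[of k] z True unfolding interval_family_def by auto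
      next
        case False
        then have "y k \<le> x l \<or> y l \<le> x k" using no z by auto
        then show ?thesis using 1 2 z by auto
      qed
    qed
    have len: "(\<Sum>z\<in>?S. (\<lambda>(k,j). Y k j) z - (\<lambda>(k,j). X k j) z) < \<delta>"
    proof -
      have "(\<Sum>z\<in>?S. (\<lambda>(k,j). Y k j) z - (\<lambda>(k,j). X k j) z) = (\<Sum>k<n. \<Sum>j\<in>I k. Y k j - X k j)"
        using finI by (subst sum.Sigma) (auto intro!: sum.cong)
      also have "\<dots> \<le> (\<Sum>k<n. y k - x k)"
        using xy by (intro sum_mono interval_family_length[OF fam]) auto
      finally show ?thesis using sm by simp
    qed
    have "(\<Sum>k<n. \<Sum>j\<in>I k. f (Y k j) - f (X k j)) =
        (\<Sum>z\<in>?S. f ((\<lambda>(k,j). Y k j) z) - f ((\<lambda>(k,j). X k j) z))"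
      using finI by (subst sum.Sigma) (auto intro!: sum.cong)
    also have "\<dots> \<le> (\<Sum>z\<in>?S. \<bar>f ((\<lambda>(k,j). Y k j) z) - f ((\<lambda>(k,j). X k j) z)\<bar>)"
      by (intro sum_mono) auto
    also have "\<dots> < \<epsilon>/2" by (rule D[OF famS len])
    finally have small: "(\<Sum>k<n. \<Sum>j\<in>I k. f (Y k j) - f (X k j)) < \<epsilon>/2" .
    have "(\<Sum>k<n. \<bar>posvar f a (y k) - posvar f a (x k)\<bar>) \<le> (\<Sum>k<n. (\<Sum>j\<in>I k. f (Y k j) - f (X k j)) + \<eta>)"
    proof (rule sum_mono)
      fix k assume "k \<in> {..<n}"
      then have k: "a \<le> x k" "x k \<le> y k" "y k \<le> b" using xy by auto
      show "\<bar>posvar f a (y k) - posvar f a (x k)\<bar> \<le> (\<Sum>j\<in>I k. f (Y k j) - f (X k j)) + \<eta>"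
        using posvar_mono[OF k] posvar_split[OF k] ap[of k] by linarith
    qed
    also have "\<dots> = (\<Sum>k<n. \<Sum>j\<in>I k. f (Y k j) - f (X k j)) + real n * \<eta>"
      by (simp add: sum.distrib)
    also have "real n * \<eta> \<le> \<epsilon>/2"
      using e by (simp add: \<eta>_def field_simps)
    finally show ?thesis using small by linarith
  qed
  then show "\<exists>\<delta>>0. \<forall>(n::nat) x y. (\<forall>k<n. a \<le> x k \<and> x k < y k \<and> y k \<le> b) \<and>
      (\<forall>k<n. \<forall>l<n. k \<noteq> l \<longrightarrow> y k \<le> x l \<or> y l \<le> x k) \<and> (\<Sum>k<n. y k - x k) < \<delta> \<longrightarrow>
      (\<Sum>k<n. \<bar>posvar f a (y k) - posvar f a (x k)\<bar>) < \<epsilon>"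
    by (intro exI[of _ \<delta>] conjI allI impI d; elim conjE)
qed

end

lemma abs_cont_diff:
  assumes "abs_cont_on a b f" "abs_cont_on a b g"
  shows "abs_cont_on a b (\<lambda>t. f t - g t)"
  unfolding abs_cont_on_def
proof (intro allI impI)
  fix \<epsilon> :: real assume e: "\<epsilon> > 0"
  then have e2: "\<epsilon>/2 > 0" by simp
  obtain d1 where d1: "d1 > 0" and D1: "\<forall>(n::nat) x y. (\<forall>k<n. a \<le> x k \<and> x k < y k \<and> y k \<le> b) \<and>
      (\<forall>k<n. \<forall>l<n. k \<noteq> l \<longrightarrow> y k \<le> x l \<or> y l \<le> x k) \<and> (\<Sum>k<n. y k - x k) < d1 \<longrightarrow>
      (\<Sum>k<n. \<bar>f (y k) - f (x k)\<bar>) < \<epsilon>/2"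
    using assms(1)[unfolded abs_cont_on_def, THEN spec, THEN mp, OF e2] by (elim exE conjE)
  obtain d2 where d2: "d2 > 0" and D2: "\<forall>(n::nat) x y. (\<forall>k<n. a \<le> x k \<and> x k < y k \<and> y k \<le> b) \<and>
      (\<forall>k<n. \<forall>l<n. k \<noteq> l \<longrightarrow> y k \<le> x l \<or> y l \<le> x k) \<and> (\<Sum>k<n. y k - x k) < d2 \<longrightarrow>
      (\<Sum>k<n. \<bar>g (y k) - g (x k)\<bar>) < \<epsilon>/2"
    using assms(2)[unfolded abs_cont_on_def, THEN spec, THEN mp, OF e2] by (elim exE conjE)
  show "\<exists>\<delta>>0. \<forall>(n::nat) x y. (\<forall>k<n. a \<le> x k \<and> x k < y k \<and> y k \<le> b) \<and>
      (\<forall>k<n. \<forall>l<n. k \<noteq> l \<longrightarrow> y k \<le> x l \<or> y l \<le> x k) \<and> (\<Sum>k<n. y k - x k) < \<delta> \<longrightarrow>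
      (\<Sum>k<n. \<bar>f (y k) - g (y k) - (f (x k) - g (x k))\<bar>) < \<epsilon>"
  proof (intro exI[of _ "min d1 d2"] conjI allI impI)
    show "min d1 d2 > 0" using d1 d2 by simp
    fix n :: nat and x y :: "nat \<Rightarrow> real"
    assume *: "(\<forall>k<n. a \<le> x k \<and> x k < y k \<and> y k \<le> b) \<and>
      (\<forall>k<n. \<forall>l<n. k \<noteq> l \<longrightarrow> y k \<le> x l \<or> y l \<le> x k) \<and> (\<Sum>k<n. y k - x k) < min d1 d2"
    have "(\<Sum>k<n. \<bar>f (y k) - g (y k) - (f (x k) - g (x k))\<bar>) \<le>
        (\<Sum>k<n. \<bar>f (y k) - f (x k)\<bar> + \<bar>g (y k) - g (x k)\<bar>)"
      by (intro sum_mono) linarith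
    also have "\<dots> = (\<Sum>k<n. \<bar>f (y k) - f (x k)\<bar>) + (\<Sum>k<n. \<bar>g (y k) - g (x k)\<bar>)"
      by (rule sum.distrib)
    also have "\<dots> < \<epsilon>" using D1[THEN spec, THEN spec, THEN spec, THEN mp, of n x y]
        D2[THEN spec, THEN spec, THEN spec, THEN mp, of n x y] * by simp
    finally show "(\<Sum>k<n. \<bar>f (y k) - g (y k) - (f (x k) - g (x k))\<bar>) < \<epsilon>" .
  qed
qed

lemma abs_cont_continuous:
  assumes "abs_cont_on a b f"
  shows "continuous_on {a..b} f"
proof (rule continuous_onI)
  fix x e :: real assume x: "x \<in> {a..b}" and e: "e > 0"
  obtain \<delta> where d: "\<delta> > 0" and D: "\<And>(I::unit set) x y. interval_family a b I x y \<Longrightarrow>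
     (\<Sum>k\<in>I. y k - x k) < \<delta> \<Longrightarrow> (\<Sum>k\<in>I. \<bar>f (y k) - f (x k)\<bar>) < e"
    using abs_cont_family[OF assms e] by blast
  have *: "\<bar>f v - f u\<bar> < e" if "a \<le> u" "u \<le> v" "v \<le> b" "v - u < \<delta>" for u v
    using D[of "{()}" "\<lambda>_. u" "\<lambda>_. v"] that by (auto simp: interval_family_def)
  have "dist (f y) (f x) \<le> e" if y: "y \<in> {a..b}" "dist y x < \<delta>" for y
    using *[of x y] *[of y x] x y by (cases "x \<le> y") (auto simp: dist_real_def)
  then show "\<exists>d>0. \<forall>x'\<in>{a..b}. dist x' x < d \<longrightarrow> dist (f x') (f x) \<le> e" using d by blast
qed

section \<open>Densities of increasing absolutely continuous functions\<close>

lemma mono_abs_cont_has_integral: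
  fixes g :: "real \<Rightarrow> real"
  assumes ac: "abs_cont_on a b g" and ab: "a \<le> b"
    and mono: "\<And>s t. a \<le> s \<Longrightarrow> s \<le> t \<Longrightarrow> t \<le> b \<Longrightarrow> g s \<le> g t"
  obtains h where "\<And>x. 0 \<le> h x" "\<And>t. t \<in> {a..b} \<Longrightarrow> (h has_integral (g t - g a)) {a..t}"
proof -
  \<comment> \<open>Clamping to [a, b] makes g monotone and continuous on the whole line, as
    \<open>interval_measure\<close> requires, and adds no mass outside [a, b]. Being 1-Lipschitz, it
    does not lengthen intervals.\<close>
  define cl where "cl = (\<lambda>t. max a (min b t))"
  have cl: "cl t \<in> {a..b}" "s \<le> t \<Longrightarrow> cl s \<le> cl t" "s \<le> t \<Longrightarrow> cl t - cl s \<le> t - s"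
    "t \<in> {a..b} \<Longrightarrow> cl t = t" for s t
    using ab by (auto simp: cl_def)
  define G where "G = (\<lambda>t. g (cl t))"
  have G_mono: "s \<le> t \<Longrightarrow> G s \<le> G t" for s t
    unfolding G_def using cl[of s] cl[of t] by (intro mono) auto
  have "continuous_on UNIV cl" unfolding cl_def by (intro continuous_intros)
  then have G_cont: "continuous_on UNIV G" unfolding G_def
    by (intro continuous_on_compose2[OF abs_cont_continuous[OF ac]]) (use cl in auto)
  define \<mu> where "\<mu> = interval_measure G"
  have Icc: "emeasure \<mu> {s..t} = ennreal (G t - G s)" if "s \<le> t" for s t
    unfolding \<mu>_def using that G_mono G_cont by (intro emeasure_interval_measure_Icc) auto
  have Ioc: "emeasure \<mu> {s<..t} = ennreal (G t - G s)" if "s \<le> t" for s t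
    unfolding \<mu>_def using that G_mono G_cont
    by (intro emeasure_interval_measure_Ioc)
       (auto intro: continuous_on_imp_continuous_within continuous_at_imp_continuous_at_within
          simp: continuous_on_eq_continuous_at)
  have sets_mu[simp]: "sets \<mu> = sets borel" by (simp add: \<mu>_def)
  have "absolutely_continuous lborel \<mu>"
    unfolding absolutely_continuous_def
  proof
    fix N assume N: "N \<in> null_sets (lborel :: real measure)"
    \<comment> \<open>N lies in an open T of Lebesgue measure below \<delta>. T is a countable union
      of closed intervals, and each finite subunion has \<mu>-measure at most \<epsilon> by absolute
      continuity of g.\<close>
    have bd: "emeasure \<mu> N \<le> ennreal \<epsilon>" if e: "\<epsilon> > 0" for \<epsilon>
    proof -
      obtain \<delta> where d: "\<delta> > 0" and D: "\<And>(I::real set set) x y. interval_family a b I x y \<Longrightarrow>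
         (\<Sum>k\<in>I. y k - x k) < \<delta> \<Longrightarrow> (\<Sum>k\<in>I. \<bar>g (y k) - g (x k)\<bar>) < \<epsilon>"
        using abs_cont_family[OF ac e] by blast
      have Nleb: "N \<in> sets lebesgue" "emeasure lebesgue N = 0"
        using N by (auto simp: null_sets_def)
      obtain T where T: "open T" "N \<subseteq> T" "emeasure lebesgue (T - N) < ennreal \<delta>"
        using sets_lebesgue_outer_open[OF Nleb(1) d] by blast
      have "emeasure lebesgue T \<le> emeasure lebesgue (T - N) + emeasure lebesgue N"
      proof -
        have "T \<in> sets lebesgue" using T(1) by auto
        then have "emeasure lebesgue ((T - N) \<union> N) \<le> emeasure lebesgue (T - N) + emeasure lebesgue N"
          using Nleb by (intro emeasure_subadditive) auto
        then show ?thesis using T(2) by (simp add: Un_absorb1 Un_commute)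
      qed
      then have "emeasure lebesgue T < ennreal \<delta>" using T(3) Nleb by simp
      then have Tm: "emeasure lborel T < ennreal \<delta>" using T(1) by simp
      have fin_bd: "emeasure \<mu> (\<Union>F) \<le> ennreal \<epsilon>"
        if F: "finite F" "\<And>X. X \<in> F \<Longrightarrow> \<exists>u v. X = cbox u v" "\<Union>F \<subseteq> T" for F :: "real set set"
      proof -
        \<comment> \<open>The boxes of F may overlap; a division of their union replaces them by
          pieces with disjoint interiors.\<close>
        obtain p where p: "p division_of \<Union>F" using elementary_unions_intervals[OF F(1,2)] by blast
        have finp: "finite p" using p by blast
        define x where "x = (\<lambda>K::real set. Inf K)"
        define y where "y = (\<lambda>K::real set. Sup K)"
        have K: "K = {x K..y K}" "x K \<le> y K" if Kp: "K \<in> p" for K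
        proof -
          obtain u v where uv: "K = cbox u v" "K \<noteq> {}"
            using division_ofD(3)[OF p Kp] division_ofD(4)[OF p Kp] by blast
          then have "u \<le> v" by auto
          then show "K = {x K..y K}" "x K \<le> y K" using uv by (auto simp: x_def y_def)
        qed
        define J where "J = {K\<in>p. x K < y K}"
        have finJ: "finite J" using finp by (simp add: J_def)
        have nov: "y K \<le> x L \<or> y L \<le> x K" if "K \<in> J" "L \<in> J" "K \<noteq> L" for K L
        proof (rule ccontr)
          assume n: "\<not> (y K \<le> x L \<or> y L \<le> x K)"
          have "interior K \<inter> interior L = {}" using that p by (intro division_ofD(5)[OF p]) (auto simp: J_def)
          moreover have "interior K = {x K<..<y K}" "interior L = {x L<..<y L}"
            using arg_cong[OF K(1), of K interior] arg_cong[OF K(1), of L interior] that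
            by (simp_all add: J_def interior_atLeastAtMost_real)
          ultimately have "{x K<..<y K} \<inter> {x L<..<y L} = {}" by simp
          moreover have "(max (x K) (x L) + min (y K) (y L)) / 2 \<in> {x K<..<y K} \<inter> {x L<..<y L}"
            using n that by (auto simp: J_def max_def min_def)
          ultimately show False by blast
        qed
        have fam: "interval_family a b J (\<lambda>K. cl (x K)) (\<lambda>K. cl (y K))"
          unfolding interval_family_def
        proof (intro conjI ballI impI)
          fix k l assume "k \<in> J" "l \<in> J" "k \<noteq> l"
          from nov[OF this] show "cl (y k) \<le> cl (x l) \<or> cl (y l) \<le> cl (x k)" using cl(2) by blast
        qed (use finJ cl(1,2) J_def in auto)
        have "ennreal (\<Sum>K\<in>J. y K - x K) = (\<Sum>K\<in>J. emeasure lborel {x K<..<y K})"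
          by (subst sum_ennreal[symmetric]) (auto simp: J_def intro!: sum.cong)
        also have "\<dots> = emeasure lborel (\<Union>K\<in>J. {x K<..<y K})"
        proof (rule sum_emeasure)
          show "disjoint_family_on (\<lambda>K. {x K<..<y K}) J"
            unfolding disjoint_family_on_def
          proof (intro ballI impI)
            fix k l assume "k \<in> J" "l \<in> J" "k \<noteq> l"
            from nov[OF this] show "{x k<..<y k} \<inter> {x l<..<y l} = {}" by auto
          qed
        qed (use finJ in auto)
        also have "\<dots> \<le> emeasure lborel T"
        proof (rule emeasure_mono)
          show "(\<Union>K\<in>J. {x K<..<y K}) \<subseteq> T"
          proof (rule UN_least)
            fix K assume "K \<in> J"
            then have "K \<in> p" by (simp add: J_def)
            have "{x K<..<y K} \<subseteq> {x K..y K}" by auto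
            also have "\<dots> = K" using K(1)[OF \<open>K \<in> p\<close>] by simp
            also have "\<dots> \<subseteq> T" using division_ofD(2)[OF p \<open>K \<in> p\<close>] F(3) by blast
            finally show "{x K<..<y K} \<subseteq> T" .
          qed
        qed (use T in auto)
        finally have "ennreal (\<Sum>K\<in>J. y K - x K) < ennreal \<delta>" using Tm by (rule le_less_trans)
        then have "(\<Sum>K\<in>J. y K - x K) < \<delta>" 
          by (subst (asm) ennreal_less_iff) (auto simp: J_def intro!: sum_nonneg)
        moreover have "(\<Sum>K\<in>J. cl (y K) - cl (x K)) \<le> (\<Sum>K\<in>J. y K - x K)"
          using cl(3) by (intro sum_mono) (auto simp: J_def)
        ultimately have "(\<Sum>K\<in>J. \<bar>g (cl (y K)) - g (cl (x K))\<bar>) < \<epsilon>"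
          by (intro D[OF fam]) linarith
        then have small: "(\<Sum>K\<in>J. G (y K) - G (x K)) < \<epsilon>"
          using sum_mono[of J "\<lambda>K. G (y K) - G (x K)" "\<lambda>K. \<bar>g (cl (y K)) - g (cl (x K))\<bar>"]
          by (force simp: G_def)
        have "emeasure \<mu> (\<Union>F) = emeasure \<mu> (\<Union>K\<in>p. K)" using p by (simp add: division_ofD(6))
        also have "\<dots> \<le> (\<Sum>K\<in>p. emeasure \<mu> K)"
        proof (rule emeasure_subadditive_finite[OF finp])
          show "(\<lambda>K. K) ` p \<subseteq> sets \<mu>"
          proof clarify
            fix K assume "K \<in> p"
            then show "K \<in> sets \<mu>" by (subst K(1)) auto
          qed
        qed
        also have "\<dots> = (\<Sum>K\<in>p. ennreal (G (y K) - G (x K)))"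
        proof (rule sum.cong)
          fix K assume "K \<in> p"
          show "emeasure \<mu> K = ennreal (G (y K) - G (x K))"
            using Icc[OF K(2)[OF \<open>K \<in> p\<close>]] K(1)[OF \<open>K \<in> p\<close>] by simp
        qed simp
        also have "\<dots> = (\<Sum>K\<in>J. ennreal (G (y K) - G (x K)))"
        proof (rule sum.mono_neutral_right)
          show "\<forall>K\<in>p - J. ennreal (G (y K) - G (x K)) = 0"
            using K(2) by (force simp: J_def)
        qed (use finp J_def in auto)
        also have "\<dots> = ennreal (\<Sum>K\<in>J. G (y K) - G (x K))"
          using G_mono by (intro sum_ennreal) (auto simp: J_def)
        also have "\<dots> \<le> ennreal \<epsilon>" using small by (intro ennreal_leI) simp
        finally show ?thesis .
      qed
      obtain \<D> where \<D>: "countable \<D>" "\<D> \<subseteq> Pow T" "\<And>X. X \<in> \<D> \<Longrightarrow> \<exists>u v. X = cbox u v" "\<Union>\<D> = T"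
        using open_countable_Union_open_cbox[OF T(1)] by blast
      have "emeasure \<mu> T \<le> ennreal \<epsilon>"
      proof (cases "\<D> = {}")
        case True then show ?thesis using \<D> by auto
      next
        case False
        define A where "A = (\<lambda>n. \<Union>(from_nat_into \<D> ` {..<n}))"
        have fD: "from_nat_into \<D> n \<in> \<D>" for n using False from_nat_into by blast
        have mA: "A n \<in> sets \<mu>" for n
        proof -
          have "from_nat_into \<D> i \<in> sets borel" for i
            using \<D>(3)[OF fD[of i]] by auto
          then show ?thesis unfolding A_def by auto
        qed
        have "(SUP n. emeasure \<mu> (A n)) = emeasure \<mu> (\<Union>n. A n)"
        proof (rule SUP_emeasure_incseq)
          show "incseq A" unfolding incseq_def A_def
            by (intro allI impI Union_mono image_mono) auto
        qed (use mA in auto)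
        moreover have "(\<Union>n. A n) = T"
        proof -
          have "(\<Union>n. A n) = \<Union>(range (from_nat_into \<D>))" unfolding A_def by blast
          then show ?thesis using range_from_nat_into[OF False \<D>(1)] \<D>(4) by simp
        qed
        moreover have "emeasure \<mu> (A n) \<le> ennreal \<epsilon>" for n
          unfolding A_def
        proof (rule fin_bd)
          show "\<Union>(from_nat_into \<D> ` {..<n}) \<subseteq> T" using fD \<D>(4) by blast
        qed (use fD \<D>(3) in auto)
        ultimately show ?thesis using SUP_least[of UNIV "\<lambda>n. emeasure \<mu> (A n)"] by simp
      qed
      moreover have "emeasure \<mu> N \<le> emeasure \<mu> T" using T by (intro emeasure_mono) auto
      ultimately show ?thesis by (rule order_trans[rotated])
    qed
    have "emeasure \<mu> N \<le> 0"
    proof (rule ennreal_le_epsilon)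
      fix e :: real assume "0 < e"
      then show "emeasure \<mu> N \<le> 0 + ennreal e" using bd by simp
    qed
    then have "emeasure \<mu> N = 0" by simp
    then show "N \<in> null_sets \<mu>" using N by (auto simp: null_sets_def)
  qed
  then obtain \<phi> where phi: "\<phi> \<in> borel_measurable lborel" "density lborel \<phi> = \<mu>"
    using sigma_finite_measure.Radon_Nikodym[OF sigma_finite_lborel, of \<mu>] by auto
  have nn: "(\<integral>\<^sup>+x. \<phi> x * indicator {s<..t} x \<partial>lborel) = ennreal (G t - G s)" if "s \<le> t" for s t
    using Ioc[OF that] phi by (auto simp: emeasure_density[symmetric])
  \<comment> \<open>Finite mass on (a, b] makes the density finite almost everywhere there, so
    \<open>enn2real\<close> loses nothing.\<close>
  have "AE x in lborel. \<phi> x * indicator {a<..b} x \<noteq> \<infinity>"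
    using nn[OF ab] phi(1) by (intro nn_integral_PInf_AE) auto
  then have finAE: "AE x in lborel. x \<in> {a<..b} \<longrightarrow> \<phi> x \<noteq> \<infinity>"
    by eventually_elim (auto simp: indicator_def split: if_splits)
  define h where "h = (\<lambda>x. enn2real (\<phi> x))"
  have hm: "h \<in> borel_measurable borel" unfolding h_def using phi(1) by auto
  have "(h has_integral (g t - g a)) {a..t}" if t: "t \<in> {a..b}" for t
  proof -
    have "(\<integral>\<^sup>+x. ennreal (h x * indicator {a<..t} x) \<partial>lborel) = (\<integral>\<^sup>+x. \<phi> x * indicator {a<..t} x \<partial>lborel)"
    proof (rule nn_integral_cong_AE)
      show "AE x in lborel. ennreal (h x * indicator {a<..t} x) = \<phi> x * indicator {a<..t} x"
        using finAE by eventually_elim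
          (use t in \<open>auto simp: h_def indicator_def less_top[symmetric]\<close>)
    qed
    also have "\<dots> = ennreal (g t - g a)" using nn[of a t] t ab by (simp add: G_def cl(4))
    finally have "((\<lambda>x. h x * indicator {a<..t} x) has_integral (g t - g a)) UNIV"
      using hm t mono[of a t] by (intro nn_integral_has_integral) (auto simp: h_def)
    then have "(h has_integral (g t - g a)) {a<..t}"
      by (subst has_integral_restrict_UNIV[symmetric])
         (auto elim!: has_integral_eq[rotated] simp: indicator_def)
    then show ?thesis
      by (subst has_integral_spike_set_eq[of _ "{a<..t}"])
         (auto intro: negligible_subset[of "{a}"])
  qed
  moreover have "\<And>x. 0 \<le> h x" by (simp add: h_def)
  ultimately show ?thesis using that by blast
qed

section \<open>Differentiation of indefinite integrals and of absolutely continuous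
  functions\<close>

text \<open>\<open>integrable_ccontinuous_explicit\<close> yields right difference quotients;
  applied to the reflected function it yields the left ones.\<close>

lemma indefinite_integral_has_derivative_ae:
  fixes h :: "real \<Rightarrow> real"
  assumes h: "h integrable_on {a..b}"
  obtains N where "negligible N"
    "\<And>x. x \<in> {a<..<b} - N \<Longrightarrow> ((\<lambda>t. integral {a..t} h) has_real_derivative h x) (at x)"
proof -
  \<comment> \<open>Extension by zero makes the function integrable on every interval, also on those
    reaching beyond [a, b].\<close>
  define h0 where "h0 = (\<lambda>x. if x \<in> {a..b} then h x else 0)"
  have "h0 integrable_on UNIV" using h unfolding h0_def by (simp only: integrable_restrict_UNIV)
  then have int0: "h0 integrable_on {u..v}" for u v
    using integrable_on_subcbox[of h0 UNIV u v] by simp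
  obtain N1 where N1: "negligible N1" "\<And>x e. \<lbrakk>x \<notin> N1; 0 < e\<rbrakk> \<Longrightarrow>
     \<exists>d>0. \<forall>k. 0 < k \<and> k < d \<longrightarrow> norm (integral (cbox x (x + k *\<^sub>R One)) h0 /\<^sub>R k ^ DIM(real) - h0 x) < e"
  proof (rule integrable_ccontinuous_explicit[of h0])
    show "h0 integrable_on cbox u v" for u v using int0 by simp
  qed blast
  have intm: "(\<lambda>x. h0 (-x)) integrable_on cbox u v" for u v
    using int0[of "-v" "-u"] Henstock_Kurzweil_Integration.integrable_reflect_real[of h0 "-u" "-v"] by simp
  obtain N2 where N2: "negligible N2" "\<And>x e. \<lbrakk>x \<notin> N2; 0 < e\<rbrakk> \<Longrightarrow>
     \<exists>d>0. \<forall>k. 0 < k \<and> k < d \<longrightarrow> norm (integral (cbox x (x + k *\<^sub>R One)) (\<lambda>x. h0 (-x)) /\<^sub>R k ^ DIM(real) - h0 (-x)) < e"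
    by (rule integrable_ccontinuous_explicit[of "\<lambda>x. h0 (-x)", OF intm]) blast
  define N where "N = N1 \<union> uminus ` N2"
  have "negligible N" unfolding N_def
    using N1(1) N2(1)
    by (auto intro!: negligible_differentiable_image_negligible derivative_intros simp: differentiable_on_def)
  moreover have "((\<lambda>t. integral {a..t} h) has_real_derivative h x) (at x)"
    if x: "x \<in> {a<..<b} - N" for x
  proof -
    have xN: "x \<notin> N1" "-x \<notin> N2" using x by (force simp: N_def)+
    have Heq: "integral {a..t} h = integral {a..t} h0" if "t \<le> b" for t
      using that by (intro integral_cong) (auto simp: h0_def)
    have comb: "integral {a..s} h0 + integral {s..t} h0 = integral {a..t} h0" if "a \<le> s" "s \<le> t" for s t
      using that int0 by (intro Henstock_Kurzweil_Integration.integral_combine) auto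
    have hx: "h0 x = h x" using x by (simp add: h0_def)
    have "\<exists>d>0. \<forall>k. k \<noteq> 0 \<and> norm k < d \<longrightarrow>
        norm ((integral {a..x+k} h - integral {a..x} h) / k - h x) < e" if e: "e > 0" for e
    proof -
      obtain d1 where d1: "d1 > 0" "\<And>k. 0 < k \<Longrightarrow> k < d1 \<Longrightarrow> \<bar>integral {x..x+k} h0 / k - h x\<bar> < e"
        using N1(2)[OF xN(1) e] hx by (auto simp: divide_inverse mult.commute)
      have refl: "integral {-x..k-x} (\<lambda>x. h0 (-x)) = integral {x-k..x} h0" for k
        using Henstock_Kurzweil_Integration.integral_reflect_real[of x "x-k" h0] by simp
      obtain d2 where d2: "d2 > 0" "\<And>k. 0 < k \<Longrightarrow> k < d2 \<Longrightarrow> \<bar>integral {x-k..x} h0 / k - h x\<bar> < e"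
        using N2(2)[OF xN(2) e] hx by (auto simp: divide_inverse mult.commute refl)
      define d where "d = Min {d1, d2, x - a, b - x}"
      have d: "d > 0" "d \<le> d1" "d \<le> d2" "d \<le> x - a" "d \<le> b - x"
        using d1(1) d2(1) x by (auto simp: d_def)
      have "norm ((integral {a..x+k} h - integral {a..x} h) / k - h x) < e"
        if k: "k \<noteq> 0" "norm k < d" for k
      proof (cases "k > 0")
        case True
        then have "integral {a..x+k} h - integral {a..x} h = integral {x..x+k} h0"
          using comb[of x "x+k"] Heq[of x] Heq[of "x+k"] k d x by auto
        then show ?thesis using d1(2)[of k] True k d by simp
      next
        case False
        define j where "j = -k"
        have j: "0 < j" "j < d" using False k by (auto simp: j_def)
        have "integral {a..x+k} h - integral {a..x} h = - integral {x-j..x} h0"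
          using comb[of "x-j" x] Heq[of x] Heq[of "x+k"] j d x by (auto simp: j_def)
        then have "(integral {a..x+k} h - integral {a..x} h) / k = integral {x-j..x} h0 / j"
          by (simp add: j_def)
        then show ?thesis using d2(2)[of j] j d by simp
      qed
      then show ?thesis using d(1) by blast
    qed
    then show ?thesis unfolding DERIV_def LIM_def by (simp add: dist_real_def)
  qed
  ultimately show ?thesis using that by blast
qed

text \<open>Both parts of the Jordan decomposition have nonnegative densities, which turns mere
  gauge integrability into absolute integrability.\<close>

lemma abs_cont_ftc:
  fixes f :: "real \<Rightarrow> real"
  assumes ac: "abs_cont_on a b f" and ab: "a \<le> b"
  obtains h N where "h absolutely_integrable_on {a..b}"
    "\<And>t. t \<in> {a..b} \<Longrightarrow> (h has_integral (f t - f a)) {a..t}" "negligible N"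
    "\<And>t. t \<in> {a..b} - N \<Longrightarrow> (f has_real_derivative h t) (at t)"
proof -
  obtain h1 where h1: "\<And>x. 0 \<le> h1 x"
    "\<And>t. t \<in> {a..b} \<Longrightarrow> (h1 has_integral (posvar f a t - posvar f a a)) {a..t}"
    using mono_abs_cont_has_integral[OF posvar_abs_cont[OF ac ab] ab posvar_mono[OF ac ab]] by metis
  have "abs_cont_on a b (\<lambda>t. posvar f a t - f t)" by (rule abs_cont_diff[OF posvar_abs_cont[OF ac ab] ac])
  moreover have "posvar f a s - f s \<le> posvar f a t - f t" if "a \<le> s" "s \<le> t" "t \<le> b" for s t
    using posvar_add_le[OF ac ab that] by linarith
  ultimately obtain h2 where h2: "\<And>x. 0 \<le> h2 x"
    "\<And>t. t \<in> {a..b} \<Longrightarrow> (h2 has_integral ((posvar f a t - f t) - (posvar f a a - f a))) {a..t}"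
    using mono_abs_cont_has_integral[OF _ ab, of "\<lambda>t. posvar f a t - f t"] by metis
  define h where "h = (\<lambda>x. h1 x - h2 x)"
  have "h1 absolutely_integrable_on {a..b}" "h2 absolutely_integrable_on {a..b}"
    using h1(1) h1(2)[of b] h2(1) h2(2)[of b] ab
    by (auto intro!: nonnegative_absolutely_integrable_1)
  then have hint: "h absolutely_integrable_on {a..b}" unfolding h_def
    by (rule set_integral_diff(1))
  have hI: "(h has_integral (f t - f a)) {a..t}" if "t \<in> {a..b}" for t
    using has_integral_diff[OF h1(2)[OF that] h2(2)[OF that]] by (simp add: h_def)
  obtain N where N: "negligible N"
    "\<And>x. x \<in> {a<..<b} - N \<Longrightarrow> ((\<lambda>t. integral {a..t} h) has_real_derivative h x) (at x)"
    using indefinite_integral_has_derivative_ae[of h a b] hint set_lebesgue_integral_eq_integral(1) by blast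
  \<comment> \<open>The endpoints join the exceptional set: f is arbitrary outside [a, b], so a
    two-sided derivative may fail to exist there.\<close>
  have der: "(f has_real_derivative h t) (at t)" if t: "t \<in> {a..b} - (N \<union> {a,b})" for t
  proof -
    have t': "t \<in> {a<..<b}" using t by auto
    have "((\<lambda>t. f a + integral {a..t} h) has_real_derivative h t) (at t)"
      using N(2)[of t] t t' by (auto intro!: derivative_eq_intros)
    then show ?thesis
    proof (rule DERIV_cong_ev[THEN iffD1, rotated -1])
      show "\<forall>\<^sub>F x in nhds t. f a + integral {a..x} h = f x"
      proof (rule eventually_nhds_in_open[of "{a<..<b}", THEN eventually_mono])
        fix x assume "x \<in> {a<..<b}"
        then show "f a + integral {a..x} h = f x" using integral_unique[OF hI[of x]] by simp
      qed (use t' in auto)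
    qed auto
  qed
  have "negligible (N \<union> {a,b})" using N(1) by auto
  then show ?thesis using that hint hI der by blast
qed

section \<open>Equivariance of the signature\<close>

lemma abs_cont_mult:
  fixes f g :: "real \<Rightarrow> real"
  assumes f: "abs_cont_on a b f" and g: "abs_cont_on a b g"
  shows "abs_cont_on a b (\<lambda>t. f t * g t)"
proof -
  have "bounded (f ` {a..b})" "bounded (g ` {a..b})"
    using abs_cont_continuous[OF f] abs_cont_continuous[OF g]
    by (auto intro!: compact_imp_bounded compact_continuous_image)
  then obtain B1 B2 where B12: "\<And>t. t \<in> {a..b} \<Longrightarrow> \<bar>f t\<bar> \<le> B1" "\<And>t. t \<in> {a..b} \<Longrightarrow> \<bar>g t\<bar> \<le> B2"
    unfolding bounded_iff by (metis imageI real_norm_def)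
  define B where "B = max 1 (max B1 B2)"
  have B: "B > 0" "\<And>t. t \<in> {a..b} \<Longrightarrow> \<bar>f t\<bar> \<le> B" "\<And>t. t \<in> {a..b} \<Longrightarrow> \<bar>g t\<bar> \<le> B"
    using B12 by (fastforce simp: B_def)+
  show ?thesis unfolding abs_cont_on_def
  proof (intro allI impI)
    fix \<epsilon> :: real assume e: "\<epsilon> > 0"
    then have e2: "\<epsilon> / (2 * B) > 0" using B by simp
    obtain d1 where d1: "d1 > 0" and D1: "\<And>(I::nat set) x y. interval_family a b I x y \<Longrightarrow>
     (\<Sum>k\<in>I. y k - x k) < d1 \<Longrightarrow> (\<Sum>k\<in>I. \<bar>f (y k) - f (x k)\<bar>) < \<epsilon> / (2 * B)"
      using abs_cont_family[OF f e2] by blast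
    obtain d2 where d2: "d2 > 0" and D2: "\<And>(I::nat set) x y. interval_family a b I x y \<Longrightarrow>
     (\<Sum>k\<in>I. y k - x k) < d2 \<Longrightarrow> (\<Sum>k\<in>I. \<bar>g (y k) - g (x k)\<bar>) < \<epsilon> / (2 * B)"
      using abs_cont_family[OF g e2] by blast
    show "\<exists>\<delta>>0. \<forall>(n::nat) x y. (\<forall>k<n. a \<le> x k \<and> x k < y k \<and> y k \<le> b) \<and>
      (\<forall>k<n. \<forall>l<n. k \<noteq> l \<longrightarrow> y k \<le> x l \<or> y l \<le> x k) \<and> (\<Sum>k<n. y k - x k) < \<delta> \<longrightarrow>
      (\<Sum>k<n. \<bar>f (y k) * g (y k) - f (x k) * g (x k)\<bar>) < \<epsilon>"
    proof (intro exI[of _ "min d1 d2"] conjI allI impI; (elim conjE)?)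
      show "min d1 d2 > 0" using d1 d2 by simp
      fix n :: nat and x y :: "nat \<Rightarrow> real"
      assume xy: "\<forall>k<n. a \<le> x k \<and> x k < y k \<and> y k \<le> b"
        and no: "\<forall>k<n. \<forall>l<n. k \<noteq> l \<longrightarrow> y k \<le> x l \<or> y l \<le> x k"
        and sm: "(\<Sum>k<n. y k - x k) < min d1 d2"
      have fam: "interval_family a b {..<n} x y"
        using xy no by (auto simp: interval_family_def less_imp_le)
      have "(\<Sum>k<n. \<bar>f (y k) * g (y k) - f (x k) * g (x k)\<bar>) \<le>
          (\<Sum>k<n. B * \<bar>f (y k) - f (x k)\<bar> + B * \<bar>g (y k) - g (x k)\<bar>)"
      proof (rule sum_mono)
        fix k assume "k \<in> {..<n}"
        then have k: "x k \<in> {a..b}" "y k \<in> {a..b}" using xy by force+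
        have "\<bar>f (y k) * g (y k) - f (x k) * g (x k)\<bar>
            = \<bar>g (y k) * (f (y k) - f (x k)) + f (x k) * (g (y k) - g (x k))\<bar>"
          by (simp add: algebra_simps)
        also have "\<dots> \<le> \<bar>g (y k)\<bar> * \<bar>f (y k) - f (x k)\<bar> + \<bar>f (x k)\<bar> * \<bar>g (y k) - g (x k)\<bar>"
          by (metis abs_mult abs_triangle_ineq)
        also have "\<dots> \<le> B * \<bar>f (y k) - f (x k)\<bar> + B * \<bar>g (y k) - g (x k)\<bar>"
          using B k by (intro add_mono mult_right_mono) auto
        finally show "\<bar>f (y k) * g (y k) - f (x k) * g (x k)\<bar>
          \<le> B * \<bar>f (y k) - f (x k)\<bar> + B * \<bar>g (y k) - g (x k)\<bar>" .
      qed
      also have "\<dots> = B * (\<Sum>k<n. \<bar>f (y k) - f (x k)\<bar>) + B * (\<Sum>k<n. \<bar>g (y k) - g (x k)\<bar>)"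
        by (simp add: sum.distrib sum_distrib_left)
      also have "\<dots> < B * (\<epsilon> / (2 * B)) + B * (\<epsilon> / (2 * B))"
        using D1[OF fam] D2[OF fam] sm B(1) by (intro add_strict_mono mult_strict_left_mono) auto
      also have "\<dots> = \<epsilon>" using B(1) by simp
      finally show "(\<Sum>k<n. \<bar>f (y k) * g (y k) - f (x k) * g (x k)\<bar>) < \<epsilon>" .
    qed
  qed
qed

lemma abs_cont_const: "abs_cont_on a b (\<lambda>_. c)"
  unfolding abs_cont_on_def by (auto intro: exI[of _ 1])

text \<open>\<open>iter_int\<close> uses the total operator \<open>deriv\<close>; off a negligible
  set it is the density, and integrals do not see the rest.\<close>

lemma abs_cont_deriv:
  fixes f :: "real \<Rightarrow> real"
  assumes ac: "abs_cont_on a b f" and ab: "a \<le> b"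
  obtains N where "deriv f absolutely_integrable_on {a..b}"
    "\<And>t. t \<in> {a..b} \<Longrightarrow> (deriv f has_integral (f t - f a)) {a..t}" "negligible N"
    "\<And>t. t \<in> {a..b} - N \<Longrightarrow> (f has_real_derivative deriv f t) (at t)"
proof -
  obtain h N where h: "h absolutely_integrable_on {a..b}"
    "\<And>t. t \<in> {a..b} \<Longrightarrow> (h has_integral (f t - f a)) {a..t}" "negligible N"
    "\<And>t. t \<in> {a..b} - N \<Longrightarrow> (f has_real_derivative h t) (at t)"
    using abs_cont_ftc[OF ac ab] by blast
  have eq: "deriv f t = h t" if "t \<in> {a..b} - N" for t
    using h(4)[OF that] by (rule DERIV_imp_deriv)
  show ?thesis
  proof
    show "deriv f absolutely_integrable_on {a..b}"
      by (rule absolutely_integrable_spike[OF h(1) h(3)]) (use eq in auto)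
    show "(deriv f has_integral (f t - f a)) {a..t}" if "t \<in> {a..b}" for t
      by (rule has_integral_spike[OF h(3) _ h(2)[OF that]]) (use eq that in auto)
    show "negligible N" by fact
    show "(f has_real_derivative deriv f t) (at t)" if "t \<in> {a..b} - N" for t
      using h(4)[OF that] eq[OF that] by simp
  qed
qed

lemma absolutely_integrable_continuous_mult:
  fixes f g :: "real \<Rightarrow> real"
  assumes "continuous_on {a..b} f" "g absolutely_integrable_on {a..b}"
  shows "(\<lambda>x. f x * g x) absolutely_integrable_on {a..b}"
proof (rule absolutely_integrable_bounded_measurable_product_real)
  show "f \<in> borel_measurable (lebesgue_on {a..b})"
    using assms by (intro continuous_imp_measurable_on_sets_lebesgue) auto
  show "bounded (f ` {a..b})" using assms by (auto intro!: compact_imp_bounded compact_continuous_image)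
qed (use assms in auto)

section \<open>Iterated integrals under linear maps\<close>

text \<open>What the equivariance of iterated integrals uses of absolute continuity. In this form,
  closure under linear maps needs only linearity of derivative and integral.\<close>

definition regular_path :: "nat \<Rightarrow> (real \<Rightarrow> nat \<Rightarrow> real) \<Rightarrow> bool" where
  "regular_path d Z \<longleftrightarrow> (\<forall>i\<in>{1..d}. deriv (\<lambda>r. Z r i) absolutely_integrable_on {0..1} \<and>
     (\<exists>N. negligible N \<and> (\<forall>t\<in>{0..1} - N. (\<lambda>r. Z r i) field_differentiable at t)))"

lemma abs_cont_regular_path: "abs_cont_path d Z \<Longrightarrow> regular_path d Z"
  unfolding abs_cont_path_def regular_path_def
proof
  fix i assume "\<forall>i\<in>{1..d}. abs_cont_on 0 1 (\<lambda>t. Z t i)" "i \<in> {1..d}"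
  then have "abs_cont_on 0 1 (\<lambda>t. Z t i)" by blast
  from abs_cont_deriv[OF this] obtain N where
    "deriv (\<lambda>t. Z t i) absolutely_integrable_on {0..1}" "negligible N"
    "\<And>t. t \<in> {0..1} - N \<Longrightarrow> ((\<lambda>t. Z t i) has_real_derivative deriv (\<lambda>t. Z t i) t) (at t)"
    by (metis zero_le_one)
  then show "deriv (\<lambda>r. Z r i) absolutely_integrable_on {0..1} \<and>
     (\<exists>N. negligible N \<and> (\<forall>t\<in>{0..1} - N. (\<lambda>r. Z r i) field_differentiable at t))"
    unfolding field_differentiable_def by blast
qed

lemma path_act_deriv_ae:
  assumes "regular_path d Z"
  obtains N where "negligible N"
    "\<And>a t. t \<in> {0..1} - N \<Longrightarrow>
      ((\<lambda>r. path_act d g Z r a) has_real_derivative (\<Sum>k\<in>{1..d}. g a k * deriv (\<lambda>r. Z r k) t)) (at t)"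
proof -
  obtain N where N: "\<And>i. i \<in> {1..d} \<Longrightarrow> negligible (N i)"
    "\<And>i t. i \<in> {1..d} \<Longrightarrow> t \<in> {0..1} - N i \<Longrightarrow> (\<lambda>r. Z r i) field_differentiable at t"
    using assms unfolding regular_path_def by metis
  show ?thesis
  proof
    show "negligible (\<Union>i\<in>{1..d}. N i)" using N(1) by (intro negligible_Union) auto
    fix a t assume "t \<in> {0..1} - (\<Union>i\<in>{1..d}. N i)"
    then have "((\<lambda>r. Z r i) has_real_derivative deriv (\<lambda>r. Z r i) t) (at t)" if "i \<in> {1..d}" for i
      using N(2)[OF that, of t] that by (auto simp: field_differentiable_derivI)
    then show "((\<lambda>r. path_act d g Z r a) has_real_derivative (\<Sum>k\<in>{1..d}. g a k * deriv (\<lambda>r. Z r k) t)) (at t)"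
      unfolding path_act_def by (intro DERIV_sum DERIV_cmult)
  qed
qed

lemma regular_path_act:
  assumes "regular_path d Z"
  shows "regular_path d (path_act d g Z)"
proof -
  obtain N where N: "negligible N"
    "\<And>a t. t \<in> {0..1} - N \<Longrightarrow>
      ((\<lambda>r. path_act d g Z r a) has_real_derivative (\<Sum>k\<in>{1..d}. g a k * deriv (\<lambda>r. Z r k) t)) (at t)"
    using path_act_deriv_ae[OF assms] by blast
  have "(\<lambda>t. \<Sum>k\<in>{1..d}. g a k * deriv (\<lambda>r. Z r k) t) absolutely_integrable_on {0..1}" for a
    using assms unfolding regular_path_def by (intro absolutely_integrable_sum set_integrable_mult_right) auto
  then have "deriv (\<lambda>r. path_act d g Z r a) absolutely_integrable_on {0..1}" for a
    by (rule absolutely_integrable_spike[OF _ N(1)]) (use DERIV_imp_deriv[OF N(2)] in auto)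
  then show ?thesis unfolding regular_path_def field_differentiable_def using N by blast
qed

text \<open>A continuous factor on a compact interval is bounded, so its product with the absolutely
  integrable derivative stays integrable. Hence no iterated integral over letters in {1..d} takes
  the default value of \<open>integral\<close>.\<close>

lemma iter_int_continuous:
  assumes Z: "regular_path d Z" and "set ws \<subseteq> {1..d}"
  shows "continuous_on {0..1} (iter_int Z ws)"
  using assms(2)
proof (induction ws)
  case Nil
  have "iter_int Z [] = (\<lambda>_. 1)" by auto
  then show ?case by simp
next
  case (Cons a ws)
  have "deriv (\<lambda>r. Z r a) absolutely_integrable_on {0..1}" using Cons.prems Z by (auto simp: regular_path_def)
  with Cons have "(\<lambda>s. iter_int Z ws s * deriv (\<lambda>r. Z r a) s) absolutely_integrable_on {0..1}"
    by (intro absolutely_integrable_continuous_mult) auto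
  then have "continuous_on {0..1} (\<lambda>t. integral {0..t} (\<lambda>s. iter_int Z ws s * deriv (\<lambda>r. Z r a) s))"
    by (intro indefinite_integral_continuous_1) (rule set_lebesgue_integral_eq_integral(1))
  moreover have "iter_int Z (a # ws) = (\<lambda>t. integral {0..t} (\<lambda>s. iter_int Z ws s * deriv (\<lambda>r. Z r a) s))"
    by (rule ext) simp
  ultimately show ?case by (simp only:)
qed

lemma iter_int_integrable:
  assumes "regular_path d Z" "set ws \<subseteq> {1..d}" "a \<in> {1..d}" "t \<in> {0..1}"
  shows "(\<lambda>s. iter_int Z ws s * deriv (\<lambda>r. Z r a) s) integrable_on {0..t}"
proof -
  have "(\<lambda>s. iter_int Z ws s * deriv (\<lambda>r. Z r a) s) absolutely_integrable_on {0..1}"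
    using assms iter_int_continuous[OF assms(1,2)]
    by (intro absolutely_integrable_continuous_mult) (auto simp: regular_path_def)
  then have "(\<lambda>s. iter_int Z ws s * deriv (\<lambda>r. Z r a) s) integrable_on {0..1}"
    by (rule set_lebesgue_integral_eq_integral(1))
  then show ?thesis by (rule integrable_on_subinterval) (use assms(4) in auto)
qed

text \<open>The tensor power action of g on functions of words: the value at w is the sum, over
  words u of the same length, of F u times the product of the entries g w_n u_n. The recursion
  avoids a sum over words.\<close>

fun word_act :: "nat \<Rightarrow> (nat \<Rightarrow> nat \<Rightarrow> real) \<Rightarrow> (nat list \<Rightarrow> real) \<Rightarrow> nat list \<Rightarrow> real" where
  "word_act d g F [] = F []"
| "word_act d g F (a # ws) = (\<Sum>k\<in>{1..d}. g a k * word_act d g (\<lambda>u. F (k # u)) ws)"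

lemma word_act_cong:
  "(\<And>u. set u \<subseteq> {1..d} \<Longrightarrow> F u = F' u) \<Longrightarrow> word_act d g F ws = word_act d g F' ws"
proof (induction ws arbitrary: F F')
  case Nil
  then show ?case by simp
next
  case (Cons a ws)
  have "word_act d g (\<lambda>u. F (k # u)) ws = word_act d g (\<lambda>u. F' (k # u)) ws" if "k \<in> {1..d}" for k
    by (intro Cons.IH Cons.prems) (use that in auto)
  then show ?case by simp
qed

lemma word_act_has_integral:
  assumes "\<And>u. set u \<subseteq> {1..d} \<Longrightarrow> (\<lambda>s. F u s * \<phi> s) integrable_on S"
  shows "((\<lambda>s. word_act d g (\<lambda>u. F u s) ws * \<phi> s) has_integral
     word_act d g (\<lambda>u. integral S (\<lambda>s. F u s * \<phi> s)) ws) S"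
  using assms
proof (induction ws arbitrary: F)
  case Nil
  then show ?case by (auto intro: integrable_integral)
next
  case (Cons a ws)
  have "((\<lambda>s. \<Sum>k\<in>{1..d}. g a k * (word_act d g (\<lambda>u. F (k # u) s) ws * \<phi> s)) has_integral
     (\<Sum>k\<in>{1..d}. g a k * word_act d g (\<lambda>u. integral S (\<lambda>s. F (k # u) s * \<phi> s)) ws)) S"
    by (intro has_integral_sum has_integral_mult_right Cons.IH Cons.prems) auto
  then show ?case by (simp add: sum_distrib_right mult.assoc)
qed

text \<open>Almost everywhere the derivative of a transformed coordinate is the same linear
  combination of derivatives, and \<open>word_act_has_integral\<close> exchanges the sums with the
  integral.\<close>

lemma iter_int_path_act:
  assumes Z: "regular_path d Z" and "t \<in> {0..1}"
  shows "iter_int (path_act d g Z) ws t = word_act d g (\<lambda>u. iter_int Z u t) ws"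
  using assms(2)
proof (induction ws arbitrary: t)
  case Nil
  then show ?case by simp
next
  case (Cons a ws)
  obtain N where N: "negligible N"
    "\<And>a t. t \<in> {0..1} - N \<Longrightarrow>
      ((\<lambda>r. path_act d g Z r a) has_real_derivative (\<Sum>k\<in>{1..d}. g a k * deriv (\<lambda>r. Z r k) t)) (at t)"
    using path_act_deriv_ae[OF Z] by blast
  have "iter_int (path_act d g Z) (a # ws) t = integral {0..t}
      (\<lambda>s. iter_int (path_act d g Z) ws s * deriv (\<lambda>r. path_act d g Z r a) s)"
    by simp
  also have "\<dots> = integral {0..t} (\<lambda>s. \<Sum>k\<in>{1..d}. g a k *
      (word_act d g (\<lambda>u. iter_int Z u s) ws * deriv (\<lambda>r. Z r k) s))"
  proof (rule integral_spike[OF N(1)])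
    fix s assume s: "s \<in> {0..t} - N"
    then have s1: "s \<in> {0..1} - N" using Cons.prems by auto
    show "(\<Sum>k\<in>{1..d}. g a k * (word_act d g (\<lambda>u. iter_int Z u s) ws * deriv (\<lambda>r. Z r k) s)) =
      iter_int (path_act d g Z) ws s * deriv (\<lambda>r. path_act d g Z r a) s"
      using Cons.IH[of s] s1 DERIV_imp_deriv[OF N(2)[OF s1, of a]]
      by (simp add: sum_distrib_left mult.left_commute)
  qed
  also have "\<dots> = (\<Sum>k\<in>{1..d}. g a k * word_act d g (\<lambda>u. iter_int Z (k # u) t) ws)"
  proof (rule integral_unique, intro has_integral_sum has_integral_mult_right)
    fix k assume k: "k \<in> {1..d}"
    show "((\<lambda>s. word_act d g (\<lambda>u. iter_int Z u s) ws * deriv (\<lambda>r. Z r k) s) has_integral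
        word_act d g (\<lambda>u. iter_int Z (k # u) t) ws) {0..t}"
      using word_act_has_integral[of d "iter_int Z" "deriv (\<lambda>r. Z r k)" "{0..t}" g ws]
        iter_int_integrable[OF Z _ k Cons.prems] by simp
  qed simp
  finally show ?case by simp
qed

text \<open>The reversals appear because \<open>iter_int\<close> has the last letter at the head of
  the list.\<close>

lemma sig_path_act:
  assumes "regular_path d Z"
  shows "sig (path_act d g Z) w = word_act d g (\<lambda>u. sig Z (rev u)) (rev w)"
  using iter_int_path_act[OF assms, of 1] by (simp add: sig_def)

lemma sig_eq_path_act:
  assumes "regular_path d Z" "regular_path d Z'" "sig_eq d Z Z'"
  shows "sig_eq d (path_act d g Z) (path_act d g Z')"
  unfolding sig_eq_def sig_path_act[OF assms(1)] sig_path_act[OF assms(2)]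
  using assms(3) by (auto simp: sig_eq_def intro!: word_act_cong)

lemma iter_int_cong:
  "(\<And>t i. i \<in> {1..d} \<Longrightarrow> Z t i = Z' t i) \<Longrightarrow> set ws \<subseteq> {1..d} \<Longrightarrow> iter_int Z ws t = iter_int Z' ws t"
  by (induction ws arbitrary: t) auto

lemma sig_eq_cong:
  "(\<And>t i. i \<in> {1..d} \<Longrightarrow> Z t i = Z' t i) \<Longrightarrow> sig_eq d Z Z'"
  unfolding sig_eq_def sig_def using iter_int_cong[of d Z Z'] by simp

section \<open>Signature and logarithm on words of length at most two\<close>

lemma iter_int_letter:
  assumes ac: "abs_cont_on 0 1 (\<lambda>t. Z t i)" and t: "t \<in> {0..1}"
  shows "iter_int Z [i] t = Z t i - Z 0 i"
proof -
  have "(deriv (\<lambda>t. Z t i) has_integral (Z t i - Z 0 i)) {0..t}"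
    using abs_cont_deriv[OF ac] t by (metis zero_le_one)
  then show ?thesis by (simp add: integral_unique)
qed

text \<open>The shuffle relation is integration by parts for the absolutely continuous product
  of two coordinates.\<close>
lemma sig_shuffle:
  assumes Z: "abs_cont_path d Z" and i: "i \<in> {1..d}" and j: "j \<in> {1..d}"
  shows "sig Z [i] * sig Z [j] = sig Z [i, j] + sig Z [j, i]"
proof -
  have aci: "abs_cont_on 0 1 (\<lambda>t. Z t i)" and acj: "abs_cont_on 0 1 (\<lambda>t. Z t j)"
    using Z i j by (auto simp: abs_cont_path_def)
  define f where "f = (\<lambda>k t. Z t k - Z 0 k)"
  have acf: "abs_cont_on 0 1 (f i)" "abs_cont_on 0 1 (f j)" unfolding f_def
    using aci acj by (auto intro!: abs_cont_diff abs_cont_const)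
  obtain N1 where N1: "negligible N1"
    "\<And>t. t \<in> {0..1} - N1 \<Longrightarrow> ((\<lambda>t. Z t i) has_real_derivative deriv (\<lambda>t. Z t i) t) (at t)"
    using abs_cont_deriv[OF aci] by (metis zero_le_one)
  obtain N2 where N2: "negligible N2"
    "\<And>t. t \<in> {0..1} - N2 \<Longrightarrow> ((\<lambda>t. Z t j) has_real_derivative deriv (\<lambda>t. Z t j) t) (at t)"
    using abs_cont_deriv[OF acj] by (metis zero_le_one)
  have der: "deriv (\<lambda>t. f i t * f j t) t = iter_int Z [i] t * deriv (\<lambda>t. Z t j) t
      + iter_int Z [j] t * deriv (\<lambda>t. Z t i) t" if t: "t \<in> {0..1} - (N1 \<union> N2)" for t
  proof -
    have "((\<lambda>t. f i t * f j t) has_real_derivative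
        (deriv (\<lambda>t. Z t i) t * f j t + deriv (\<lambda>t. Z t j) t * f i t)) (at t)"
      unfolding f_def using N1(2)[of t] N2(2)[of t] t
      by (auto intro!: derivative_eq_intros)
    moreover have "iter_int Z [i] t = f i t" "iter_int Z [j] t = f j t"
      using iter_int_letter[of Z, OF aci] iter_int_letter[of Z, OF acj] t by (auto simp: f_def simp del: iter_int.simps)
    ultimately show ?thesis by (simp add: DERIV_imp_deriv mult.commute del: iter_int.simps)
  qed
  have "(deriv (\<lambda>t. f i t * f j t) has_integral (f i 1 * f j 1 - f i 0 * f j 0)) {0..1}"
    using abs_cont_deriv[OF abs_cont_mult[OF acf]] by (metis atLeastAtMost_iff zero_le_one order_refl)
  then have 1: "((\<lambda>t. iter_int Z [i] t * deriv (\<lambda>t. Z t j) t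
      + iter_int Z [j] t * deriv (\<lambda>t. Z t i) t) has_integral (f i 1 * f j 1 - f i 0 * f j 0)) {0..1}"
    by (rule has_integral_spike[rotated 2, where S="N1 \<union> N2"])
       (use N1 N2 der in \<open>auto simp del: iter_int.simps\<close>)
  have reg: "regular_path d Z" by (rule abs_cont_regular_path[OF Z])
  have "((\<lambda>t. iter_int Z [i] t * deriv (\<lambda>t. Z t j) t
      + iter_int Z [j] t * deriv (\<lambda>t. Z t i) t) has_integral (sig Z [i,j] + sig Z [j,i])) {0..1}"
  proof (rule has_integral_add)
    show "((\<lambda>t. iter_int Z [i] t * deriv (\<lambda>t. Z t j) t) has_integral sig Z [i,j]) {0..1}"
      using iter_int_integrable[OF reg, of "[i]" j 1] i j
      by (auto simp: sig_def intro: integrable_integral)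
    show "((\<lambda>t. iter_int Z [j] t * deriv (\<lambda>t. Z t i) t) has_integral sig Z [j,i]) {0..1}"
      using iter_int_integrable[OF reg, of "[j]" i 1] i j
      by (auto simp: sig_def intro: integrable_integral)
  qed
  with 1 have "sig Z [i,j] + sig Z [j,i] = f i 1 * f j 1 - f i 0 * f j 0"
    by (rule has_integral_unique[rotated])
  moreover have "sig Z [i] = f i 1" "sig Z [j] = f j 1"
    using iter_int_letter[of Z, OF aci, of 1] iter_int_letter[of Z, OF acj, of 1] by (auto simp: sig_def f_def)
  ultimately show ?thesis by (simp add: f_def)
qed

lemma logsig2_fst: "fst (logsig2 Z) i = sig Z [i]"
  by (simp add: logsig2_def ser_log_def ser_mult_def ser_one_def sig_def)

text \<open>S - 1 has no constant term, so on two letters its square sees only the splitting [i],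
  [j]; \<open>ser_log\<close> stops at the second power.\<close>

lemma logsig2_snd: "snd (logsig2 Z) i j = sig Z [i, j] - sig Z [i] * sig Z [j] / 2"
proof -
  have "{1..2} = {1, 2::nat}" by auto
  then show ?thesis
    by (simp add: logsig2_def ser_log_def ser_mult_def ser_one_def sig_def numeral_2_eq_2 atMost_Suc)
qed

text \<open>\<open>act\<close> rebuilds a skew matrix from the entries with k < l, while the
  signature of the moved path involves all words [k, l]. The two agree because the shuffle relation
  makes the degree-two coefficients of the logarithm antisymmetric, with zero diagonal.\<close>

lemma logsig2_path_act:
  assumes Z: "abs_cont_path d Z"
  shows "logsig2 (path_act d g Z) = act d g (logsig2 Z)"
proof -
  have reg: "regular_path d Z" by (rule abs_cont_regular_path[OF Z])
  have s1: "sig (path_act d g Z) [i] = (\<Sum>k\<in>{1..d}. g i k * sig Z [k])" for i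
    by (simp add: sig_path_act[OF reg])
  have s2: "sig (path_act d g Z) [i, j] = (\<Sum>k\<in>{1..d}. \<Sum>l\<in>{1..d}. g i k * sig Z [k, l] * g j l)" for i j
    by (simp add: sig_path_act[OF reg] sum_distrib_left)
       (subst sum.swap, simp add: mult_ac)
  have sk: "skew (snd (logsig2 Z)) k l = sig Z [k, l] - sig Z [k] * sig Z [l] / 2"
    if "k \<in> {1..d}" "l \<in> {1..d}" for k l
    using sig_shuffle[OF Z that] sig_shuffle[OF Z that(1) that(1)]
    by (cases "k = l") (auto simp: skew_def logsig2_snd field_simps)
  show ?thesis
  proof (rule prod_eqI)
    show "fst (logsig2 (path_act d g Z)) = fst (act d g (logsig2 Z))"
      by (simp add: fun_eq_iff act_def logsig2_fst s1)
    show "snd (logsig2 (path_act d g Z)) = snd (act d g (logsig2 Z))"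
    proof (intro ext)
      fix i j
      have "snd (act d g (logsig2 Z)) i j =
          (\<Sum>k\<in>{1..d}. \<Sum>l\<in>{1..d}. g i k * (sig Z [k, l] - sig Z [k] * sig Z [l] / 2) * g j l)"
        by (simp add: act_def sk)
      also have "\<dots> = (\<Sum>k\<in>{1..d}. \<Sum>l\<in>{1..d}. g i k * sig Z [k, l] * g j l)
          - (\<Sum>k\<in>{1..d}. g i k * sig Z [k]) * (\<Sum>l\<in>{1..d}. g j l * sig Z [l]) / 2"
        by (simp add: sum_product sum_divide_distrib sum_subtractf[symmetric] algebra_simps)
      finally show "snd (logsig2 (path_act d g Z)) i j = snd (act d g (logsig2 Z)) i j"
        by (simp add: logsig2_snd s1 s2)
    qed
  qed
qed

section \<open>The Lanczos recursion\<close>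

declare One_nat_def [simp del]

section \<open>Orthogonal matrices and their action\<close>

text \<open>\<open>orth\<close> says A A^T = I; that A^T A = I follows is the finite-dimensional
  fact that a one-sided inverse of a square matrix is two-sided, taken from the matrix library after
  shifting the indices to start at 0.\<close>

lemma orth_transpose:
  fixes A :: "nat \<Rightarrow> nat \<Rightarrow> 'a::field"
  assumes "orth d A"
  shows "orth d (\<lambda>i j. A j i)"
proof -
  define M where "M = Matrix.mat d d (\<lambda>(i, j). A (Suc i) (Suc j))"
  define T where "T = Matrix.mat d d (\<lambda>(i, j). A (Suc j) (Suc i))"
  have shift: "(\<Sum>k\<in>{1..d}. f k) = (\<Sum>k<d. f (Suc k))" for f :: "nat \<Rightarrow> 'a"
    by (rule sum.reindex_bij_witness[of _ Suc "\<lambda>k. k - 1"]) auto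
  have "M * T = 1\<^sub>m d"
  proof (rule eq_matI)
    fix i j assume ij: "i < dim_row (1\<^sub>m d :: 'a mat)" "j < dim_col (1\<^sub>m d :: 'a mat)"
    have "(M * T) $$ (i, j) = (\<Sum>k<d. A (Suc i) (Suc k) * A (Suc j) (Suc k))"
      using ij by (simp add: M_def T_def scalar_prod_def atLeast0LessThan)
    also have "\<dots> = (if Suc i = Suc j then 1 else 0)"
      using assms ij unfolding orth_def shift by auto
    finally show "(M * T) $$ (i, j) = 1\<^sub>m d $$ (i, j)" using ij by simp
  qed (auto simp: M_def T_def)
  then have TM: "T * M = 1\<^sub>m d"
    by (intro mat_mult_left_right_inverse[of M d T]) (auto simp: M_def T_def)
  show ?thesis unfolding orth_def
  proof (intro ballI)
    fix i j assume "i \<in> {1..d}" "j \<in> {1..d}"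
    then obtain i' j' where ij: "i = Suc i'" "j = Suc j'" "i' < d" "j' < d"
      by (metis Suc_diff_1 atLeastAtMost_iff less_eq_Suc_le Suc_le_D One_nat_def)
    have "(\<Sum>k\<in>{1..d}. A k i * A k j) = (T * M) $$ (i', j')"
      unfolding shift using ij by (simp add: M_def T_def scalar_prod_def atLeast0LessThan)
    then show "(\<Sum>k\<in>{1..d}. A k i * A k j) = (if i = j then 1 else 0)"
      using ij TM by simp
  qed
qed

lemma orth_colD:
  fixes A :: "nat \<Rightarrow> nat \<Rightarrow> 'a::field"
  assumes "orth d A" "i \<in> {1..d}" "j \<in> {1..d}"
  shows "(\<Sum>k\<in>{1..d}. A k i * A k j) = (if i = j then 1 else 0)"
  using orth_transpose[OF assms(1)] assms(2,3) by (simp add: orth_def)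

definition matmul :: "nat \<Rightarrow> (nat \<Rightarrow> nat \<Rightarrow> 'a::comm_ring_1) \<Rightarrow> (nat \<Rightarrow> nat \<Rightarrow> 'a) \<Rightarrow> nat \<Rightarrow> nat \<Rightarrow> 'a" where
  "matmul d A B i j = (\<Sum>k\<in>{1..d}. A i k * B k j)"

lemma orth_norm:
  fixes A :: "nat \<Rightarrow> nat \<Rightarrow> 'a::field"
  assumes "orth d A"
  shows "(\<Sum>k\<in>{1..d}. (\<Sum>l\<in>{1..d}. A k l * x l) * (\<Sum>l\<in>{1..d}. A k l * y l)) = (\<Sum>l\<in>{1..d}. x l * y l)"
proof -
  have "(\<Sum>k\<in>{1..d}. (\<Sum>l\<in>{1..d}. A k l * x l) * (\<Sum>l\<in>{1..d}. A k l * y l))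
      = (\<Sum>k\<in>{1..d}. \<Sum>l\<in>{1..d}. \<Sum>m\<in>{1..d}. x l * y m * (A k l * A k m))"
    by (simp add: sum_product mult_ac)
  also have "\<dots> = (\<Sum>l\<in>{1..d}. \<Sum>m\<in>{1..d}. \<Sum>k\<in>{1..d}. x l * y m * (A k l * A k m))"
    by (subst sum.swap, rule sum.cong[OF refl], subst sum.swap, rule refl)
  also have "\<dots> = (\<Sum>l\<in>{1..d}. \<Sum>m\<in>{1..d}. x l * y m * (if l = m then 1 else 0))"
    unfolding sum_distrib_left[symmetric] by (intro sum.cong refl) (simp add: orth_colD[OF assms])
  also have "\<dots> = (\<Sum>l\<in>{1..d}. x l * y l)"
    by (intro sum.cong refl) (simp add: if_distrib[of "(*) _"] sum.delta cong: if_cong)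
  finally show ?thesis .
qed

lemma orth_matmul:
  fixes A :: "nat \<Rightarrow> nat \<Rightarrow> 'a::field"
  assumes "orth d A" "orth d B"
  shows "orth d (matmul d A B)"
  unfolding orth_def
proof (intro ballI)
  fix i j assume ij: "i \<in> {1..d}" "j \<in> {1..d}"
  have "(\<Sum>k\<in>{1..d}. matmul d A B i k * matmul d A B j k) = (\<Sum>l\<in>{1..d}. A i l * A j l)"
    using orth_norm[OF orth_transpose[OF assms(2)], of "A i" "A j"] by (simp add: matmul_def mult.commute)
  then show "(\<Sum>k\<in>{1..d}. matmul d A B i k * matmul d A B j k) = (if i = j then 1 else 0)"
    using assms(1) ij by (simp add: orth_def)
qed

lemma skew_antisym: "skew m k l = - skew m l k"
  by (auto simp: skew_def)

text \<open>\<open>act\<close> returns the full matrix A M A^T and \<open>skew\<close> reads its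
  upper triangle; nothing is lost because A M A^T is again skew. Its diagonal vanishes since B_ii =
  - B_ii in characteristic 0.\<close>

lemma skew_act:
  fixes A :: "nat \<Rightarrow> nat \<Rightarrow> 'a::field_char_0"
  shows "skew (snd (act d A p)) i j = (\<Sum>k\<in>{1..d}. \<Sum>l\<in>{1..d}. A i k * skew (snd p) k l * A j l)"
proof -
  define B where "B = (\<lambda>i j. \<Sum>k\<in>{1..d}. \<Sum>l\<in>{1..d}. A i k * skew (snd p) k l * A j l)"
  have anti: "B i j = - B j i" for i j
  proof -
    have "B i j = (\<Sum>l\<in>{1..d}. \<Sum>k\<in>{1..d}. A i k * skew (snd p) k l * A j l)"
      unfolding B_def by (rule sum.swap)
    also have "\<dots> = (\<Sum>l\<in>{1..d}. \<Sum>k\<in>{1..d}. - (A j l * skew (snd p) l k * A i k))"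
      by (intro sum.cong refl) (subst skew_antisym, simp add: mult_ac)
    finally show ?thesis by (simp add: B_def sum_negf)
  qed
  have "2 * B i i = 0" for i using anti[of i i] by (metis add.right_inverse mult_2)
  then have diag: "B i i = 0" for i by simp
  have "snd (act d A p) = B" by (simp add: act_def B_def)
  then have "skew (snd (act d A p)) i j = B i j"
    using anti[of i j] diag[of i] by (cases i j rule: linorder_cases) (simp_all add: skew_def)
  then show ?thesis by (simp add: B_def)
qed

lemma act_matmul:
  fixes A B :: "nat \<Rightarrow> nat \<Rightarrow> 'a::field_char_0"
  shows "act d B (act d A p) = act d (matmul d B A) p"
proof (rule prod_eqI)
  show "fst (act d B (act d A p)) = fst (act d (matmul d B A) p)"
    unfolding act_def matmul_def
    by (intro ext) (simp add: sum_distrib_left sum_distrib_right mult.assoc, rule sum.swap)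
  show "snd (act d B (act d A p)) = snd (act d (matmul d B A) p)"
  proof (intro ext)
    fix i j
    let ?S = "skew (snd p)"
    define X where "X = (\<lambda>i l. \<Sum>k\<in>{1..d}. A i k * ?S k l)"
    have sk: "skew (snd (act d A p)) a b = (\<Sum>l\<in>{1..d}. X a l * A b l)" for a b
      unfolding skew_act X_def by (subst sum.swap) (simp add: sum_distrib_right)
    have "snd (act d B (act d A p)) i j = (\<Sum>a\<in>{1..d}. \<Sum>b\<in>{1..d}. B i a * (\<Sum>l\<in>{1..d}. X a l * A b l) * B j b)"
      by (simp add: act_def[of d B] sk)
    also have "\<dots> = (\<Sum>a\<in>{1..d}. \<Sum>l\<in>{1..d}. \<Sum>b\<in>{1..d}. B i a * X a l * (B j b * A b l))"
      by (rule sum.cong[OF refl], subst sum.swap) (simp add: sum_distrib_left sum_distrib_right mult_ac)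
    also have "\<dots> = (\<Sum>a\<in>{1..d}. \<Sum>l\<in>{1..d}. B i a * X a l * matmul d B A j l)"
      by (simp add: matmul_def sum_distrib_left)
    also have "\<dots> = (\<Sum>l\<in>{1..d}. (\<Sum>a\<in>{1..d}. B i a * X a l) * matmul d B A j l)"
      unfolding sum_distrib_right by (rule sum.swap)
    also have "\<dots> = (\<Sum>l\<in>{1..d}. (\<Sum>k\<in>{1..d}. matmul d B A i k * ?S k l) * matmul d B A j l)"
    proof -
      have "(\<Sum>a\<in>{1..d}. B i a * X a l) = (\<Sum>k\<in>{1..d}. matmul d B A i k * ?S k l)" for l
        unfolding X_def matmul_def
        by (simp add: sum_distrib_left sum_distrib_right mult.assoc, rule sum.swap)
      then show ?thesis by simp
    qed
    also have "\<dots> = snd (act d (matmul d B A) p) i j"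
      unfolding act_def by (simp add: sum_distrib_right) (rule sum.swap)
    finally show "snd (act d B (act d A p)) i j = snd (act d (matmul d B A) p) i j" .
  qed
qed

text \<open>The i-th value is (w_i, s_i) with w_i = s_i r_i, where r_1 = v and
  r_{i+1} = M r_i + (|r_i|^2 / |r_{i-1}|^2) r_{i-1}; the scalars s_i clear the denominators, so that
  all entries are polynomial in (v, M). The initial values w_0 = 0 and |r_0|^2 = 1 are conventions.\<close>
fun lanczos :: "nat \<Rightarrow> 'a::field_char_0 pt \<Rightarrow> nat \<Rightarrow> (nat \<Rightarrow> 'a) \<times> 'a" where
  "lanczos d p 0 = (\<lambda>_. 0, 1)"
| "lanczos d p (Suc 0) = (fst p, 1)"
| "lanczos d p (Suc (Suc i)) =
     (let w0 = fst (lanczos d p i); s0 = snd (lanczos d p i);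
          w1 = fst (lanczos d p (Suc i)); s1 = snd (lanczos d p (Suc i));
          n0 = (if i = 0 then 1 else \<Sum>k\<in>{1..d}. (w0 k)\<^sup>2); n1 = (\<Sum>k\<in>{1..d}. (w1 k)\<^sup>2)
      in (\<lambda>k. s1 * n0 * (\<Sum>l\<in>{1..d}. skew (snd p) k l * w1 l) + n1 * s0 * w0 k, s1\<^sup>2 * n0))"

definition "lz_vec d p i = fst (lanczos d p i)"
definition "lz_scale d p i = snd (lanczos d p i)"
definition "lz_norm d p i = (if i = 0 then 1 else \<Sum>k\<in>{1..d}. (lz_vec d p i k)\<^sup>2)"

lemma lz_vec_simps:
  "lz_vec d p 0 k = 0" "lz_vec d p (Suc 0) k = fst p k"
  "lz_vec d p (Suc (Suc i)) k = lz_scale d p (Suc i) * lz_norm d p i *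
      (\<Sum>l\<in>{1..d}. skew (snd p) k l * lz_vec d p (Suc i) l) + lz_norm d p (Suc i) * lz_scale d p i * lz_vec d p i k"
  by (simp_all add: lz_vec_def lz_scale_def lz_norm_def Let_def)

lemma lz_scale_simps:
  "lz_scale d p 0 = 1" "lz_scale d p (Suc 0) = 1"
  "lz_scale d p (Suc (Suc i)) = (lz_scale d p (Suc i))\<^sup>2 * lz_norm d p i"
  by (simp_all add: lz_vec_def lz_scale_def lz_norm_def Let_def)

text \<open>The recursion is built from M, v and the bilinear form alone, and A is compatible with
  each of them.\<close>

lemma lz_act:
  fixes A :: "nat \<Rightarrow> nat \<Rightarrow> 'a::field_char_0"
  assumes A: "orth d A"
  shows "(\<forall>k. lz_vec d (act d A p) i k = (\<Sum>l\<in>{1..d}. A k l * lz_vec d p i l)) \<and>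
    lz_scale d (act d A p) i = lz_scale d p i \<and> lz_norm d (act d A p) i = lz_norm d p i"
proof -
  have norm: "lz_norm d (act d A p) i = lz_norm d p i"
    if "\<forall>k. lz_vec d (act d A p) i k = (\<Sum>l\<in>{1..d}. A k l * lz_vec d p i l)" for i
    using that orth_norm[OF A, of "lz_vec d p i" "lz_vec d p i"]
    by (simp add: lz_norm_def power2_eq_square)
  \<comment> \<open>(A M A^T) (A x) = A (M x), by A^T A = I.\<close>
  have M: "(\<Sum>l\<in>{1..d}. skew (snd (act d A p)) k l * (\<Sum>m\<in>{1..d}. A l m * x m)) =
      (\<Sum>a\<in>{1..d}. A k a * (\<Sum>b\<in>{1..d}. skew (snd p) a b * x b))" for k and x :: "nat \<Rightarrow> 'a"
  proof -
    have "(\<Sum>l\<in>{1..d}. skew (snd (act d A p)) k l * (\<Sum>m\<in>{1..d}. A l m * x m)) =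
      (\<Sum>l\<in>{1..d}. (\<Sum>b\<in>{1..d}. A l b * (\<Sum>a\<in>{1..d}. A k a * skew (snd p) a b)) * (\<Sum>m\<in>{1..d}. A l m * x m))"
    proof -
      have "skew (snd (act d A p)) k l = (\<Sum>b\<in>{1..d}. A l b * (\<Sum>a\<in>{1..d}. A k a * skew (snd p) a b))" for l
        unfolding skew_act by (subst sum.swap) (simp add: sum_distrib_left mult_ac)
      then show ?thesis by simp
    qed
    also have "\<dots> = (\<Sum>b\<in>{1..d}. (\<Sum>a\<in>{1..d}. A k a * skew (snd p) a b) * x b)"
      by (rule orth_norm[OF A])
    also have "\<dots> = (\<Sum>a\<in>{1..d}. A k a * (\<Sum>b\<in>{1..d}. skew (snd p) a b * x b))"
      by (simp add: sum_distrib_left sum_distrib_right mult.assoc) (rule sum.swap)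
    finally show ?thesis .
  qed
  show ?thesis
  proof (induction i rule: induct_nat_012)
    case 0
    then show ?case by (simp add: lz_vec_simps lz_scale_simps lz_norm_def)
  next
    case 1
    have "\<forall>k. lz_vec d (act d A p) (Suc 0) k = (\<Sum>l\<in>{1..d}. A k l * lz_vec d p (Suc 0) l)"
      by (simp add: lz_vec_simps act_def)
    then show ?case using norm by (simp add: lz_scale_simps)
  next
    case (ge2 i)
    have v: "\<forall>k. lz_vec d (act d A p) (Suc (Suc i)) k = (\<Sum>l\<in>{1..d}. A k l * lz_vec d p (Suc (Suc i)) l)"
    proof
      fix k
      have "lz_vec d (act d A p) (Suc (Suc i)) k =
        lz_scale d p (Suc i) * lz_norm d p i * (\<Sum>a\<in>{1..d}. A k a * (\<Sum>b\<in>{1..d}. skew (snd p) a b * lz_vec d p (Suc i) b))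
        + lz_norm d p (Suc i) * lz_scale d p i * (\<Sum>l\<in>{1..d}. A k l * lz_vec d p i l)"
        using ge2 M[of k "lz_vec d p (Suc i)"] by (simp add: lz_vec_simps)
      also have "\<dots> = (\<Sum>l\<in>{1..d}. A k l * lz_vec d p (Suc (Suc i)) l)"
        by (simp add: lz_vec_simps sum_distrib_left sum.distrib algebra_simps)
      finally show "lz_vec d (act d A p) (Suc (Suc i)) k = (\<Sum>l\<in>{1..d}. A k l * lz_vec d p (Suc (Suc i)) l)" .
    qed
    then show ?case using ge2 norm[OF v] by (simp add: lz_scale_simps)
  qed
qed

section \<open>The recursion on the slices\<close>

text \<open>Reading v as an extra column d+1 of the skew matrix M makes the first condition on v uniform
  with the later ones on the columns of M: \<^term>\<open>col_reduced d (d - j)\<close> describes the slice L^(j).\<close>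
definition ext_col :: "nat \<Rightarrow> 'a::comm_ring_1 pt \<Rightarrow> nat \<Rightarrow> nat \<Rightarrow> 'a" where
  "ext_col d p l k = (if l = Suc d then fst p k else skew (snd p) k l)"

definition col_reduced :: "nat \<Rightarrow> nat \<Rightarrow> 'a::comm_ring_1 pt \<Rightarrow> bool" where
  "col_reduced d m p \<longleftrightarrow> (\<forall>l k. m + 2 \<le> l \<and> l \<le> Suc d \<and> 1 \<le> k \<and> Suc k < l \<longrightarrow> ext_col d p l k = 0)"

lemma col_reduced_mono: "col_reduced d m p \<Longrightarrow> m \<le> m' \<Longrightarrow> col_reduced d m' p"
  unfolding col_reduced_def by auto

text \<open>On the slice, w_i is this multiple of the upper part of the extended column d + 2 - i.
  From i = 2 on it is s_{i-1} n_{i-2}, with n the norms, times the one nonzero entry of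
  w_{i-1}.\<close>

fun lz_factor :: "nat \<Rightarrow> 'a::field_char_0 pt \<Rightarrow> nat \<Rightarrow> 'a" where
  "lz_factor d p 0 = 1"
| "lz_factor d p (Suc 0) = 1"
| "lz_factor d p (Suc (Suc i)) = lz_scale d p (Suc i) * lz_norm d p i * lz_vec d p (Suc i) (d - i)"

text \<open>On the slice each earlier vector is a multiple of one unit vector, so multiplying it by
  M picks out one column. The slice conditions annihilate that column below the subdiagonal, and the
  correction term of the recursion cancels the subdiagonal entry.\<close>

lemma lz_vec_reduced:
  fixes p :: "'a::field_char_0 pt"
  assumes "Suc i \<le> d" "col_reduced d (d - i) p"
  shows "\<forall>k\<in>{1..d}. lz_vec d p (Suc i) k =
    (if k \<le> d - i then lz_factor d p (Suc i) * ext_col d p (Suc (d - i)) k else 0)"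
  using assms
proof (induction i rule: less_induct)
  case (less i)
  define \<kappa> where "\<kappa> = (\<lambda>j. lz_vec d p (Suc j) (d - j))"
  have spike: "lz_vec d p (Suc j) k = (if k = d - j then \<kappa> j else 0)" if "j < i" "k \<in> {1..d}" for j k
  proof -
    have "col_reduced d (d - j) p" using less.prems that by (auto intro: col_reduced_mono)
    then have "lz_vec d p (Suc j) k = (if k \<le> d - j then lz_factor d p (Suc j) * ext_col d p (Suc (d - j)) k else 0)"
      using less.IH[of j] that less.prems by auto
    moreover have "ext_col d p (Suc (d - j)) k = 0" if "k < d - j"
      using less.prems that \<open>k \<in> {1..d}\<close> \<open>j < i\<close> unfolding col_reduced_def by auto
    ultimately show ?thesis by (auto simp: \<kappa>_def)
  qed
  have lam: "\<kappa> j = lz_factor d p (Suc j) * ext_col d p (Suc (d - j)) (d - j)" if "j < i" for j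
  proof -
    have "col_reduced d (d - j) p" using less.prems that by (auto intro: col_reduced_mono)
    then show ?thesis using less.IH[of j] that less.prems by (auto simp: \<kappa>_def)
  qed
  have nrm: "lz_norm d p (Suc j) = (\<kappa> j)\<^sup>2" if "j < i" for j
  proof -
    have "lz_norm d p (Suc j) = (\<Sum>k\<in>{1..d}. if k = d - j then (\<kappa> j)\<^sup>2 else 0)"
      unfolding lz_norm_def if_not_P[OF nat.discI[OF refl]]
      by (rule sum.cong[OF refl]) (simp add: spike[OF that])
    then show ?thesis using that less.prems by (simp add: sum.delta)
  qed
  show ?case
  proof (cases i)
    case 0
    then show ?thesis by (simp add: lz_vec_simps ext_col_def)
  next
    case (Suc j)
    define r where "r = d - j"
    have r: "r \<in> {1..d}" "d - i = r - 1" "Suc (d - i) = r" "1 < r" using Suc less.prems by (auto simp: r_def)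
    have col: "(\<Sum>l\<in>{1..d}. skew (snd p) k l * lz_vec d p (Suc j) l) = skew (snd p) k r * \<kappa> j" for k
    proof -
      have "(\<Sum>l\<in>{1..d}. skew (snd p) k l * lz_vec d p (Suc j) l) =
          (\<Sum>l\<in>{1..d}. if l = r then skew (snd p) k r * \<kappa> j else 0)"
        by (rule sum.cong[OF refl]) (use spike[of j] Suc in \<open>auto simp: r_def\<close>)
      then show ?thesis using r by (simp add: sum.delta)
    qed
    have red: "skew (snd p) k l = 0" if "r < l" "l \<le> d" "1 \<le> k" "Suc k < l" for k l
    proof -
      have "ext_col d p l k = 0" using less.prems(2) that r unfolding col_reduced_def by auto
      then show ?thesis using that by (simp add: ext_col_def)
    qed
    show ?thesis
    proof
      fix k assume k: "k \<in> {1..d}"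
      have v: "lz_vec d p (Suc i) k = lz_scale d p (Suc j) * lz_norm d p j * (skew (snd p) k r * \<kappa> j)
         + lz_norm d p (Suc j) * lz_scale d p j * lz_vec d p j k"
        unfolding Suc lz_vec_simps col ..
      have fac: "lz_factor d p (Suc i) = lz_scale d p (Suc j) * lz_norm d p j * \<kappa> j"
        by (simp add: Suc \<kappa>_def)
      have prev: "lz_vec d p j k = 0" if "k \<noteq> Suc r"
      proof (cases j)
        case 0 then show ?thesis by (simp add: lz_vec_simps)
      next
        case (Suc j')
        then have "k \<noteq> d - j'" using that r less.prems \<open>i = Suc j\<close> by (auto simp: r_def)
        then show ?thesis using spike[of j' k] k Suc \<open>i = Suc j\<close> by auto
      qed
      consider "k < r" | "k = r" | "k = Suc r" | "Suc r < k" by linarith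
      then show "lz_vec d p (Suc i) k = (if k \<le> d - i then lz_factor d p (Suc i) * ext_col d p (Suc (d - i)) k else 0)"
      proof cases
        case 1
        then have "k \<le> d - i" using r by auto
        then show ?thesis using v prev 1 r fac by (simp add: ext_col_def)
      next
        case 2
        then have "\<not> k \<le> d - i" using r by auto
        then show ?thesis using v prev 2 by (simp add: skew_def)
      next
        case 3
        then obtain j' where j': "j = Suc j'" using k by (cases j) (auto simp: r_def)
        then have dj: "d - j' = Suc r" using less.prems Suc by (auto simp: r_def)
        \<comment> \<open>This entry occurs twice: with a minus sign in column r of M, and as a
          factor of \<open>\<kappa> j\<close>, because w_{j+1} is a multiple of column r + 1. The
          two terms of the recursion therefore cancel.\<close>
        define c where "c = skew (snd p) r (Suc r)"
        have c1: "skew (snd p) k r = - c" unfolding c_def 3 by (rule skew_antisym)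
        have "\<kappa> j = lz_factor d p (Suc j) * ext_col d p (Suc r) r"
          using lam[of j] Suc by (simp add: r_def)
        then have lj: "\<kappa> j = lz_scale d p j * lz_norm d p j' * \<kappa> j' * c"
          using 3 k j' by (simp add: ext_col_def c_def \<kappa>_def)
        have n1: "lz_norm d p (Suc j) = (\<kappa> j)\<^sup>2" "lz_norm d p j = (\<kappa> j')\<^sup>2"
          using nrm[of j] nrm[of j'] Suc j' by auto
        have lv: "lz_vec d p j k = \<kappa> j'" using spike[of j' k] 3 k j' Suc dj by auto
        have ls: "lz_scale d p (Suc j) = (lz_scale d p j)\<^sup>2 * lz_norm d p j'"
          unfolding j' by (rule lz_scale_simps)
        have "lz_vec d p (Suc i) k = \<kappa> j * \<kappa> j' * (\<kappa> j * lz_scale d p j - lz_scale d p (Suc j) * \<kappa> j' * c)"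
          unfolding v c1 n1 lv by (simp add: algebra_simps power2_eq_square)
        also have "\<kappa> j * lz_scale d p j - lz_scale d p (Suc j) * \<kappa> j' * c = 0"
          unfolding ls by (subst lj) (simp add: algebra_simps power2_eq_square)
        finally show ?thesis using 3 r by auto
      next
        case 4
        have "skew (snd p) r k = 0" using 4 k r by (intro red) auto
        then have "skew (snd p) k r = 0" using skew_antisym[of "snd p" k r] by simp
        then show ?thesis using v prev 4 r by auto
      qed
    qed
  qed
qed

text \<open>As |r_i|^2 = n_i / s_i^2, these are numerator and denominator of |r_i|^2 / |r_{i-1}|^2.
  For i at least 1 the denominator is also the next scale s_{i+1}.\<close>

definition "lz_num d i p = lz_norm d p i * (lz_scale d p (i - 1))\<^sup>2"
definition "lz_den d i p = (lz_scale d p i)\<^sup>2 * lz_norm d p (i - 1)"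

text \<open>The same function as \<open>target\<close> for i in {1..d}; reading v as column d + 1
  removes the case split.\<close>

definition "col_norm d i p = (\<Sum>k\<in>{1..d + 1 - i}. (ext_col d p (d + 2 - i) k)\<^sup>2)"

text \<open>By \<open>lz_vec_reduced\<close>, w_i is \<open>lz_factor\<close> times a column, and
  the square of that factor times s_{i-1}^2 is exactly \<open>lz_den\<close>. The product form also
  covers points where the denominator vanishes.\<close>

lemma lz_num_reduced:
  fixes p :: "'a::field_char_0 pt"
  assumes i: "i \<in> {1..d}" and red: "col_reduced d (d + 1 - i) p"
  shows "lz_num d i p = col_norm d i p * lz_den d i p"
proof -
  obtain j where j: "i = Suc j" using i by (cases i) auto
  have red': "col_reduced d (d - j) p" using red j by simp
  have "lz_norm d p i = (\<Sum>k\<in>{1..d}. if k \<in> {1..d - j} then (lz_factor d p i * ext_col d p (Suc (d - j)) k)\<^sup>2 else 0)"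
    unfolding lz_norm_def j if_not_P[OF nat.discI[OF refl]]
    by (rule sum.cong[OF refl]) (use lz_vec_reduced[OF _ red'] i j in auto)
  also have "\<dots> = (\<Sum>k\<in>{1..d - j}. (lz_factor d p i * ext_col d p (Suc (d - j)) k)\<^sup>2)"
    by (subst sum.inter_restrict[symmetric]) (auto intro!: sum.cong)
  also have "\<dots> = (lz_factor d p i)\<^sup>2 * col_norm d i p"
    using i j by (simp add: col_norm_def power_mult_distrib sum_distrib_left Suc_diff_le)
  finally have n: "lz_norm d p i = (lz_factor d p i)\<^sup>2 * col_norm d i p" .
  show ?thesis
  proof (cases j)
    case 0
    then show ?thesis using n j by (simp add: lz_num_def lz_den_def lz_scale_simps lz_norm_def[of d p 0])
  next
    case (Suc j')
    have dj: "d - j' = Suc (d - j)" using Suc i j by auto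
    have "col_reduced d (d - j') p" using col_reduced_mono[OF red'] dj by simp
    then have v: "lz_vec d p j k = (if k \<le> d - j' then lz_factor d p (Suc j') * ext_col d p (Suc (d - j')) k else 0)"
      if "k \<in> {1..d}" for k
      using lz_vec_reduced[of j' d p] Suc i j that by auto
    have z: "lz_vec d p j k = 0" if "k \<in> {1..d}" "k \<noteq> d - j'" for k
    proof (cases "k \<le> d - j'")
      case True
      then have "ext_col d p (Suc (d - j')) k = 0" using red' dj that unfolding col_reduced_def by auto
      then show ?thesis using v[OF that(1)] by simp
    next
      case False then show ?thesis using v[OF that(1)] by simp
    qed
    have "lz_norm d p j = (\<Sum>k\<in>{1..d}. if k = d - j' then (lz_vec d p j (d - j'))\<^sup>2 else 0)"
      unfolding lz_norm_def Suc if_not_P[OF nat.discI[OF refl]]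
      by (rule sum.cong[OF refl]) (use z Suc in auto)
    also have "\<dots> = (lz_vec d p j (d - j'))\<^sup>2"
      using i j Suc by (simp add: sum.delta)
    finally have nj: "lz_norm d p j = (lz_vec d p j (d - j'))\<^sup>2" .
    have f: "lz_factor d p i = lz_scale d p j * lz_norm d p j' * lz_vec d p j (d - j')"
      by (simp add: j Suc)
    have s: "lz_scale d p i = (lz_scale d p j)\<^sup>2 * lz_norm d p j'"
      unfolding j Suc by (rule lz_scale_simps)
    have "i - 1 = j" using j by simp
    then show ?thesis unfolding lz_num_def lz_den_def n f s
      by (simp add: nj power_mult_distrib algebra_simps)
  qed
qed

section \<open>Reduction to the slice and rational invariants\<close>

text \<open>B is the reflection exchanging u, truncated to its first m coordinates, with r times the
  m-th unit vector, where r is the length of the truncation; x is the difference of the two.\<close>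

lemma householder:
  fixes u :: "nat \<Rightarrow> real"
  assumes m: "m \<in> {1..d}"
  obtains B where "orth d B"
    "\<And>k l. k \<in> {1..d} \<Longrightarrow> l \<in> {1..d} \<Longrightarrow> m < k \<or> m < l \<Longrightarrow> B k l = (if k = l then 1 else 0)"
    "\<And>k. k \<in> {1..<m} \<Longrightarrow> (\<Sum>l\<in>{1..m}. B k l * u l) = 0"
    "(\<Sum>l\<in>{1..m}. B m l * u l) \<ge> 0"
proof -
  define r where "r = sqrt (\<Sum>l\<in>{1..m}. (u l)\<^sup>2)"
  define x where "x = (\<lambda>l. if l \<le> m then u l - (if l = m then r else 0) else 0)"
  define q where "q = (\<Sum>l\<in>{1..m}. (x l)\<^sup>2)"
  \<comment> \<open>If q = 0 then u is already in position; division by zero yields c = 0, and B is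
    the identity.\<close>
  define c where "c = 2 / q"
  define B where "B = (\<lambda>k l. (if k = l then 1 else 0) - c * x k * x l)"
  have r: "r \<ge> 0" "r\<^sup>2 = (\<Sum>l\<in>{1..m}. (u l)\<^sup>2)" by (auto simp: r_def sum_nonneg)
  have xu: "(\<Sum>l\<in>{1..m}. x l * u l) = r\<^sup>2 - r * u m"
  proof -
    have "(\<Sum>l\<in>{1..m}. x l * u l) = (\<Sum>l\<in>{1..m}. (u l)\<^sup>2 - (if l = m then r * u m else 0))"
      by (rule sum.cong) (auto simp: x_def power2_eq_square algebra_simps)
    then show ?thesis using m r by (simp add: sum_subtractf)
  qed
  have q: "q = 2 * (r\<^sup>2 - r * u m)"
  proof -
    have "q = (\<Sum>l\<in>{1..m}. x l * u l - (if l = m then r * (u m - r) else 0))"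
      unfolding q_def by (rule sum.cong) (auto simp: x_def power2_eq_square algebra_simps)
    then show ?thesis using m xu by (simp add: sum_subtractf power2_eq_square algebra_simps)
  qed
  have qd: "(\<Sum>l\<in>{1..d}. x l * x l) = q"
    unfolding q_def power2_eq_square
    by (rule sum.mono_neutral_right) (use m in \<open>auto simp: x_def\<close>)
  have ccq: "c * c * q = 2 * c" by (simp add: c_def)
  have "orth d B" unfolding orth_def
  proof (intro ballI)
    fix i j assume ij: "i \<in> {1..d}" "j \<in> {1..d}"
    have "(\<Sum>k\<in>{1..d}. B i k * B j k) = (\<Sum>k\<in>{1..d}. (if k = i then (if i = j then 1 else 0) else 0)
        - (if k = i then c * x j * x i else 0) - (if k = j then c * x i * x j else 0) + c * c * x i * x j * (x k * x k))"
      by (rule sum.cong) (auto simp: B_def algebra_simps)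
    also have "\<dots> = (if i = j then 1 else 0) - c * x j * x i - c * x i * x j + c * c * x i * x j * q"
      using ij by (simp add: sum.distrib sum_subtractf sum_distrib_left[symmetric] qd)
    also have "c * c * x i * x j * q = x i * x j * (c * c * q)" by simp
    also have "\<dots> = 2 * c * x i * x j" unfolding ccq by simp
    finally show "(\<Sum>k\<in>{1..d}. B i k * B j k) = (if i = j then 1 else 0)" by simp
  qed
  moreover have "B k l = (if k = l then 1 else 0)" if "m < k \<or> m < l" for k l
    using that by (auto simp: B_def x_def)
  moreover have Bu: "(\<Sum>l\<in>{1..m}. B k l * u l) = (if k = m then r else 0)" if k: "k \<in> {1..m}" for k
  proof -
    have "(\<Sum>l\<in>{1..m}. B k l * u l) = (\<Sum>l\<in>{1..m}. (if l = k then u k else 0) - c * x k * (x l * u l))"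
      by (rule sum.cong) (auto simp: B_def algebra_simps)
    also have "\<dots> = u k - x k * (c * (r\<^sup>2 - r * u m))"
      using k by (simp add: sum_subtractf sum_distrib_left[symmetric] xu)
    also have "\<dots> = u k - x k"
    proof (cases "q = 0")
      case True
      then have "x k = 0" using k unfolding q_def by (subst (asm) sum_nonneg_eq_0_iff) auto
      then show ?thesis by simp
    next
      case False
      then have "c * (r\<^sup>2 - r * u m) = 1" using q by (simp add: c_def)
      then show ?thesis by simp
    qed
    finally show ?thesis using k by (auto simp: x_def)
  qed
  ultimately show ?thesis using that[of B] r(1) m by auto
qed

lemma orth_id: "orth d (\<lambda>i j. if i = j then 1 else 0)"
  unfolding orth_def
proof (intro ballI)
  fix i j assume "i \<in> {1..d}" "j \<in> {1..d}"
  then show "(\<Sum>k\<in>{1..d}. (if i = k then 1 else 0) * (if j = k then 1 else 0)) = (if i = j then 1 else (0::'a))"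
    by (auto simp: if_distrib[of "\<lambda>x. x * _"] cong: if_cong)
qed

text \<open>When row l of B is a unit row, the right factor B^T leaves column l of M alone; column d
  + 1 holds v and always transforms by B only.\<close>

lemma ext_col_act_fixed:
  fixes B :: "nat \<Rightarrow> nat \<Rightarrow> 'a::field_char_0"
  assumes "l \<le> Suc d" "1 \<le> l" "\<And>b. l \<le> d \<Longrightarrow> b \<in> {1..d} \<Longrightarrow> B l b = (if l = b then 1 else 0)"
  shows "ext_col d (act d B p) l k = (\<Sum>a\<in>{1..d}. B k a * ext_col d p l a)"
proof (cases "l = Suc d")
  case True
  then show ?thesis by (simp add: ext_col_def act_def)
next
  case False
  then have l: "l \<in> {1..d}" using assms by auto
  have "ext_col d (act d B p) l k = (\<Sum>a\<in>{1..d}. \<Sum>b\<in>{1..d}. B k a * skew (snd p) a b * B l b)"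
    using False by (simp add: ext_col_def skew_act)
  also have "\<dots> = (\<Sum>a\<in>{1..d}. \<Sum>b\<in>{1..d}. if b = l then B k a * skew (snd p) a l else 0)"
    by (intro sum.cong refl) (use assms(3) l in auto)
  also have "\<dots> = (\<Sum>a\<in>{1..d}. B k a * ext_col d p l a)"
    using l False by (simp add: ext_col_def)
  finally show ?thesis .
qed

text \<open>Columns are cleared from the right. The reflection in the first m coordinates treats
  column m + 1 and leaves the reduced columns to its right unchanged above the diagonal, since their
  only possibly nonzero entry there sits at an index beyond m.\<close>

lemma real_reduction:
  fixes p :: "real pt"
  assumes "j \<le> d"
  shows "\<exists>A. orth d A \<and> col_reduced d (d - j) (act d A p) \<and>
    (\<forall>l\<in>{d - j + 2..Suc d}. ext_col d (act d A p) l (l - 1) \<ge> 0)"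
  using assms
proof (induction j)
  case 0
  show ?case by (intro exI[of _ "\<lambda>i j. if i = j then 1 else 0"]) (auto simp: orth_id col_reduced_def)
next
  case (Suc j)
  define m where "m = d - j"
  have m: "m \<in> {1..d}" "d - Suc j = m - 1" using Suc.prems by (auto simp: m_def)
  obtain A where A: "orth d A" "col_reduced d m (act d A p)"
    "\<forall>l\<in>{m + 2..Suc d}. ext_col d (act d A p) l (l - 1) \<ge> 0"
    using Suc by (auto simp: m_def)
  define q where "q = act d A p"
  obtain B where B: "orth d B"
    "\<And>k l. k \<in> {1..d} \<Longrightarrow> l \<in> {1..d} \<Longrightarrow> m < k \<or> m < l \<Longrightarrow> B k l = (if k = l then 1 else 0)"
    "\<And>k. k \<in> {1..<m} \<Longrightarrow> (\<Sum>l\<in>{1..m}. B k l * ext_col d q (Suc m) l) = 0"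
    "(\<Sum>l\<in>{1..m}. B m l * ext_col d q (Suc m) l) \<ge> 0"
    using householder[OF m(1), of "ext_col d q (Suc m)"] by blast
  have col: "ext_col d (act d B q) l k = (\<Sum>a\<in>{1..d}. B k a * ext_col d q l a)" if "m < l" "l \<le> Suc d" for l k
    by (rule ext_col_act_fixed) (use that m B(2) in auto)
  have last: "ext_col d (act d B q) (Suc m) k = (\<Sum>a\<in>{1..m}. B k a * ext_col d q (Suc m) a)" if "k \<in> {1..m}" for k
  proof -
    have "ext_col d (act d B q) (Suc m) k = (\<Sum>a\<in>{1..d}. B k a * ext_col d q (Suc m) a)"
      using m by (intro col) auto
    also have "\<dots> = (\<Sum>a\<in>{1..m}. B k a * ext_col d q (Suc m) a)"
      by (rule sum.mono_neutral_right) (use m that B(2) in auto)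
    finally show ?thesis .
  qed
  have low: "ext_col d (act d B q) l k = (if Suc k = l then ext_col d q l k else 0)"
    if l: "m + 2 \<le> l" "l \<le> Suc d" and k: "1 \<le> k" "k < l" for l k
  proof -
    have kd: "k \<in> {1..d}" using l k by auto
    have "ext_col d (act d B q) l k = (\<Sum>a\<in>{1..d}. B k a * ext_col d q l a)" using col l by auto
    also have "\<dots> = (\<Sum>a\<in>{1..d}. if a = k then (if Suc k = l then ext_col d q l k else 0) else 0)"
    proof (rule sum.cong[OF refl])
      fix a assume a: "a \<in> {1..d}"
      have z: "ext_col d q l a = 0" if "Suc a < l"
        using A(2) a l that unfolding col_reduced_def q_def by auto
      show "B k a * ext_col d q l a = (if a = k then (if Suc k = l then ext_col d q l k else 0) else 0)"
      proof (cases "Suc a < l")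
        case True
        then show ?thesis using z by auto
      next
        case False
        then have "m < a" using l by auto
        then have "B k a = (if k = a then 1 else 0)" using B(2) kd a by auto
        then show ?thesis using False k by auto
      qed
    qed
    also have "\<dots> = (if Suc k = l then ext_col d q l k else 0)" using kd by simp
    finally show ?thesis .
  qed
  have "col_reduced d (m - 1) (act d B q)"
    unfolding col_reduced_def
  proof (intro allI impI; elim conjE)
    fix l k assume lk: "m - 1 + 2 \<le> l" "l \<le> Suc d" "1 \<le> k" "Suc k < l"
    show "ext_col d (act d B q) l k = 0"
    proof (cases "l = Suc m")
      case True
      then show ?thesis using last[of k] B(3)[of k] lk by auto
    next
      case False
      then show ?thesis using low[of l k] lk m by auto
    qed
  qed
  moreover have "ext_col d (act d B q) l (l - 1) \<ge> 0" if l: "l \<in> {m - 1 + 2..Suc d}" for l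
  proof (cases "l = Suc m")
    case True
    then show ?thesis using last[of m] B(4) m by auto
  next
    case False
    then have "m + 2 \<le> l" "l \<le> Suc d" using l m by auto
    then show ?thesis using low[of l "l - 1"] A(3) by (auto simp: q_def)
  qed
  ultimately show ?case
    using orth_matmul[OF B(1) A(1)] m(2) unfolding q_def act_matmul by (intro exI[of _ "matmul d B A"]) simp
qed

section \<open>Polynomial functions, lines and real points\<close>

lemma polyfun_sum:
  "finite I \<Longrightarrow> (\<And>i. i \<in> I \<Longrightarrow> f i \<in> polyfun d) \<Longrightarrow> (\<lambda>p. \<Sum>i\<in>I. f i p) \<in> polyfun d"
  by (induction I rule: finite_induct) (use polyfun.pconst[of 0 d] in \<open>auto intro!: polyfun.padd\<close>)

lemma polyfun_uminus: "P \<in> polyfun d \<Longrightarrow> (\<lambda>p. - P p) \<in> polyfun d"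
  using polyfun.pmult[OF polyfun.pconst[of "-1"], of P d] by simp

lemma polyfun_diff: "P \<in> polyfun d \<Longrightarrow> Q \<in> polyfun d \<Longrightarrow> (\<lambda>p. P p - Q p) \<in> polyfun d"
  using polyfun.padd[OF _ polyfun_uminus] by fastforce

lemma polyfun_power2: "P \<in> polyfun d \<Longrightarrow> (\<lambda>p. (P p)\<^sup>2) \<in> polyfun d"
  unfolding power2_eq_square by (rule polyfun.pmult)

lemma polyfun_skew:
  assumes "k \<in> {1..d}" "l \<in> {1..d}"
  shows "(\<lambda>p. skew (snd p) k l) \<in> polyfun d"
proof (cases k l rule: linorder_cases)
  case less
  then show ?thesis using polyfun.pvar2[of k l d] assms by (simp add: skew_def)
next
  case equal
  then show ?thesis using polyfun.pconst[of 0 d] by (simp add: skew_def)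
next
  case greater
  then show ?thesis using polyfun_uminus[OF polyfun.pvar2[of l k d]] assms by (simp add: skew_def)
qed

lemma polyfun_lanczos:
  "(\<forall>k\<in>{1..d}. (\<lambda>p. lz_vec d p i k) \<in> polyfun d) \<and> (\<lambda>p. lz_scale d p i) \<in> polyfun d
    \<and> (\<lambda>p. lz_norm d p i) \<in> polyfun d"
proof (induction i rule: induct_nat_012)
  case 0
  then show ?case using polyfun.pconst[of 0 d] polyfun.pconst[of 1 d]
    by (simp add: lz_vec_simps lz_scale_simps lz_norm_def)
next
  case 1
  then show ?case using polyfun.pconst[of 1 d]
    by (auto simp add: lz_vec_simps lz_scale_simps lz_norm_def intro!: polyfun_sum polyfun_power2 polyfun.pvar1)
next
  case (ge2 i)
  have v: "(\<lambda>p. lz_vec d p (Suc (Suc i)) k) \<in> polyfun d" if "k \<in> {1..d}" for k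
    unfolding lz_vec_simps using ge2 that
    by (intro polyfun.padd polyfun.pmult polyfun_sum polyfun_skew) auto
  have "(\<lambda>p. lz_norm d p (Suc (Suc i))) \<in> polyfun d"
    unfolding lz_norm_def if_not_P[OF nat.discI[OF refl]]
    by (intro polyfun_sum polyfun_power2 v) auto
  moreover have "(\<lambda>p. lz_scale d p (Suc (Suc i))) \<in> polyfun d"
    unfolding lz_scale_simps using ge2 by (intro polyfun.pmult polyfun_power2) auto
  ultimately show ?case using v by blast
qed

lemma polyfun_lz_num: "lz_num d i \<in> polyfun d" and polyfun_lz_den: "lz_den d i \<in> polyfun d"
  using polyfun_lanczos[of d i] polyfun_lanczos[of d "i - 1"]
  unfolding lz_num_def[abs_def] lz_den_def[abs_def]
  by (auto intro!: polyfun.pmult polyfun_power2)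

text \<open>Points are functions on all of nat, and matrix identities such as A^T A = I hold only
  inside the index range; polynomial functions cannot tell the difference.\<close>

lemma polyfun_cong:
  assumes "P \<in> polyfun d" "\<And>i. i \<in> {1..d} \<Longrightarrow> fst p i = fst q i"
    "\<And>i j. 1 \<le> i \<Longrightarrow> i < j \<Longrightarrow> j \<le> d \<Longrightarrow> snd p i j = snd q i j"
  shows "P p = P q"
  using assms(1) by induction (use assms(2,3) in auto)

definition pt_line :: "'a::comm_ring_1 pt \<Rightarrow> 'a pt \<Rightarrow> 'a \<Rightarrow> 'a pt" where
  "pt_line p q t = (\<lambda>i. fst p i + t * fst q i, \<lambda>i j. snd p i j + t * snd q i j)"

text \<open>Stands in for a theory of multivariate polynomials: vanishing and cancellation are
  decided on lines, by univariate \<open>poly\<close>.\<close>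

lemma polyfun_line:
  assumes "P \<in> polyfun d"
  shows "\<exists>R. \<forall>t. P (pt_line p q t) = poly R t"
  using assms
proof induction
  case (pconst r)
  show ?case by (intro exI[of _ "[:complex_of_real r:]"]) simp
next
  case (pvar1 i)
  show ?case by (intro exI[of _ "[:fst p i, fst q i:]"]) (simp add: pt_line_def)
next
  case (pvar2 i j)
  show ?case by (intro exI[of _ "[:snd p i j, snd q i j:]"]) (simp add: pt_line_def)
next
  case (padd P Q)
  then show ?case by (metis poly_add)
next
  case (pmult P Q)
  then show ?case by (metis poly_mult)
qed

lemma cplx_pt_line: "cplx_pt (pt_line p q t) = pt_line (cplx_pt p) (cplx_pt q) (of_real t)"
  by (simp add: cplx_pt_def pt_line_def)

lemma skew_pt_line: "skew (snd (pt_line p q t)) k l = skew (snd p) k l + t * skew (snd q) k l"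
  by (simp add: skew_def pt_line_def algebra_simps)

lemma act_pt_line:
  "act d A (pt_line p q t) = pt_line (act d A p) (act d A q) t"
proof (rule prod_eqI)
  show "fst (act d A (pt_line p q t)) = fst (pt_line (act d A p) (act d A q) t)"
    by (simp add: act_def pt_line_def fun_eq_iff algebra_simps sum.distrib sum_distrib_left)
  show "snd (act d A (pt_line p q t)) = snd (pt_line (act d A p) (act d A q) t)"
    by (simp add: act_def skew_pt_line fun_eq_iff)
       (simp add: pt_line_def algebra_simps sum.distrib sum_distrib_left)
qed

lemma ext_col_pt_line: "ext_col d (pt_line p q t) l k = ext_col d p l k + t * ext_col d q l k"
  by (simp add: ext_col_def skew_pt_line) (simp add: pt_line_def)

lemma col_reduced_pt_line:
  "col_reduced d m p \<Longrightarrow> col_reduced d m q \<Longrightarrow> col_reduced d m (pt_line p q t)"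
  by (simp add: col_reduced_def ext_col_pt_line)

lemma ext_col_cplx: "ext_col d (cplx_pt p) l k = of_real (ext_col d p l k)"
  by (simp add: ext_col_def cplx_pt_def skew_def)

lemma col_reduced_cplx: "col_reduced d m (cplx_pt p) \<longleftrightarrow> col_reduced d m p"
  by (simp add: col_reduced_def ext_col_cplx)

lemma act_cplx: "act d (\<lambda>i j. of_real (A i j)) (cplx_pt p) = cplx_pt (act d A p)"
proof -
  have "skew (snd (cplx_pt p)) k l = of_real (skew (snd p) k l)" for k l
    by (simp add: skew_def cplx_pt_def)
  then show ?thesis by (simp add: act_def fun_eq_iff) (simp add: cplx_pt_def)
qed

lemma orth_cplx: "orth d A \<Longrightarrow> orth d (\<lambda>i j. complex_of_real (A i j))"
  unfolding orth_def of_real_mult[symmetric] of_real_sum[symmetric] by (auto split: if_splits)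

lemma poly_zero_on_reals:
  fixes R :: "complex poly"
  assumes "\<And>t::real. poly R (of_real t) = 0"
  shows "R = 0"
proof (rule ccontr)
  assume "R \<noteq> 0"
  then have "finite {x. poly R x = 0}" by (rule poly_roots_finite)
  moreover have "range complex_of_real \<subseteq> {x. poly R x = 0}" using assms by auto
  ultimately have "finite (range complex_of_real)" by (rule finite_subset[rotated])
  then have "finite (UNIV :: real set)" by (rule finite_imageD) (simp add: inj_on_def)
  then show False using infinite_UNIV_char_0 by blast
qed

text \<open>Weak enough to hold for P composed with a linear action without exhibiting the
  composition as a member of \<open>polyfun\<close>, strong enough for cancellation.\<close>

definition line_poly :: "(real pt \<Rightarrow> complex) \<Rightarrow> bool" where
  "line_poly f \<longleftrightarrow> (\<forall>p q. \<exists>R. \<forall>t. f (pt_line p q t) = poly R (of_real t))"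

lemma line_poly_mult: "line_poly f \<Longrightarrow> line_poly g \<Longrightarrow> line_poly (\<lambda>p. f p * g p)"
  unfolding line_poly_def by (metis poly_mult)

lemma line_poly_diff: "line_poly f \<Longrightarrow> line_poly g \<Longrightarrow> line_poly (\<lambda>p. f p - g p)"
  unfolding line_poly_def by (metis poly_diff)

lemma line_poly_act: "P \<in> polyfun d \<Longrightarrow> line_poly (\<lambda>p. P (cplx_pt (act n A p)))"
  unfolding line_poly_def act_pt_line cplx_pt_line using polyfun_line by blast

lemma line_poly_cplx: "P \<in> polyfun d \<Longrightarrow> line_poly (\<lambda>p. P (cplx_pt p))"
  unfolding line_poly_def cplx_pt_line using polyfun_line by blast

text \<open>On the line from p to q, which stays in X, the product of two univariate polynomials
  vanishes at all reals while the second is nonzero at q; hence the first is the zero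
  polynomial.\<close>

lemma line_poly_domain:
  assumes f: "line_poly f" and g: "line_poly g"
    and X: "\<And>p q t. p \<in> X \<Longrightarrow> q \<in> X \<Longrightarrow> pt_line p q t \<in> X"
    and zero: "\<And>p. p \<in> X \<Longrightarrow> f p * g p = 0"
    and q: "q \<in> X" "g q \<noteq> 0" and p: "p \<in> X"
  shows "f p = 0"
proof -
  \<comment> \<open>The direction q - p, written as a combination to which closure of X
    applies.\<close>
  define v where "v = pt_line q p (-1)"
  have v: "v \<in> X" "pt_line p v 0 = p" "pt_line p v 1 = q"
    unfolding v_def using X[OF q(1) p, of "-1"] by (simp_all add: pt_line_def)
  obtain R where R: "\<And>t. f (pt_line p v t) = poly R (of_real t)" using f unfolding line_poly_def by metis
  obtain S where S: "\<And>t. g (pt_line p v t) = poly S (of_real t)" using g unfolding line_poly_def by metis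
  have "poly (R * S) (of_real t) = 0" for t
    using zero[OF X[OF p v(1), of t]] R[of t] S[of t] by simp
  then have "R * S = 0" by (rule poly_zero_on_reals)
  moreover have "S \<noteq> 0" using S[of 1] v q by auto
  ultimately have "R = 0" by simp
  then show ?thesis using R[of 0] v by simp
qed

text \<open>With q = a + i b for real a and b, the polynomial along a + t b vanishes for all real t,
  hence also at t = i. Both a and b stay in the slice because its equations are real and
  linear.\<close>

lemma polyfun_zero_real_imp_complex:
  assumes P: "P \<in> polyfun d" and zero: "\<And>p. col_reduced d m p \<Longrightarrow> P (cplx_pt p) = 0"
    and q: "col_reduced d m q"
  shows "P q = 0"
proof -
  define a :: "real pt" where "a = (\<lambda>i. Re (fst q i), \<lambda>i j. Re (snd q i j))"
  define b :: "real pt" where "b = (\<lambda>i. Im (fst q i), \<lambda>i j. Im (snd q i j))"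
  have ab: "ext_col d a l k = Re (ext_col d q l k)" "ext_col d b l k = Im (ext_col d q l k)" for l k
    by (auto simp: ext_col_def a_def b_def skew_def)
  have red: "col_reduced d m a" "col_reduced d m b" using q by (auto simp: col_reduced_def ab)
  have qq: "pt_line (cplx_pt a) (cplx_pt b) \<i> = q"
    by (rule prod_eqI; simp add: pt_line_def cplx_pt_def a_def b_def fun_eq_iff complex_eq_iff)
  obtain R where R: "\<And>t. P (pt_line (cplx_pt a) (cplx_pt b) t) = poly R t" using polyfun_line[OF P] by metis
  have "poly R (of_real t) = 0" for t
    using zero[OF col_reduced_pt_line[OF red, of t]] R[of "of_real t"] by (simp add: cplx_pt_line)
  then have "R = 0" by (rule poly_zero_on_reals)
  then show ?thesis using R[of \<i>] qq by simp
qed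

lemma col_reduced_top: "col_reduced d d p"
  by (auto simp: col_reduced_def)

lemma polyfun_domain:
  assumes P: "P \<in> polyfun d" and Q: "Q \<in> polyfun d" and zero: "\<And>p. P p * Q p = 0" and q: "Q q \<noteq> 0"
  shows "P p = 0"
proof -
  obtain q' where q': "Q (cplx_pt q') \<noteq> 0"
    using polyfun_zero_real_imp_complex[OF Q _ col_reduced_top] q by blast
  have "P (cplx_pt x) = 0" for x
    by (rule line_poly_domain[OF line_poly_cplx[OF P] line_poly_cplx[OF Q], of UNIV q'])
       (use zero q' in auto)
  then show ?thesis using polyfun_zero_real_imp_complex[OF P _ col_reduced_top] by blast
qed

section \<open>Slices, prescribed restrictions and nonvanishing\<close>

lemma Lset_col_reduced:
  assumes "j \<le> d"
  shows "p \<in> Lset d j \<longleftrightarrow> col_reduced d (d - j) p"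
  using assms
proof (induction j rule: induct_nat_012)
  case 0
  then show ?case by (simp add: col_reduced_top)
next
  case 1
  have "(\<forall>i\<in>{1..d-1}. fst p i = 0) \<longleftrightarrow> col_reduced d (d - 1) p" using 1
    by (fastforce simp: col_reduced_def ext_col_def)
  then show ?case by (simp add: One_nat_def)
next
  case (ge2 n)
  define m where "m = d - (n + 2)"
  have m: "d - Suc n = Suc m" "m + 2 \<le> d" "d - Suc (Suc n) = m" using ge2.prems by (auto simp: m_def)
  have "p \<in> Lset d (Suc (Suc n)) \<longleftrightarrow> col_reduced d (Suc m) p \<and> (\<forall>k\<in>{1..m}. snd p k (m + 2) = 0)"
    unfolding Lset.simps(3) m_def[symmetric] using ge2.IH(2) ge2.prems by (simp add: m(1))
  also have "\<dots> \<longleftrightarrow> col_reduced d m p"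
  proof
    assume L: "col_reduced d (Suc m) p \<and> (\<forall>k\<in>{1..m}. snd p k (m + 2) = 0)"
    show "col_reduced d m p" unfolding col_reduced_def
    proof (intro allI impI; elim conjE)
      fix l k assume lk: "m + 2 \<le> l" "l \<le> Suc d" "1 \<le> k" "Suc k < l"
      show "ext_col d p l k = 0"
      proof (cases "l = m + 2")
        case True
        then show ?thesis using L lk m by (auto simp: ext_col_def skew_def)
      next
        case False
        then show ?thesis using L lk unfolding col_reduced_def by auto
      qed
    qed
  next
    assume R: "col_reduced d m p"
    have "snd p k (m + 2) = 0" if "k \<in> {1..m}" for k
    proof -
      have "ext_col d p (m + 2) k = 0" using R that m unfolding col_reduced_def by auto
      then show ?thesis using that m by (simp add: ext_col_def skew_def)
    qed
    then show "col_reduced d (Suc m) p \<and> (\<forall>k\<in>{1..m}. snd p k (m + 2) = 0)"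
      using col_reduced_mono[OF R] by auto
  qed
  finally show ?case using m by simp
qed

lemma target_col_norm:
  assumes "i \<in> {1..d}"
  shows "target d i p = col_norm d i p"
proof (cases "i = 1")
  case True
  then show ?thesis by (simp add: target_def col_norm_def ext_col_def)
next
  case False
  have 1: "d + 1 - i = d - i + 1" "d + 2 - i = d - i + 2" using assms by auto
  show ?thesis unfolding target_def col_norm_def 1 using False assms
    by (auto intro!: sum.cong simp: ext_col_def skew_def)
qed

lemma lz_scale_Suc: "lz_scale d p (Suc i) = lz_den d i p" if "i \<ge> 1"
  using that lz_scale_simps(3)[of d p "i - 1"] by (cases i) (auto simp: lz_den_def)

text \<open>\<open>lz_den\<close> at index i + 1 is s_{i+1}^2 n_i, nonzero by induction; the premise
  then gives n_{i+1} nonzero, and that same denominator is the scale s_{i+2}.\<close>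

lemma lz_nonzero:
  assumes "\<And>i. i \<in> {1..d} \<Longrightarrow> lz_den d i p \<noteq> 0 \<Longrightarrow> lz_num d i p \<noteq> 0"
    and "i \<le> d"
  shows "lz_norm d p i \<noteq> 0 \<and> lz_scale d p i \<noteq> 0 \<and> lz_scale d p (Suc i) \<noteq> 0"
  using assms(2)
proof (induction i)
  case 0
  then show ?case by (simp add: lz_norm_def lz_scale_simps)
next
  case (Suc i)
  then have den: "lz_den d (Suc i) p \<noteq> 0" by (simp add: lz_den_def)
  then have "lz_num d (Suc i) p \<noteq> 0" using assms(1) Suc.prems by simp
  then show ?case using den Suc lz_scale_Suc[of "Suc i" d p] by (auto simp: lz_num_def)
qed

lemma col_norm_reduced:
  assumes "i \<in> {1..d}" "col_reduced d (d - i) p"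
  shows "col_norm d i p = (ext_col d p (d + 2 - i) (d + 1 - i))\<^sup>2"
proof -
  have "col_norm d i p = (\<Sum>k\<in>{1..d + 1 - i}. if k = d + 1 - i then (ext_col d p (d + 2 - i) (d + 1 - i))\<^sup>2 else 0)"
    unfolding col_norm_def
  proof (rule sum.cong[OF refl])
    fix k assume k: "k \<in> {1..d + 1 - i}"
    show "(ext_col d p (d + 2 - i) k)\<^sup>2 = (if k = d + 1 - i then (ext_col d p (d + 2 - i) (d + 1 - i))\<^sup>2 else 0)"
    proof (cases "k = d + 1 - i")
      case False
      then have "d - i + 2 \<le> d + 2 - i" "d + 2 - i \<le> Suc d" "1 \<le> k" "Suc k < d + 2 - i"
        using assms(1) k by auto
      then have "ext_col d p (d + 2 - i) k = 0" using assms(2) unfolding col_reduced_def by blast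
      then show ?thesis using False by simp
    qed simp
  qed
  moreover have "1 \<le> d + 1 - i" using assms(1) by auto
  ultimately show ?thesis by simp
qed

lemma lz_invariant:
  fixes A :: "nat \<Rightarrow> nat \<Rightarrow> 'a::field_char_0"
  assumes "orth d A"
  shows "lz_num d i (act d A p) = lz_num d i p" "lz_den d i (act d A p) = lz_den d i p"
  using lz_act[OF assms, of p] by (simp_all add: lz_num_def lz_den_def)

text \<open>At v = e_d, with ones next to the diagonal of M, all column norms equal 1. The point
  lies in every slice, so \<open>lz_den\<close> is neither the zero polynomial nor identically zero
  on a slice.\<close>

lemma lz_den_nonzero_reduced:
  assumes "i \<in> {1..d}"
  obtains p :: "complex pt" where "col_reduced d 0 p" "lz_den d i p \<noteq> 0"
proof -
  define p :: "complex pt" where "p = (\<lambda>i. if i = d then 1 else 0, \<lambda>k l. if l = Suc k then 1 else 0)"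
  have red: "col_reduced d 0 p" by (auto simp: col_reduced_def ext_col_def skew_def p_def)
  have one: "ext_col d p (Suc k) k = 1" if "k \<in> {1..d}" for k
    using that by (auto simp: ext_col_def skew_def p_def)
  have nz: "lz_num d j p \<noteq> 0" if j: "j \<in> {1..d}" and "lz_den d j p \<noteq> 0" for j
  proof -
    have "d + 2 - j = Suc (d + 1 - j)" "d + 1 - j \<in> {1..d}" using j by auto
    then have "col_norm d j p = 1"
      using col_norm_reduced[OF j col_reduced_mono[OF red]] one[of "d + 1 - j"] by simp
    moreover have "lz_num d j p = col_norm d j p * lz_den d j p"
      by (rule lz_num_reduced[OF j col_reduced_mono[OF red]]) simp
    ultimately show ?thesis using that by simp
  qed
  have "i \<le> d" "i - 1 \<le> d" using assms by auto
  from lz_nonzero[OF nz this(1)] lz_nonzero[OF nz this(2)]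
  have "lz_scale d p i \<noteq> 0 \<and> lz_norm d p (i - 1) \<noteq> 0" by simp
  then show ?thesis using that[OF red] by (simp add: lz_den_def)
qed

section \<open>Classes of fractions and uniqueness of the invariants\<close>

text \<open>Cross-multiplication of fractions is transitive only after cancelling the middle
  denominator, which needs that polynomial functions have no zero divisors.\<close>

lemma ratclass_eq:
  assumes "(P, Q) \<in> frac d" "(P', Q') \<in> ratclass d P Q"
  shows "ratclass d P' Q' = ratclass d P Q"
proof -
  have P: "P \<in> polyfun d" "Q \<in> polyfun d" "\<exists>q. Q q \<noteq> 0" using assms(1) by (auto simp: frac_def)
  have P': "P' \<in> polyfun d" "Q' \<in> polyfun d" "\<exists>q. Q' q \<noteq> 0" "\<And>p. P p * Q' p = P' p * Q p"
    using assms(2) by (auto simp: frac_def ratclass_def)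
  have trans: "(\<forall>p. A p * E p = C p * B p)"
    if *: "A \<in> polyfun d" "B \<in> polyfun d" "C \<in> polyfun d" "E \<in> polyfun d" "F \<in> polyfun d" "G \<in> polyfun d"
      "\<exists>q. G q \<noteq> 0" "\<forall>p. F p * B p = A p * G p" "\<forall>p. F p * E p = C p * G p" for A B C E F G
  proof
    fix p
    obtain q where q: "G q \<noteq> 0" using *(7) by blast
    have z: "(A p * E p - C p * B p) * G p = 0" for p
    proof -
      have "A p * E p * G p = (F p * B p) * E p" using *(8)[rule_format, of p] by (simp add: mult_ac)
      also have "\<dots> = C p * B p * G p" using *(9)[rule_format, of p] by (simp add: mult_ac)
      finally show ?thesis by (simp add: algebra_simps)
    qed
    have "A p * E p - C p * B p = 0"
      by (rule polyfun_domain[where P="\<lambda>p. A p * E p - C p * B p", OF _ *(6) z q])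
         (intro polyfun_diff polyfun.pmult *)
    then show "A p * E p = C p * B p" by simp
  qed
  have "(\<forall>p. P' p * E p = C p * Q' p) \<longleftrightarrow> (\<forall>p. P p * E p = C p * Q p)"
    if "C \<in> polyfun d" "E \<in> polyfun d" for C E
  proof
    assume "\<forall>p. P' p * E p = C p * Q' p"
    then show "\<forall>p. P p * E p = C p * Q p"
      using trans[of P Q C E P' Q'] P P' that by metis
  next
    assume "\<forall>p. P p * E p = C p * Q p"
    then show "\<forall>p. P' p * E p = C p * Q' p"
      using trans[of P' Q' C E P Q] P P' that by metis
  qed
  then show ?thesis unfolding ratclass_def frac_def by blast
qed

lemma act_identity:
  assumes I: "\<And>i j. i \<in> {1..d} \<Longrightarrow> j \<in> {1..d} \<Longrightarrow> I i j = (if i = j then 1 else 0)"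
  shows "i \<in> {1..d} \<Longrightarrow> fst (act d I p) i = fst p i"
    and "1 \<le> i \<Longrightarrow> i < j \<Longrightarrow> j \<le> d \<Longrightarrow> snd (act d I p) i j = snd p i j"
proof -
  assume i: "i \<in> {1..d}"
  have "fst (act d I p) i = (\<Sum>k\<in>{1..d}. if k = i then fst p i else 0)"
    unfolding act_def fst_conv by (rule sum.cong[OF refl]) (use I[OF i] in auto)
  then show "fst (act d I p) i = fst p i" using i by simp
next
  assume ij: "1 \<le> i" "i < j" "j \<le> d"
  have "snd (act d I p) i j =
      (\<Sum>k\<in>{1..d}. \<Sum>l\<in>{1..d}. if l = j then (if k = i then skew (snd p) i j else 0) else 0)"
    unfolding act_def snd_conv by (intro sum.cong refl) (use I ij in auto)
  then show "snd (act d I p) i j = snd p i j" using ij by (simp add: skew_def)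
qed

text \<open>In fractions: a/b = a'/b' at the moved point, u/v' = u'/v at the original one, and
  invariance a/b = u/v' of the first representative gives that of the second. The denominators b and
  v' stay as factors, to be cancelled as polynomials afterwards.\<close>

lemma fraction_cross:
  fixes a a' b b' u u' v v' :: "'a::comm_ring"
  assumes "a * v' = u * b" "a * b' = a' * b" "u * v = u' * v'"
  shows "(a' * v - u' * b') * b * v' = 0"
proof -
  have "a' * v * b * v' = (a' * b) * v * v'" by (simp add: mult_ac)
  also have "\<dots> = (a * v') * b' * v" unfolding assms(2)[symmetric] by (simp add: mult_ac)
  also have "\<dots> = (u * v) * b * b'" unfolding assms(1) by (simp add: mult_ac)
  also have "\<dots> = u' * b' * b * v'" unfolding assms(3) by (simp add: mult_ac)
  finally show ?thesis by (simp add: left_diff_distrib)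
qed

text \<open>Uniqueness of the invariant extension: by invariance it is determined on all real points
  of the form A q with A real orthogonal and q in the slice, and by Householder reduction these
  are all real points.\<close>
lemma invariant_extension_unique:
  assumes i: "i \<in> {1..d}" and frac: "(P0, Q0) \<in> frac d"
    and inv: "\<And>A p. orth d A \<Longrightarrow> P0 (act d A p) * Q0 p = P0 p * Q0 (act d A p)"
    and rep: "(P, Q) \<in> ratclass d P0 Q0" and q0: "q0 \<in> Lset d (i - 1)" "Q q0 \<noteq> 0"
    and slice: "\<And>p. p \<in> Lset d (i - 1) \<Longrightarrow> P p = target d i p * Q p"
  shows "ratclass d P0 Q0 = ratclass d (lz_num d i) (lz_den d i)"
proof -
  define m where "m = d + 1 - i"
  have mi: "d - (i - 1) = m" "i - 1 \<le> d" using i by (auto simp: m_def)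
  have P0: "P0 \<in> polyfun d" "Q0 \<in> polyfun d" "\<exists>q. Q0 q \<noteq> 0" using frac by (auto simp: frac_def)
  have P: "P \<in> polyfun d" "Q \<in> polyfun d" "\<And>p. P0 p * Q p = P p * Q0 p"
    using rep by (auto simp: frac_def ratclass_def)
  obtain r0 where r0: "Q0 (cplx_pt r0) \<noteq> 0"
    using polyfun_zero_real_imp_complex[OF P0(2) _ col_reduced_top] P0(3) by blast
  have "col_reduced d m q0" using q0 Lset_col_reduced mi by metis
  then obtain q1 where q1: "col_reduced d m q1" "Q (cplx_pt q1) \<noteq> 0"
    using polyfun_zero_real_imp_complex[OF P(2), of m q0] q0 by blast
  \<comment> \<open>Invariance is given for the pair P0, Q0 and the slice condition for the pair P,
    Q; it is transferred by cancelling Q0 at both points.\<close>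
  have inv_real: "P (cplx_pt (act d A p)) * Q (cplx_pt p) = P (cplx_pt p) * Q (cplx_pt (act d A p))"
    if A: "orth d A" for A :: "nat \<Rightarrow> nat \<Rightarrow> real" and p
  proof -
    let ?f = "\<lambda>p. P (cplx_pt (act d A p)) * Q (cplx_pt p) - P (cplx_pt p) * Q (cplx_pt (act d A p))"
    let ?g = "\<lambda>p. Q0 (cplx_pt (act d A p))" and ?h = "\<lambda>p. Q0 (cplx_pt p)"
    have z: "?f p * ?g p * ?h p = 0" for p
    proof -
      have "P0 (cplx_pt (act d A p)) * Q0 (cplx_pt p) = P0 (cplx_pt p) * Q0 (cplx_pt (act d A p))"
        using inv[OF orth_cplx[OF A], of "cplx_pt p"] by (simp add: act_cplx)
      moreover have "P0 (cplx_pt (act d A p)) * Q (cplx_pt (act d A p)) = P (cplx_pt (act d A p)) * Q0 (cplx_pt (act d A p))"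
        "P0 (cplx_pt p) * Q (cplx_pt p) = P (cplx_pt p) * Q0 (cplx_pt p)" using P(3) by auto
      ultimately show ?thesis by (rule fraction_cross)
    qed
    have lf: "line_poly ?f"
      by (intro line_poly_diff line_poly_mult line_poly_act[where d=d] line_poly_cplx[where d=d] P)
    have lg: "line_poly ?g" by (rule line_poly_act[OF P0(2)])
    have lh: "line_poly ?h" by (rule line_poly_cplx[OF P0(2)])
    have fg: "?f p * ?g p = 0" for p
      by (rule line_poly_domain[OF line_poly_mult[OF lf lg] lh, of UNIV r0]) (use z r0 in auto)
    \<comment> \<open>A moves the image of r0 under the transpose back to r0, where Q0 is
      nonzero.\<close>
    have "?g (act d (\<lambda>i j. A j i) r0) \<noteq> 0"
    proof -
      have "?g (act d (\<lambda>i j. A j i) r0) = Q0 (cplx_pt r0)"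
      proof (rule polyfun_cong[OF P0(2)])
        let ?I = "matmul d A (\<lambda>i j. A j i)"
        have I: "?I i j = (if i = j then 1 else 0)" if "i \<in> {1..d}" "j \<in> {1..d}" for i j
          using A that by (simp add: matmul_def orth_def)
        show "fst (cplx_pt (act d A (act d (\<lambda>i j. A j i) r0))) i = fst (cplx_pt r0) i" if "i \<in> {1..d}" for i
          using act_identity(1)[of d ?I, OF I that, of r0] by (simp only: act_matmul cplx_pt_def fst_conv)
        show "snd (cplx_pt (act d A (act d (\<lambda>i j. A j i) r0))) i j = snd (cplx_pt r0) i j"
          if "1 \<le> i" "i < j" "j \<le> d" for i j
          using act_identity(2)[of d ?I, OF I that, of r0] by (simp only: act_matmul cplx_pt_def snd_conv)
      qed
      then show ?thesis using r0 by simp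
    qed
    then have "?f p = 0"
      by (intro line_poly_domain[OF lf lg, of UNIV "act d (\<lambda>i j. A j i) r0"]) (use fg in auto)
    then show ?thesis by simp
  qed
  define F where "F = (\<lambda>p. P p * lz_den d i p - lz_num d i p * Q p)"
  have Fpoly: "F \<in> polyfun d" unfolding F_def
    by (intro polyfun_diff polyfun.pmult P polyfun_lz_num polyfun_lz_den)
  have Fslice: "F (cplx_pt q) = 0" if q: "col_reduced d m q" for q
  proof -
    have "cplx_pt q \<in> Lset d (i - 1)" using q Lset_col_reduced[OF mi(2)] mi(1) by (simp add: col_reduced_cplx)
    then have "P (cplx_pt q) = target d i (cplx_pt q) * Q (cplx_pt q)" by (rule slice)
    moreover have "lz_num d i (cplx_pt q) = target d i (cplx_pt q) * lz_den d i (cplx_pt q)"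
      using lz_num_reduced[OF i, of "cplx_pt q"] q by (simp add: m_def col_reduced_cplx target_col_norm[OF i])
    ultimately show ?thesis by (simp add: F_def)
  qed
  \<comment> \<open>Q may vanish at individual slice points, so the identity is proved after
    multiplication by Q, which is then cancelled along lines inside the slice with q1 as
    witness.\<close>
  have Forbit: "F (cplx_pt (act d A q)) = 0" if A: "orth d A" and q: "col_reduced d m q" for A q
  proof (rule line_poly_domain[of "\<lambda>q. F (cplx_pt (act d A q))" "\<lambda>q. Q (cplx_pt q)" "{q. col_reduced d m q}" q1])
    show "line_poly (\<lambda>q. F (cplx_pt (act d A q)))" by (rule line_poly_act[OF Fpoly])
    show "line_poly (\<lambda>q. Q (cplx_pt q))" by (rule line_poly_cplx[OF P(2)])
    fix p :: "real pt" assume "p \<in> {q. col_reduced d m q}"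
    then have Fp: "F (cplx_pt p) = 0" using Fslice by simp
    have "lz_num d i (cplx_pt (act d A p)) = lz_num d i (cplx_pt p)"
      "lz_den d i (cplx_pt (act d A p)) = lz_den d i (cplx_pt p)"
      using lz_invariant[OF orth_cplx[OF A], of i "cplx_pt p"] by (auto simp: act_cplx)
    then have "F (cplx_pt (act d A p)) * Q (cplx_pt p) = F (cplx_pt p) * Q (cplx_pt (act d A p))"
      using inv_real[OF A, of p] by (simp add: F_def left_diff_distrib mult.assoc mult.left_commute)
    then show "F (cplx_pt (act d A p)) * Q (cplx_pt p) = 0" using Fp by simp
  qed (use q q1 col_reduced_pt_line in auto)
  have Freal: "F (cplx_pt p) = 0" for p
  proof -
    obtain A where A: "orth d A" "col_reduced d m (act d A p)"
      using real_reduction[OF mi(2), of p] mi(1) by auto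
    let ?T = "\<lambda>i j. A j i"
    have I: "matmul d ?T A i j = (if i = j then 1 else 0)" if "i \<in> {1..d}" "j \<in> {1..d}" for i j
      using orth_colD[OF A(1) that] by (simp add: matmul_def)
    have "F (cplx_pt (act d ?T (act d A p))) = F (cplx_pt p)"
    proof (rule polyfun_cong[OF Fpoly])
      show "fst (cplx_pt (act d ?T (act d A p))) i = fst (cplx_pt p) i" if "i \<in> {1..d}" for i
        using act_identity(1)[of d "matmul d ?T A", OF I that, of p] by (simp only: act_matmul cplx_pt_def fst_conv)
      show "snd (cplx_pt (act d ?T (act d A p))) i j = snd (cplx_pt p) i j"
        if "1 \<le> i" "i < j" "j \<le> d" for i j
        using act_identity(2)[of d "matmul d ?T A", OF I that, of p] by (simp only: act_matmul cplx_pt_def snd_conv)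
    qed
    then show ?thesis using Forbit[OF orth_transpose[OF A(1)] A(2)] by simp
  qed
  have Fzero: "F p = 0" for p
    using polyfun_zero_real_imp_complex[OF Fpoly Freal col_reduced_top] .
  have PQ: "(P, Q) \<in> frac d" using P(1,2) q0(2) unfolding frac_def by blast
  obtain pd :: "complex pt" where "lz_den d i pd \<noteq> 0" using lz_den_nonzero_reduced[OF i] by metis
  then have "(lz_num d i, lz_den d i) \<in> frac d"
    unfolding frac_def using polyfun_lz_num polyfun_lz_den by blast
  then have "(lz_num d i, lz_den d i) \<in> ratclass d P Q"
    using Fzero by (simp add: ratclass_def F_def)
  then have "ratclass d (lz_num d i) (lz_den d i) = ratclass d P Q" by (rule ratclass_eq[OF PQ])
  also have "\<dots> = ratclass d P0 Q0" by (rule ratclass_eq[OF frac rep])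
  finally show ?thesis ..
qed

text \<open>This evaluates the definite description: the explicit pair has the required properties,
  and \<open>invariant_extension_unique\<close> forces every other candidate class to coincide with
  it.\<close>

lemma fclass_eq:
  assumes i: "i \<in> {1..d}"
  shows "fclass d i = ratclass d (lz_num d i) (lz_den d i)"
  unfolding fclass_def
proof (rule the_equality)
  obtain pd where pd: "col_reduced d 0 pd" "lz_den d i pd \<noteq> (0::complex)"
    using lz_den_nonzero_reduced[OF i] by metis
  have fr: "(lz_num d i, lz_den d i) \<in> frac d"
    unfolding frac_def using pd(2) polyfun_lz_num polyfun_lz_den by blast
  have L: "p \<in> Lset d (i - 1) \<longleftrightarrow> col_reduced d (d + 1 - i) p" for p
  proof -
    have "i - 1 \<le> d" "d - (i - 1) = d + 1 - i" using i by auto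
    then show ?thesis using Lset_col_reduced[of "i - 1" d p] by simp
  qed
  show "\<exists>P Q. (P, Q) \<in> frac d \<and> ratclass d (lz_num d i) (lz_den d i) = ratclass d P Q \<and>
       (\<forall>A::nat \<Rightarrow> nat \<Rightarrow> complex. orth d A \<longrightarrow> (\<forall>p. P (act d A p) * Q p = P p * Q (act d A p))) \<and>
       (\<exists>(P', Q') \<in> ratclass d (lz_num d i) (lz_den d i). (\<exists>p\<in>Lset d (i - 1). Q' p \<noteq> 0) \<and>
           (\<forall>p\<in>Lset d (i - 1). P' p = target d i p * Q' p))"
  proof (intro exI conjI)
    show "(lz_num d i, lz_den d i) \<in> frac d" by fact
    show "\<forall>A::nat \<Rightarrow> nat \<Rightarrow> complex. orth d A \<longrightarrow>
        (\<forall>p. lz_num d i (act d A p) * lz_den d i p = lz_num d i p * lz_den d i (act d A p))"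
      by (simp add: lz_invariant)
    show "\<exists>(P', Q') \<in> ratclass d (lz_num d i) (lz_den d i). (\<exists>p\<in>Lset d (i - 1). Q' p \<noteq> 0) \<and>
           (\<forall>p\<in>Lset d (i - 1). P' p = target d i p * Q' p)"
    proof (rule bexI[of _ "(lz_num d i, lz_den d i)"])
      show "(lz_num d i, lz_den d i) \<in> ratclass d (lz_num d i) (lz_den d i)"
        using fr by (simp add: ratclass_def)
      show "case (lz_num d i, lz_den d i) of (P', Q') \<Rightarrow> (\<exists>p\<in>Lset d (i - 1). Q' p \<noteq> 0) \<and>
           (\<forall>p\<in>Lset d (i - 1). P' p = target d i p * Q' p)"
        using pd col_reduced_mono[OF pd(1)] lz_num_reduced[OF i] by (auto simp: L target_col_norm[OF i])
    qed
  qed simp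
next
  fix C
  assume "\<exists>P Q. (P, Q) \<in> frac d \<and> C = ratclass d P Q \<and>
       (\<forall>A::nat \<Rightarrow> nat \<Rightarrow> complex. orth d A \<longrightarrow> (\<forall>p. P (act d A p) * Q p = P p * Q (act d A p))) \<and>
       (\<exists>(P', Q') \<in> C. (\<exists>p\<in>Lset d (i - 1). Q' p \<noteq> 0) \<and>
           (\<forall>p\<in>Lset d (i - 1). P' p = target d i p * Q' p))"
  then obtain P0 Q0 where P0: "(P0, Q0) \<in> frac d" "C = ratclass d P0 Q0"
    "\<forall>A::nat \<Rightarrow> nat \<Rightarrow> complex. orth d A \<longrightarrow> (\<forall>p. P0 (act d A p) * Q0 p = P0 p * Q0 (act d A p))"
    and ex: "\<exists>(P', Q') \<in> C. (\<exists>p\<in>Lset d (i - 1). Q' p \<noteq> 0) \<and>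
           (\<forall>p\<in>Lset d (i - 1). P' p = target d i p * Q' p)"
    by (elim exE conjE)
  from ex obtain z where z: "z \<in> C" "case z of (P', Q') \<Rightarrow> (\<exists>p\<in>Lset d (i - 1). Q' p \<noteq> 0) \<and>
           (\<forall>p\<in>Lset d (i - 1). P' p = target d i p * Q' p)" by (elim bexE)
  obtain P Q where PQ: "z = (P, Q)" by (cases z)
  from z(2) obtain q0 where q0: "q0 \<in> Lset d (i - 1)" "Q q0 \<noteq> 0"
    and slice: "\<forall>p\<in>Lset d (i - 1). P p = target d i p * Q p" unfolding PQ by blast
  have "(P, Q) \<in> ratclass d P0 Q0" using z(1) P0(2) PQ by simp
  from invariant_extension_unique[OF i P0(1) _ this q0] P0(3) slice
  show "C = ratclass d (lz_num d i) (lz_den d i)" unfolding P0(2) by blast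
qed

section \<open>The cross-section and the moving frame\<close>

lemma Kset_iff:
  assumes "d \<ge> 1"
  shows "p \<in> Kset d \<longleftrightarrow> col_reduced d 0 p \<and> (\<forall>k\<in>{1..d}. ext_col d p (Suc k) k > 0)"
proof
  assume K: "p \<in> Kset d"
  have "ext_col d p l k = 0" if "l \<le> Suc d" "1 \<le> k" "Suc k < l" for l k
  proof (cases "l = Suc d")
    case True
    then show ?thesis using K that by (auto simp: Kset_def ext_col_def)
  next
    case False
    then have "l - 1 \<in> {1..d-1}" "k \<in> {1..<l-1}" "l - 1 + 1 = l" using that by auto
    then have "snd p k l = 0" using K unfolding Kset_def by (metis (mono_tags, lifting) mem_Collect_eq)
    then show ?thesis using False that by (simp add: ext_col_def skew_def)
  qed
  moreover have "ext_col d p (Suc k) k > 0" if "k \<in> {1..d}" for k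
  proof (cases "k = d")
    case True
    then show ?thesis using K by (simp add: Kset_def ext_col_def)
  next
    case False
    then have "k \<in> {1..d-1}" using that by auto
    then have "snd p k (k + 1) > 0" using K by (simp add: Kset_def)
    then show ?thesis using False by (simp add: ext_col_def skew_def Suc_eq_plus1)
  qed
  ultimately show "col_reduced d 0 p \<and> (\<forall>k\<in>{1..d}. ext_col d p (Suc k) k > 0)"
    by (simp add: col_reduced_def)
next
  assume R: "col_reduced d 0 p \<and> (\<forall>k\<in>{1..d}. ext_col d p (Suc k) k > 0)"
  have z: "ext_col d p l k = 0" if "l \<le> Suc d" "1 \<le> k" "Suc k < l" for l k
    using R that by (auto simp: col_reduced_def)
  show "p \<in> Kset d" unfolding Kset_def mem_Collect_eq
  proof (intro conjI ballI)
    show "fst p i = 0" if "i \<in> {1..d-1}" for i using z[of "Suc d" i] that by (auto simp: ext_col_def)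
    show "snd p j (i + 1) = 0" if "i \<in> {1..d-1}" "j \<in> {1..<i}" for i j
    proof -
      have "i + 1 \<le> Suc d" "1 \<le> j" "Suc j < i + 1" "i + 1 \<noteq> Suc d" "j < i + 1" using that by auto
      then show ?thesis using z[of "i + 1" j] by (simp add: ext_col_def skew_def)
    qed
    show "fst p d > 0" using R assms by (auto simp: ext_col_def dest!: bspec[of _ _ d])
    show "snd p i (i + 1) > 0" if "i \<in> {1..d-1}" for i
    proof -
      have "ext_col d p (Suc i) i > 0" "Suc i \<noteq> Suc d" using R that by auto
      then show ?thesis by (simp add: ext_col_def skew_def Suc_eq_plus1)
    qed
  qed
qed

lemma Kset_cong:
  assumes "\<And>i. i \<in> {1..d} \<Longrightarrow> fst p i = fst q i"
    "\<And>i j. 1 \<le> i \<Longrightarrow> i < j \<Longrightarrow> j \<le> d \<Longrightarrow> snd p i j = snd q i j" "p \<in> Kset d" "d \<ge> 1"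
  shows "q \<in> Kset d"
proof -
  have "fst p i = fst q i" if "i \<in> {1..d-1}" for i using that assms(1) by auto
  moreover have "fst p d = fst q d" using assms by auto
  moreover have "snd p j (i + 1) = snd q j (i + 1)" if "i \<in> {1..d-1}" "1 \<le> j" "j \<le> i" for i j
    using that assms(2) by auto
  ultimately show ?thesis using assms(3) by (auto simp: Kset_def)
qed

text \<open>Reduction yields nonnegative entries next to the diagonal; their squares are the values
  of the f_i, which are nonzero on \<open>Uset\<close>, so the entries are positive.\<close>

lemma frame_exists:
  assumes U: "p \<in> Uset d" and d: "d \<ge> 1"
  shows "\<exists>g. orth_real d g \<and> act d g p \<in> Kset d"
proof -
  obtain A where A: "orth d A" "col_reduced d 0 (act d A p)"
    "\<forall>l\<in>{2..Suc d}. ext_col d (act d A p) l (l - 1) \<ge> 0"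
    using real_reduction[of d d p] by (auto simp: numeral_2_eq_2)
  let ?c = "cplx_pt p" and ?q = "cplx_pt (act d A p)"
  have red: "col_reduced d m ?q" for m using col_reduced_mono[OF A(2), of m] by (simp add: col_reduced_cplx)
  \<comment> \<open>A representative P, Q nonzero at the point only gives
    \<open>lz_num * Q = P * lz_den\<close> there, hence an implication; \<open>lz_nonzero\<close>
    then removes its premise.\<close>
  have num: "lz_num d i ?c \<noteq> 0" if i: "i \<in> {1..d}" and den: "lz_den d i ?c \<noteq> 0" for i
  proof -
    obtain P Q where "(P, Q) \<in> ratclass d (lz_num d i) (lz_den d i)" "Q ?c \<noteq> 0" "P ?c \<noteq> 0"
      using U i unfolding Uset_def f_def_nonzero_def fclass_eq[OF i, symmetric] by blast
    then show ?thesis using den unfolding ratclass_def by (metis (mono_tags, lifting) case_prodD mem_Collect_eq mult_eq_0_iff)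
  qed
  have "ext_col d (act d A p) (Suc k) k > 0" if k: "k \<in> {1..d}" for k
  proof -
    define i where "i = d + 1 - k"
    have i: "i \<in> {1..d}" "d + 2 - i = Suc k" "d + 1 - i = k" using k by (auto simp: i_def)
    have "i \<le> d" "i - 1 \<le> d" using i by auto
    from lz_nonzero[OF num this(1)] lz_nonzero[OF num this(2)]
    have "lz_scale d ?c i \<noteq> 0 \<and> lz_norm d ?c (i - 1) \<noteq> 0" by simp
    then have "lz_num d i ?c \<noteq> 0" using num i by (simp add: lz_den_def)
    moreover have "lz_num d i ?q = lz_num d i ?c"
      using lz_invariant(1)[OF orth_cplx[OF A(1)], of i ?c] by (simp add: act_cplx)
    ultimately have "col_norm d i ?q \<noteq> 0" using lz_num_reduced[OF i(1) red] by auto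
    then have "ext_col d ?q (Suc k) k \<noteq> 0" using col_norm_reduced[OF i(1) red] i by auto
    then have "ext_col d (act d A p) (Suc k) k \<noteq> 0" by (simp add: ext_col_cplx)
    then show ?thesis using A(3) k by (force dest!: bspec[of _ _ "Suc k"])
  qed
  then have K: "act d A p \<in> Kset d" using A(2) by (simp add: Kset_iff[OF d])
  \<comment> \<open>Entries outside the index range are cleared, as \<open>orth_real\<close> demands
    for unique representatives.\<close>
  define g where "g = (\<lambda>i j. if i \<in> {1..d} \<and> j \<in> {1..d} then A i j else 0)"
  have gA: "g i j = A i j" if "i \<in> {1..d}" "j \<in> {1..d}" for i j using that by (auto simp: g_def)
  have "orth_real d g" using A(1) unfolding orth_real_def orth_def
    by (auto simp: gA g_def)
  moreover have "act d g p \<in> Kset d"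
  proof (rule Kset_cong[OF _ _ K d])
    show "fst (act d A p) i = fst (act d g p) i" if "i \<in> {1..d}" for i
      using that by (simp add: act_def gA)
    show "snd (act d A p) i j = snd (act d g p) i j" if "1 \<le> i" "i < j" "j \<le> d" for i j
      using that by (simp add: act_def gA)
  qed
  ultimately show ?thesis by blast
qed

text \<open>At the normal form the vector w_{i+1} is a positive multiple of the unit vector d - i,
  and it equals g applied to w_{i+1} of p. Applying the transpose of g identifies row d - i of g;
  since the right-hand side does not mention g, uniqueness follows.\<close>

lemma frame_row:
  fixes p :: "real pt"
  assumes d: "d \<ge> 1" and g: "orth d g" and K: "act d g p \<in> Kset d" and i: "Suc i \<le> d" and l: "l \<in> {1..d}"
  shows "g (d - i) l = lz_vec d p (Suc i) l / sqrt (lz_norm d p (Suc i))"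
proof -
  let ?q = "act d g p"
  have red: "col_reduced d m ?q" for m
    using K col_reduced_mono[of d 0 ?q m] by (simp add: Kset_iff[OF d])
  have pos: "ext_col d ?q (Suc k) k > 0" if "k \<in> {1..d}" for k using K that by (simp add: Kset_iff[OF d])
  have "lz_num d j ?q \<noteq> 0" if j: "j \<in> {1..d}" and "lz_den d j ?q \<noteq> 0" for j
  proof -
    have "d + 2 - j = Suc (d + 1 - j)" "d + 1 - j \<in> {1..d}" using j by auto
    then have "col_norm d j ?q \<noteq> 0"
      using col_norm_reduced[OF j red] pos[of "d + 1 - j"] by simp
    then show ?thesis using lz_num_reduced[OF j red] that by simp
  qed
  then have nz: "lz_norm d ?q j \<noteq> 0 \<and> lz_scale d ?q j \<noteq> 0" if "j \<le> d" for j using lz_nonzero[of d ?q j] that by blast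
  have npos: "lz_norm d ?q j > 0" if "j \<le> d" for j
  proof -
    have "lz_norm d ?q j \<ge> 0" by (auto simp: lz_norm_def intro!: sum_nonneg)
    then show ?thesis using nz[OF that] by linarith
  qed
  \<comment> \<open>Positive scales rule out a sign ambiguity of the row: from index 2 on each is a
    square times a norm.\<close>
  have spos: "lz_scale d ?q j > 0" if "j \<le> d" for j
  proof -
    consider "j = 0" | "j = 1" | j' where "j = Suc (Suc j')" by (metis One_nat_def not0_implies_Suc)
    then show ?thesis
    proof cases
      case 3
      then show ?thesis using npos[of j'] nz[of "Suc j'"] that
        by (simp add: lz_scale_simps zero_less_mult_iff)
    qed (simp_all add: lz_scale_simps One_nat_def)
  qed
  have v: "lz_vec d ?q (Suc j) k = (if k = d - j then lz_factor d ?q (Suc j) * ext_col d ?q (Suc (d - j)) (d - j) else 0)"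
    if "Suc j \<le> d" "k \<in> {1..d}" for j k
  proof -
    have "ext_col d ?q (Suc (d - j)) k = 0" if "k < d - j"
      using red[of 0] that \<open>Suc j \<le> d\<close> \<open>k \<in> {1..d}\<close> by (auto simp: col_reduced_def)
    then show ?thesis using lz_vec_reduced[OF that(1) red] that by auto
  qed
  have vpos: "lz_vec d ?q (Suc j) (d - j) > 0" if "Suc j \<le> d" for j
    using that
  proof (induction j)
    case 0
    then show ?case using v[of 0 d] pos[of d] by (simp add: One_nat_def)
  next
    case (Suc j)
    have "lz_factor d ?q (Suc (Suc j)) > 0" using Suc spos[of "Suc j"] npos[of j] by simp
    moreover have "ext_col d ?q (Suc (d - Suc j)) (d - Suc j) > 0" using Suc.prems by (intro pos) auto
    ultimately show ?case using v[of "Suc j" "d - Suc j"] Suc.prems by auto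
  qed
  define \<kappa> where "\<kappa> = lz_vec d ?q (Suc i) (d - i)"
  have kap: "lz_vec d ?q (Suc i) k = (if k = d - i then \<kappa> else 0)" if "k \<in> {1..d}" for k
    using v[OF i that] v[OF i, of "d - i"] i by (auto simp: \<kappa>_def)
  have di: "d - i \<in> {1..d}" using i by auto
  have "lz_norm d ?q (Suc i) = (\<Sum>k\<in>{1..d}. if k = d - i then \<kappa>\<^sup>2 else 0)"
    unfolding lz_norm_def if_not_P[OF nat.discI[OF refl]] by (rule sum.cong[OF refl]) (simp add: kap)
  then have nrm: "lz_norm d p (Suc i) = \<kappa>\<^sup>2" using di lz_act[OF g, of p "Suc i"] by simp
  have "(\<Sum>k\<in>{1..d}. g k l * lz_vec d ?q (Suc i) k) = lz_vec d p (Suc i) l"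
  proof -
    have "(\<Sum>k\<in>{1..d}. g k l * lz_vec d ?q (Suc i) k) =
        (\<Sum>k\<in>{1..d}. \<Sum>m\<in>{1..d}. lz_vec d p (Suc i) m * (g k l * g k m))"
      using lz_act[OF g, of p "Suc i"] by (simp add: sum_distrib_left mult_ac)
    also have "\<dots> = (\<Sum>m\<in>{1..d}. lz_vec d p (Suc i) m * (\<Sum>k\<in>{1..d}. g k l * g k m))"
      by (subst sum.swap) (simp add: sum_distrib_left)
    also have "\<dots> = (\<Sum>m\<in>{1..d}. if m = l then lz_vec d p (Suc i) l else 0)"
      by (rule sum.cong[OF refl]) (use orth_colD[OF g l] in auto)
    finally show ?thesis using l by simp
  qed
  moreover have "(\<Sum>k\<in>{1..d}. g k l * lz_vec d ?q (Suc i) k) = (\<Sum>k\<in>{1..d}. if k = d - i then g (d - i) l * \<kappa> else 0)"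
    by (rule sum.cong[OF refl]) (simp add: kap)
  ultimately have "lz_vec d p (Suc i) l = g (d - i) l * \<kappa>" using di by simp
  then show ?thesis using vpos[OF i] by (simp add: nrm \<kappa>_def)
qed

lemma frame_unique:
  assumes d: "d \<ge> 1" and g: "orth_real d g" "act d g p \<in> Kset d" and h: "orth_real d h" "act d h p \<in> Kset d"
  shows "g = h"
proof (intro ext)
  fix r l
  show "g r l = h r l"
  proof (cases "r \<in> {1..d} \<and> l \<in> {1..d}")
    case True
    then have "Suc (d - r) \<le> d" "d - (d - r) = r" by auto
    then show ?thesis
      using frame_row[OF d _ g(2), of "d - r" l] frame_row[OF d _ h(2), of "d - r" l] g(1) h(1) True
      by (simp add: orth_real_def)
  next
    case False
    then show ?thesis using g(1) h(1) by (auto simp: orth_real_def)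
  qed
qed

lemma rho_frame:
  assumes "p \<in> Uset d" "d \<ge> 1"
  shows "orth_real d (rho d p)" "act d (rho d p) p \<in> Kset d"
proof -
  have "\<exists>!g. orth_real d g \<and> act d g p \<in> Kset d"
    using frame_exists[OF assms] frame_unique[OF assms(2)] by blast
  from theI'[OF this] show "orth_real d (rho d p)" "act d (rho d p) p \<in> Kset d"
    by (auto simp: rho_def)
qed

section \<open>Matrix products acting on paths, and the equivalence itself\<close>

lemma path_act_matmul: "path_act d g (path_act d h Z) = path_act d (matmul d g h) Z"
  unfolding path_act_def matmul_def
  by (intro ext) (simp add: sum_distrib_left sum_distrib_right mult.assoc, rule sum.swap)

lemma orth_real_matmul:
  assumes "orth_real d g" "orth_real d h"
  shows "orth_real d (matmul d g h)"
proof -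
  have "matmul d g h i j = 0" if "i \<notin> {1..d} \<or> j \<notin> {1..d}" for i j
    using assms that unfolding matmul_def orth_real_def by (intro sum.neutral) auto
  moreover have "orth d (matmul d g h)" using assms by (intro orth_matmul) (simp_all add: orth_real_def)
  ultimately show ?thesis unfolding orth_real_def by blast
qed

lemma orth_real_transpose: "orth_real d g \<Longrightarrow> orth_real d (\<lambda>i j. g j i)"
  unfolding orth_real_def using orth_transpose by blast

lemma act_cong:
  assumes "\<And>i. i \<in> {1..d} \<Longrightarrow> fst p i = fst q i"
    "\<And>i j. i \<in> {1..d} \<Longrightarrow> j \<in> {1..d} \<Longrightarrow> snd p i j = snd q i j"
  shows "act d A p = act d A q"
proof -
  have "skew (snd p) k l = skew (snd q) k l" if "k \<in> {1..d}" "l \<in> {1..d}" for k l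
    using assms(2) that by (simp add: skew_def)
  then show ?thesis using assms(1) by (simp add: act_def)
qed

text \<open>The product is the identity matrix only on the index range, which is all that words over
  {1..d} see.\<close>

lemma path_act_orth_inverse:
  assumes "orth d g"
  shows "sig_eq d (path_act d (matmul d (\<lambda>i j. g j i) g) Z) Z"
proof (rule sig_eq_cong)
  fix t i assume i: "i \<in> {1..d}"
  have "path_act d (matmul d (\<lambda>i j. g j i) g) Z t i = (\<Sum>k\<in>{1..d}. if k = i then Z t i else 0)"
    unfolding path_act_def
    by (rule sum.cong[OF refl]) (use orth_colD[OF assms i] in \<open>auto simp: matmul_def\<close>)
  then show "path_act d (matmul d (\<lambda>i j. g j i) g) Z t i = Z t i" using i by simp
qed

theorem theorem4p5:
  fixes d :: nat and Z Zt :: "real \<Rightarrow> nat \<Rightarrow> real"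
  assumes "d \<ge> 2"
    and "abs_cont_path d Z" and "abs_cont_path d Zt"
    and "logsig2 Z \<in> Uset d" and "logsig2 Zt \<in> Uset d"
  shows "sig_eq d (path_act d (rho d (logsig2 Z)) Z) (path_act d (rho d (logsig2 Zt)) Zt)
     \<longleftrightarrow> (\<exists>g. orth_real d g \<and> sig_eq d (path_act d g Z) Zt)"
proof -
  have d: "d \<ge> 1" using assms(1) by simp
  define r where "r = rho d (logsig2 Z)"
  define r' where "r' = rho d (logsig2 Zt)"
  have r: "orth_real d r" "act d r (logsig2 Z) \<in> Kset d"
    using rho_frame[OF assms(4) d] by (auto simp: r_def)
  have r': "orth_real d r'" "act d r' (logsig2 Zt) \<in> Kset d"
    using rho_frame[OF assms(5) d] by (auto simp: r'_def)
  have reg: "regular_path d Z" "regular_path d Zt" using assms by (auto intro: abs_cont_regular_path)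
  show ?thesis unfolding r_def[symmetric] r'_def[symmetric]
  proof
    assume eq: "sig_eq d (path_act d r Z) (path_act d r' Zt)"
    \<comment> \<open>The matrix sought is r'^T r: the transpose undoes the frame of
      \<open>Zt\<close>.\<close>
    let ?T = "\<lambda>i j. r' j i"
    have "sig_eq d (path_act d ?T (path_act d r Z)) (path_act d ?T (path_act d r' Zt))"
      by (rule sig_eq_path_act[OF regular_path_act regular_path_act eq]) (rule reg)+
    then have "sig_eq d (path_act d (matmul d ?T r) Z) (path_act d (matmul d ?T r') Zt)"
      by (simp add: path_act_matmul)
    moreover have "sig_eq d (path_act d (matmul d ?T r') Zt) Zt"
      using r' by (intro path_act_orth_inverse) (simp add: orth_real_def)
    ultimately have "sig_eq d (path_act d (matmul d ?T r) Z) Zt" by (simp add: sig_eq_def)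
    then show "\<exists>g. orth_real d g \<and> sig_eq d (path_act d g Z) Zt"
      using orth_real_matmul[OF orth_real_transpose[OF r'(1)] r(1)] by blast
  next
    assume "\<exists>g. orth_real d g \<and> sig_eq d (path_act d g Z) Zt"
    then obtain g where g: "orth_real d g" "sig_eq d (path_act d g Z) Zt" by blast
    have "sig (path_act d g Z) [i] = sig Zt [i]" "sig (path_act d g Z) [i, j] = sig Zt [i, j]"
      if "i \<in> {1..d}" "j \<in> {1..d}" for i j
      using g(2) that by (auto simp: sig_eq_def)
    \<comment> \<open>Equal signatures give equality of \<open>logsig2\<close> on the index range
      only, which is enough under \<open>act\<close>.\<close>
    then have "act d r' (logsig2 (path_act d g Z)) = act d r' (logsig2 Zt)"
      by (intro act_cong) (simp_all add: logsig2_fst logsig2_snd)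
    then have "act d (matmul d r' g) (logsig2 Z) \<in> Kset d"
      using r'(2) by (simp add: logsig2_path_act[OF assms(2)] act_matmul)
    \<comment> \<open>The product r' g also moves \<open>logsig2 Z\<close> into the cross-section,
      so it is the frame of \<open>Z\<close>.\<close>
    then have "r = matmul d r' g"
      by (rule frame_unique[OF d r orth_real_matmul[OF r'(1) g(1)]])
    then show "sig_eq d (path_act d r Z) (path_act d r' Zt)"
      using sig_eq_path_act[OF regular_path_act[OF reg(1)] reg(2) g(2), of r']
      by (simp add: path_act_matmul)
  qed
qed

end
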